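(* For each choice of sign $\pm$, the system of equations for the extended CMC hierarchy, $$d\hat{\mathbf Y}+[\Phi_\pm,\hat{\mathbf Y}]=0,\qquad d\hat{\mathcal S}_\pm+[\Phi_\pm,\hat{\mathcal S}_\pm]=0,\qquad d\Phi_\pm+\tfrac12[\Phi_\pm,\Phi_\pm]=0,$$ is compatible, i.e. $d^2=0$ is a formal consequence of the structure equations: regarding these equations as prescribing the exterior derivatives of the coefficients of $\mathbf Y,\mathcal S,u_\pm$ and of the 1-forms $\rho$ and $\sigma_k$ (resp. $\bar\sigma_\ell$), with $d(dt_m)=d(d\bar t_m)=0$, the exterior derivative of each equation vanishes identically modulo the equations themselves.
   Context: Conventions. $N\ge0$ is a fixed integer, $\gamma$ a fixed nonzero constant with $\bar\gamma=\gamma$, $\mathrm i=\sqrt{-1}$, $\lambda$ a formal parameter. A dot denotes the Euler operator $\mathcal D=\lambda\,\partial/\partial\lambda$, $\dot A=\mathcal D A$. The bar is formal complex conjugation extended by $\bar\lambda=\lambda^{-1}$; $\bar A^t$ is the conjugate transpose. $\boldsymbol{\mathfrak g}$ is the twisted loop algebra of formal Laurent series (finitely many negative powers) in $\mathfrak{sl}(2,\mathbb C)((\lambda))$ with even diagonal and odd off-diagonal entries; $\boldsymbol{\mathfrak g}_{\ge k}$, $\boldsymbol{\mathfrak g}_{\le k}$ consist of the series with only powers $\ge k$, $\le k$. Affine Kac-Moody algebras. $\mathcal V\mathrm{ir}^+_{N+1}$ is spanned by the derivations $\partial_{\bar\sigma_\ell}=-\lambda^{2\ell}\mathcal D$, $\ell\ge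 N+1$, and $\mathcal V\mathrm{ir}^-_{N+1}$ by $\partial_{\sigma_k}=\lambda^{-2k}\mathcal D$, $k\ge N+1$. $\hat{\boldsymbol{\mathfrak g}}^\pm_{N+1}=\mathcal V\mathrm{ir}^\pm_{N+1}\ltimes\boldsymbol{\mathfrak g}$; a pair $(f,A)$ denotes $f\mathcal D+A$, with bracket $[(f,A),(g,B)]=(f\dot g-g\dot f,\ [A,B]+f\dot B-g\dot A)$, extended to forms by the usual graded rule. Infinite sums are treated formally. Unknowns. Functions $a^{2n+1},b^{2n+2},c^{2n+2}$ ($n\ge0$; superscripts are indices), with $b^2=-\mathrm i\gamma h_2^{-1/2}$, $c^2=\mathrm ih_2^{1/2}$ for a nowhere zero function $h_2$; $\mathbf a=\sum\lambda^{2n}a^{2n+1}$, $\mathbf b=\sum\lambda^{2n+1}b^{2n+2}$, $\mathbf c=\sum\lambda^{2n+1}c^{2n+2}$, and $$\mathbf Y=\begin{pmatrix}-\mathrm i\mathbf a&2\mathbf c\\2\mathbf b&\mathrm i\mathbf a\end{pmatrix};$$ a $\boldsymbol{\mathfrak g}$-valued function $\mathcal S$ with only powers $\lambda^j$, $j\ge-(2N+1)$; scalar conformal factors $u_\pm$ with $e^{u_\pm}\in\lambda^{\pm(2N+2)}\mathbb C[[\lambda^{\pm2}]]$ with function coefficients; a real 1-form $\rho$, 1-forms $\sigma_k$ ($k\ge N+1$) in the $-$ case and $\bar\sigma_\ell$ ($\ell\ge N+1$) in the $+$ case, and $dt_m,d\bar t_m$ ($0\le m\le N$), all linearly independent. The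 algebraic relations $\det\mathbf Y=-4\gamma\lambda^2$ and $[\mathcal S,\mathbf Y]=\mathbf Y-\dot{\mathbf Y}$ (and conjugates) are imposed. Decompositions: $\frac1{2\mathrm i}\lambda^{-(2m+2)}\mathbf Y=U_m+U_{(m+1)}$ and $\lambda^{-2k}\mathcal S=\mathcal S_k+\mathcal S_{(k+1)}$, with $U_m,\mathcal S_k\in\boldsymbol{\mathfrak g}_{\le-1}$ and $U_{(m+1)},\mathcal S_{(k+1)}\in\boldsymbol{\mathfrak g}_{\ge0}$. Put $$\phi=-\sum_{m=0}^N\bar U^t_m\,d\bar t_m+\phi_0+\sum_{m=0}^NU_m\,dt_m,$$ $\phi_0$ diagonal with entries $\frac{\mathrm i}2\rho,-\frac{\mathrm i}2\rho$. Then $$\hat{\mathbf Y}=(0,\lambda^{-1}\mathbf Y),\quad \hat{\mathcal S}_\pm=(e^{u_\pm},e^{u_\pm}\mathcal S),\quad \Phi_\pm=(\boldsymbol\sigma_\pm,\hat\phi_\pm),$$ $$\boldsymbol\sigma_+=-\sum_{\ell\ge N+1}\lambda^{2\ell}\bar\sigma_\ell,\quad \boldsymbol\sigma_-=\sum_{k\ge N+1}\lambda^{-2k}\sigma_k,\quad \hat\phi_+=\phi-\sum_{\ell\ge N+1}\bar{\mathcal S}^t_\ell\,\bar\sigma_\ell,\quad \hat\phi_-=\phi+\sum_{k\ge N+1}\mathcal S_k\,\sigma_k .$$ Writing $(u,\boldsymbol\sigma,\hat\phi)$ for $(u_\pm,\boldsymbol\sigma_\pm,\hat\phi_\pm)$,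 the system is equivalent to $$d\mathbf Y+[\hat\phi,\mathbf Y]+(\dot{\mathbf Y}-\mathbf Y)\boldsymbol\sigma=0,\quad d\mathcal S+[\hat\phi,\mathcal S]+\mathcal S\dot{\boldsymbol\sigma}+\dot{\mathcal S}\boldsymbol\sigma=\dot{\hat\phi},\quad du=\dot{\boldsymbol\sigma}-\dot u\,\boldsymbol\sigma,$$ $$d\boldsymbol\sigma+\boldsymbol\sigma\wedge\dot{\boldsymbol\sigma}=0,\quad d\hat\phi+\hat\phi\wedge\hat\phi=\dot{\hat\phi}\wedge\boldsymbol\sigma,$$ and it is understood together with the equations for the formal conjugate transposes, $$d\bar{\mathbf Y}^t+[\hat\phi,\bar{\mathbf Y}^t]+(\dot{(\bar{\mathbf Y}^t)}+\bar{\mathbf Y}^t)\boldsymbol\sigma=0,\quad d\bar{\mathcal S}^t+[\hat\phi,\bar{\mathcal S}^t]+\bar{\mathcal S}^t\dot{\boldsymbol\sigma}+\dot{(\bar{\mathcal S}^t)}\boldsymbol\sigma=\dot{\hat\phi}.$$ *)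

theory Defs
  imports "HOL-Analysis.Analysis" "HOL-Library.Poly_Mapping"
begin

text \<open>
  The unknown functions are indeterminates. The arguments of the first three constructors
  are the superscripts of \<open>a\<^sup>2\<^sup>n\<^sup>+\<^sup>1\<close>, \<open>b\<^sup>2\<^sup>n\<^sup>+\<^sup>2\<close>, \<open>c\<^sup>2\<^sup>n\<^sup>+\<^sup>2\<close>; those of the next three are the powers of
  \<open>\<lambda>\<close> which the entries of \<open>S\<close> multiply; \<open>ECoef n\<close> is the \<open>n\<close>-th coefficient of the conformal factor
  \<open>exp u\<close>. Indices of the wrong parity or range never occur in what follows.

  \<open>h\<^sub>2\<close> is not a separate indeterminate: its square root is recovered as \<open>- \<i> c\<^sup>2\<close>. The relations
  below contain \<open>a\<^sup>1\<close> and the \<open>\<lambda>\<^sup>2\<close>-coefficient of \<open>det Y + 4 \<gamma> \<lambda>\<^sup>2\<close>, hence \<open>b\<^sup>2 c\<^sup>2 = \<gamma>\<close> modulo them;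
  so this square root is a unit and \<open>b\<^sup>2 = - \<i> \<gamma> h\<^sub>2\<^sup>-\<^sup>1\<^sup>/\<^sup>2\<close>.
\<close>

datatype unknown = ACoef nat | BCoef nat | CCoef nat
  | SDiag int | SUpper int | SLower int | ECoef nat

datatype coord = Fn unknown | Conj unknown

type_synonym fn = "(coord \<Rightarrow>\<^sub>0 nat) \<Rightarrow>\<^sub>0 complex"

definition const :: "complex \<Rightarrow> fn" where
  "const z = Poly_Mapping.single 0 z"

definition var :: "coord \<Rightarrow> fn" where
  "var x = Poly_Mapping.single (Poly_Mapping.single x 1) 1"

fun conj_coord :: "coord \<Rightarrow> coord" where
  "conj_coord (Fn x) = Conj x"
| "conj_coord (Conj x) = Fn x"

definition bar :: "fn \<Rightarrow> fn" where
  "bar p = Poly_Mapping.map cnj (Poly_Mapping.map_key (Poly_Mapping.map_key conj_coord) p)"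

text \<open>
  A series is its coefficient function; it may be infinite in both directions, because
  \<open>Y\<close> and its conjugate transpose extend in opposite directions. In every product formed below,
  either one factor has finite support or both are bounded on the same side, so that
  the sums over finite support in \<open>sprod\<close>, \<open>smprod\<close>, \<open>mprod\<close> are the usual Cauchy products.
\<close>

type_synonym series = "int \<Rightarrow> fn"
type_synonym mat2 = "fn ^ 2 ^ 2"
type_synonym mseries = "int \<Rightarrow> mat2"

definition mat2 :: "fn \<Rightarrow> fn \<Rightarrow> fn \<Rightarrow> fn \<Rightarrow> mat2" where
  "mat2 p q r s = vector [vector [p, q], vector [r, s]]"

definition sprod :: "series \<Rightarrow> series \<Rightarrow> series" where
  "sprod f g n = Sum_any (\<lambda>i. f i * g (n - i))"

definition smprod :: "series \<Rightarrow> mseries \<Rightarrow> mseries" where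
  "smprod f A n = Sum_any (\<lambda>i. mat (f i) ** A (n - i))"

definition mprod :: "mseries \<Rightarrow> mseries \<Rightarrow> mseries" where
  "mprod A B n = Sum_any (\<lambda>i. A i ** B (n - i))"

definition lie :: "mseries \<Rightarrow> mseries \<Rightarrow> mseries" where
  "lie A B n = mprod A B n - mprod B A n"

definition euler :: "series \<Rightarrow> series" where
  "euler f n = of_int n * f n"

definition meuler :: "mseries \<Rightarrow> mseries" where
  "meuler A n = mat (of_int n) ** A n"

definition shift :: "int \<Rightarrow> mseries \<Rightarrow> mseries" where
  "shift k A n = A (n - k)"

definition neg_part :: "mseries \<Rightarrow> mseries" where
  "neg_part A n = (if n \<le> - 1 then A n else 0)"

definition mdet :: "mseries \<Rightarrow> series" where
  "mdet A n = sprod (\<lambda>i. A i $ 1 $ 1) (\<lambda>i. A i $ 2 $ 2) n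
            - sprod (\<lambda>i. A i $ 1 $ 2) (\<lambda>i. A i $ 2 $ 1) n"

text \<open>The index changes sign because \<open>\<lambda>\<close> is conjugated to its inverse.\<close>

definition adj :: "mseries \<Rightarrow> mseries" where
  "adj A n = (\<chi> i j. bar (A (- n) $ j $ i))"

datatype sgn = Plus | Minus

definition Y_ser :: mseries where
  "Y_ser n =
    (if n < 0 then 0
     else if even n
     then mat2 (const (- \<i>) * var (Fn (ACoef (nat n + 1)))) 0
               0 (const \<i> * var (Fn (ACoef (nat n + 1))))
     else mat2 0 (2 * var (Fn (CCoef (nat n + 1))))
               (2 * var (Fn (BCoef (nat n + 1)))) 0)"

definition S_ser :: "nat \<Rightarrow> mseries" where
  "S_ser N n =
    (if n < - (2 * int N + 1) then 0
     else if even n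
     then mat2 (var (Fn (SDiag n))) 0
               0 (- var (Fn (SDiag n)))
     else mat2 0 (var (Fn (SUpper n)))
               (var (Fn (SLower n))) 0)"

text \<open>The conformal factor \<open>exp u\<close> with \<open>u = u\<^sub>\<plusminus>\<close>: the sum of \<open>ECoef n\<close> times \<open>\<lambda>\<close> to the power
  \<open>\<plusminus> (2 N + 2 + 2 n)\<close>.\<close>

definition exp_u :: "nat \<Rightarrow> sgn \<Rightarrow> series" where
  "exp_u N s n =
    (let m = (case s of Plus \<Rightarrow> n | Minus \<Rightarrow> - n) - (2 * int N + 2) in
     if m \<ge> 0 \<and> even m then var (Fn (ECoef (nat (m div 2)))) else 0)"

text \<open>
  The ideal of the algebraic relations and their conjugates. The \<open>\<lambda>\<^sup>0\<close>-coefficient of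
  \<open>det Y = - 4 \<gamma> \<lambda>\<^sup>2\<close> is \<open>(a\<^sup>1)\<^sup>2 = 0\<close>. For functions this says \<open>a\<^sup>1 = 0\<close>, but in the
  polynomial ring \<open>a\<^sup>1\<close> has to be put into the ideal.
\<close>

definition relations :: "nat \<Rightarrow> complex \<Rightarrow> fn set" where
  "relations N \<gamma> =
     {var (Fn (ACoef 1))}
     \<union> {mdet Y_ser n + (if n = 2 then const (4 * \<gamma>) else 0) | n. True}
     \<union> {(lie (S_ser N) Y_ser n - (Y_ser n - meuler Y_ser n)) $ i $ j | n i j. True}"

definition rel_ideal :: "nat \<Rightarrow> complex \<Rightarrow> fn set" where
  "rel_ideal N \<gamma> = module.span (*) (relations N \<gamma> \<union> bar ` relations N \<gamma>)"

text \<open>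
  \<open>Sig k\<close> is \<open>\<sigma>\<^sub>k\<close> for the sign \<open>-\<close> and its bar version for the sign \<open>+\<close>. The 1-forms in \<open>coframe N\<close>
  are linearly independent and form the basis of 1-forms. A \<open>p\<close>-form is given by its components,
  i.e. its values on \<open>p\<close> elements of the dual frame; an infinite formal sum of
  \<open>\<sigma>\<^sub>k\<close> with function coefficients is thereby a 1-form.
\<close>

datatype basis_form = Rho | DT nat | DTbar nat | Sig nat

definition coframe :: "nat \<Rightarrow> basis_form set" where
  "coframe N = {Rho} \<union> DT ` {..N} \<union> DTbar ` {..N} \<union> Sig ` {N + 1..}"

type_synonym form1 = "basis_form \<Rightarrow> fn"
type_synonym form2 = "basis_form \<Rightarrow> basis_form \<Rightarrow> fn"
type_synonym form3 = "basis_form \<Rightarrow> basis_form \<Rightarrow> basis_form \<Rightarrow> fn"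

text \<open>
  A degree one derivation \<open>d\<close> on forms is given by \<open>D\<close> and \<open>T\<close>: \<open>D e p\<close> is the component of \<open>dp\<close>
  along \<open>e\<close>, and \<open>T c\<close> is the 2-form \<open>dc\<close>. It is not required that \<open>d\<close> squares to zero.
  Finiteness in the last clause makes \<open>d\<close> of an infinite sum of basis forms meaningful.
\<close>

definition exterior_derivation ::
  "nat \<Rightarrow> (basis_form \<Rightarrow> fn \<Rightarrow> fn) \<Rightarrow> (basis_form \<Rightarrow> form2) \<Rightarrow> bool" where
  "exterior_derivation N D T \<longleftrightarrow>
     (\<forall>e\<in>coframe N. (\<forall>p q. D e (p + q) = D e p + D e q) \<and>
        (\<forall>p q. D e (p * q) = D e p * q + p * D e q) \<and> (\<forall>z. D e (const z) = 0)) \<and>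
     (\<forall>c\<in>coframe N. \<forall>e\<in>coframe N. \<forall>f\<in>coframe N. T c e f = - T c f e) \<and>
     (\<forall>e\<in>coframe N. \<forall>f\<in>coframe N. finite {c \<in> coframe N. T c e f \<noteq> 0})"

definition ext0 :: "(basis_form \<Rightarrow> fn \<Rightarrow> fn) \<Rightarrow> fn \<Rightarrow> form1" where
  "ext0 D p e = D e p"

definition ext1 ::
  "nat \<Rightarrow> (basis_form \<Rightarrow> fn \<Rightarrow> fn) \<Rightarrow> (basis_form \<Rightarrow> form2) \<Rightarrow> form1 \<Rightarrow> form2" where
  "ext1 N D T \<alpha> e f = D e (\<alpha> f) - D f (\<alpha> e)
     + (\<Sum>c | c \<in> coframe N \<and> T c e f \<noteq> 0. \<alpha> c * T c e f)"

definition ext2 ::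
  "nat \<Rightarrow> (basis_form \<Rightarrow> fn \<Rightarrow> fn) \<Rightarrow> (basis_form \<Rightarrow> form2) \<Rightarrow> form2 \<Rightarrow> form3" where
  "ext2 N D T \<omega> e f g = D e (\<omega> f g) + D f (\<omega> g e) + D g (\<omega> e f)
     + (\<Sum>c | c \<in> coframe N \<and> T c e f \<noteq> 0. T c e f * \<omega> c g)
     + (\<Sum>c | c \<in> coframe N \<and> T c f g \<noteq> 0. T c f g * \<omega> c e)
     + (\<Sum>c | c \<in> coframe N \<and> T c g e \<noteq> 0. T c g e * \<omega> c f)"

definition U_neg :: "nat \<Rightarrow> mseries" where
  "U_neg m = neg_part (\<lambda>n. mat (const (1 / (2 * \<i>))) ** shift (- (2 * int m + 2)) Y_ser n)"

definition S_neg :: "nat \<Rightarrow> nat \<Rightarrow> mseries" where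
  "S_neg N k = neg_part (shift (- 2 * int k) (S_ser N))"

text \<open>The components of the 1-forms \<open>\<sigma>\<^sub>\<plusminus>\<close> and \<open>\<phi>\<^sub>\<plusminus>\<close> (with hat) along a basis form.\<close>

fun sigma :: "sgn \<Rightarrow> basis_form \<Rightarrow> series" where
  "sigma Plus (Sig l) = (\<lambda>n. if n = 2 * int l then - 1 else 0)"
| "sigma Minus (Sig k) = (\<lambda>n. if n = - 2 * int k then 1 else 0)"
| "sigma _ _ = (\<lambda>n. 0)"

fun phi_hat :: "nat \<Rightarrow> sgn \<Rightarrow> basis_form \<Rightarrow> mseries" where
  "phi_hat N s Rho = (\<lambda>n. if n = 0 then mat2 (const (\<i> / 2)) 0 0 (const (- \<i> / 2)) else 0)"
| "phi_hat N s (DT m) = U_neg m"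
| "phi_hat N s (DTbar m) = (\<lambda>n. - adj (U_neg m) n)"
| "phi_hat N Plus (Sig l) = (\<lambda>n. - adj (S_neg N l) n)"
| "phi_hat N Minus (Sig k) = S_neg N k"

text \<open>A pair \<open>(f, A)\<close> stands for \<open>f \<D> + A\<close> in the affine Kac-Moody algebra.\<close>

type_synonym km = "series \<times> mseries"

fun km_bracket :: "km \<Rightarrow> km \<Rightarrow> km" where
  "km_bracket (f, A) (g, B) =
     (\<lambda>n. sprod f (euler g) n - sprod g (euler f) n,
      \<lambda>n. lie A B n + smprod f (meuler B) n - smprod g (meuler A) n)"

definition Y_hat :: km where
  "Y_hat = (\<lambda>n. 0, shift (- 1) Y_ser)"

definition Phi_km :: "nat \<Rightarrow> sgn \<Rightarrow> basis_form \<Rightarrow> km" where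
  "Phi_km N s e = (sigma s e, phi_hat N s e)"

definition km_add :: "km \<Rightarrow> km \<Rightarrow> km" where
  "km_add X X' = (\<lambda>n. fst X n + fst X' n, \<lambda>n. snd X n + snd X' n)"

definition km_ext0 :: "(basis_form \<Rightarrow> fn \<Rightarrow> fn) \<Rightarrow> km \<Rightarrow> basis_form \<Rightarrow> km" where
  "km_ext0 D X e = (\<lambda>n. ext0 D (fst X n) e, \<lambda>n. \<chi> i j. ext0 D (snd X n $ i $ j) e)"

definition km_ext1 ::
  "nat \<Rightarrow> (basis_form \<Rightarrow> fn \<Rightarrow> fn) \<Rightarrow> (basis_form \<Rightarrow> form2) \<Rightarrow> (basis_form \<Rightarrow> km)
     \<Rightarrow> basis_form \<Rightarrow> basis_form \<Rightarrow> km" where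
  "km_ext1 N D T \<alpha> e f =
     (\<lambda>n. ext1 N D T (\<lambda>c. fst (\<alpha> c) n) e f,
      \<lambda>n. \<chi> i j. ext1 N D T (\<lambda>c. snd (\<alpha> c) n $ i $ j) e f)"

text \<open>Equality to zero modulo the algebraic relations, coefficient by coefficient.\<close>

definition vanishes :: "fn set \<Rightarrow> series \<Rightarrow> bool" where
  "vanishes I f \<longleftrightarrow> (\<forall>n. f n \<in> I)"

definition mvanishes :: "fn set \<Rightarrow> mseries \<Rightarrow> bool" where
  "mvanishes I A \<longleftrightarrow> (\<forall>n i j. A n $ i $ j \<in> I)"

definition km_vanishes :: "fn set \<Rightarrow> km \<Rightarrow> bool" where
  "km_vanishes I X \<longleftrightarrow> vanishes I (fst X) \<and> mvanishes I (snd X)"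

definition mext0 :: "(basis_form \<Rightarrow> fn \<Rightarrow> fn) \<Rightarrow> mseries \<Rightarrow> basis_form \<Rightarrow> mseries" where
  "mext0 D A e n = (\<chi> i j. ext0 D (A n $ i $ j) e)"

text \<open>
  The equation of \<open>S\<^sub>\<plusminus>\<close> (with hat) for the pair \<open>(exp u, exp u S)\<close> has the two components
  \<open>d (exp u) + \<sigma> (exp u)\<^sup>\<bullet> - exp u \<sigma>\<^sup>\<bullet> = 0\<close> and, after division by \<open>exp u\<close>,
  \<open>dS + [\<phi>, S] + S \<sigma>\<^sup>\<bullet> + S\<^sup>\<bullet> \<sigma> = \<phi>\<^sup>\<bullet>\<close>.
  It is stated through these components because for the sign \<open>-\<close> the product of
  \<open>exp u\<close>, a series in \<open>1/\<lambda>\<close>, with \<open>S\<close>, a series in \<open>\<lambda>\<close>, has infinite sums as coefficients.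
\<close>

definition S_hat_equation ::
  "nat \<Rightarrow> complex \<Rightarrow> sgn \<Rightarrow> (basis_form \<Rightarrow> fn \<Rightarrow> fn) \<Rightarrow> basis_form \<Rightarrow> bool" where
  "S_hat_equation N \<gamma> s D e \<longleftrightarrow>
     vanishes (rel_ideal N \<gamma>)
       (\<lambda>n. ext0 D (exp_u N s n) e
            + sprod (sigma s e) (euler (exp_u N s)) n - sprod (exp_u N s) (euler (sigma s e)) n) \<and>
     mvanishes (rel_ideal N \<gamma>)
       (\<lambda>n. mext0 D (S_ser N) e n + lie (phi_hat N s e) (S_ser N) n
            + smprod (euler (sigma s e)) (S_ser N) n + smprod (sigma s e) (meuler (S_ser N)) n
            - meuler (phi_hat N s e) n)"

definition adjoint_equations ::
  "nat \<Rightarrow> complex \<Rightarrow> sgn \<Rightarrow> (basis_form \<Rightarrow> fn \<Rightarrow> fn) \<Rightarrow> basis_form \<Rightarrow> bool" where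
  "adjoint_equations N \<gamma> s D e \<longleftrightarrow>
     mvanishes (rel_ideal N \<gamma>)
       (\<lambda>n. mext0 D (adj Y_ser) e n + lie (phi_hat N s e) (adj Y_ser) n
            + smprod (sigma s e) (\<lambda>m. meuler (adj Y_ser) m + adj Y_ser m) n) \<and>
     mvanishes (rel_ideal N \<gamma>)
       (\<lambda>n. mext0 D (adj (S_ser N)) e n + lie (phi_hat N s e) (adj (S_ser N)) n
            + smprod (euler (sigma s e)) (adj (S_ser N)) n
            + smprod (sigma s e) (meuler (adj (S_ser N))) n
            - meuler (phi_hat N s e) n)"

text \<open>For a 1-form \<open>\<Phi>\<close>, the value of the 2-form \<open>[\<Phi>, \<Phi>] / 2\<close> on two frame vectors is the bracket of the
  two components of \<open>\<Phi>\<close>.\<close>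

definition extended_CMC_system ::
  "nat \<Rightarrow> complex \<Rightarrow> sgn \<Rightarrow> (basis_form \<Rightarrow> fn \<Rightarrow> fn) \<Rightarrow> (basis_form \<Rightarrow> form2) \<Rightarrow> bool" where
  "extended_CMC_system N \<gamma> s D T \<longleftrightarrow>
     (\<forall>e\<in>coframe N.
        km_vanishes (rel_ideal N \<gamma>) (km_add (km_ext0 D Y_hat e) (km_bracket (Phi_km N s e) Y_hat)) \<and>
        S_hat_equation N \<gamma> s D e \<and>
        adjoint_equations N \<gamma> s D e) \<and>
     (\<forall>e\<in>coframe N. \<forall>f\<in>coframe N.
        km_vanishes (rel_ideal N \<gamma>)
          (km_add (km_ext1 N D T (Phi_km N s) e f) (km_bracket (Phi_km N s e) (Phi_km N s f)))) \<and>
     (\<forall>m\<le>N. \<forall>e\<in>coframe N. \<forall>f\<in>coframe N.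
        T (DT m) e f \<in> rel_ideal N \<gamma> \<and> T (DTbar m) e f \<in> rel_ideal N \<gamma>)"

definition coefficients :: "nat \<Rightarrow> sgn \<Rightarrow> fn set" where
  "coefficients N s =
     {A n $ i $ j | A n i j. A \<in> {Y_ser, S_ser N, adj Y_ser, adj (S_ser N)}} \<union> range (exp_u N s)"

definition d_squared_zero ::
  "nat \<Rightarrow> complex \<Rightarrow> sgn \<Rightarrow> (basis_form \<Rightarrow> fn \<Rightarrow> fn) \<Rightarrow> (basis_form \<Rightarrow> form2) \<Rightarrow> bool" where
  "d_squared_zero N \<gamma> s D T \<longleftrightarrow>
     (\<forall>e\<in>coframe N. \<forall>f\<in>coframe N. \<forall>x\<in>coefficients N s.
        ext1 N D T (ext0 D x) e f \<in> rel_ideal N \<gamma>) \<and>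
     (\<forall>e\<in>coframe N. \<forall>f\<in>coframe N. \<forall>g\<in>coframe N. \<forall>c\<in>coframe N.
        ext2 N D T (T c) e f g \<in> rel_ideal N \<gamma>)"

definition preserves_relations ::
  "nat \<Rightarrow> complex \<Rightarrow> (basis_form \<Rightarrow> fn \<Rightarrow> fn) \<Rightarrow> bool" where
  "preserves_relations N \<gamma> D \<longleftrightarrow>
     (\<forall>e\<in>coframe N. \<forall>r\<in>rel_ideal N \<gamma>. ext0 D r e \<in> rel_ideal N \<gamma>)"

end

theory Submission
  imports Defs "HOL-Computational_Algebra.Formal_Laurent_Series"
begin

text \<open>
  For a component \<open>e\<close> of \<open>d\<close> the equations read \<open>D\<^sub>e Y + [\<phi>\<^sub>e, Y] + \<sigma>\<^sub>e (Y\<^sup>\<bullet> - Y) = 0\<close> and similarly for \<open>S\<close>;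
  modulo the equations, \<open>d\<^sup>2 Y\<close>, \<open>d\<^sup>2 S\<close>, \<open>d\<^sup>2 \<phi>\<close> and the derivatives of the algebraic relations vanish by
  bilinearity, the Jacobi identity and the Leibniz rule.

  That such a \<open>d\<close> exists is a matter of powers of \<open>\<lambda>\<close>. The connection form \<open>\<phi>\<^sub>e\<close> is the negative part of
  a series \<open>W\<^sub>e\<close>, a multiple of \<open>Y\<close> or of \<open>S\<close>, whose own contribution to an equation is computed from
  \<open>[Y, Y] = [S, S] = 0\<close> and \<open>[S, Y] = Y - Y\<^sup>\<bullet>\<close>. Only the nonnegative remainder \<open>\<phi>\<^sub>e - W\<^sub>e\<close> is left, and
  the coefficients of \<open>\<lambda>\<close> outside the range of the unknowns vanish. The negative part of the structure
  equation for \<open>\<phi>\<close> follows in the same way, its diagonal coefficient at \<open>\<lambda>\<^sup>0\<close> determines \<open>d\<rho>\<close>, and its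
  positive part is the negative part of its conjugate.

  The substitution of \<open>1/\<lambda>\<close> for \<open>\<lambda>\<close> brings the conjugate equations into the same form: if \<open>Y\<^sup>*\<close> is the
  conjugate transpose, in which \<open>\<lambda>\<close> is conjugated to \<open>1/\<lambda>\<close>, then \<open>Y\<^sup>*(1/\<lambda>)\<close>, \<open>- S\<^sup>*(1/\<lambda>)\<close>, \<open>\<phi>(1/\<lambda>)\<close> and
  \<open>- \<sigma>(1/\<lambda>)\<close> satisfy the equations of \<open>Y, S, \<phi>, \<sigma>\<close>. These are two views of one system, and what holds
  for one of them holds for the other.
\<close>

text \<open>Without the existence half the other half could hold vacuously. A derivation of a
  polynomial ring may take any values on the indeterminates, and each nonzero coefficient of Y, S,
  the conformal factor and the adjoints of Y and S is one indeterminate times a unit. Solving for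
  derivatives is therefore free; the obstacle is that each equation also has coefficients with no
  unknown to solve for. They are consistent because of a balance of orders: modulo the relations Y
  begins at \<lambda> to the power 1, S begins at -(2N+1), just low enough for the term that dt_N
  produces, and sigma_k begins at k = N+1, so that 2k offsets the poles of every U_m with m at most
  N. For d^2 = 0 the order of the steps is forced. An equation modulo the ideal can be
  differentiated only once the derivation preserves the ideal, and there the generator a^1 is the
  delicate one: the derivative of its square says nothing about its own, which is read off at
  \<lambda> to the power 0. Next comes d^2 on coefficients, and only then d^2 on the basis forms,
  since the connection form has such coefficients as entries.\<close>

text \<open>A triple \<open>(p, q, r)\<close> stands for the traceless matrix with rows \<open>(p, q)\<close> and \<open>(r, - p)\<close>; \<open>br\<close> is the
  commutator.\<close>

type_synonym 'r sl2 = "'r \<times> 'r \<times> 'r"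

section \<open>The Lie algebra sl(2) over a commutative ring with derivations\<close>

definition br :: "'r::comm_ring_1 sl2 \<Rightarrow> 'r sl2 \<Rightarrow> 'r sl2" where
  "br a b = (fst (snd a) * snd (snd b) - fst (snd b) * snd (snd a),
     2 * (fst a * fst (snd b) - fst b * fst (snd a)),
     2 * (snd (snd a) * fst b - snd (snd b) * fst a))"

definition sm :: "'r::comm_ring_1 \<Rightarrow> 'r sl2 \<Rightarrow> 'r sl2" where
  "sm f a = (f * fst a, f * fst (snd a), f * snd (snd a))"

definition lft :: "('r \<Rightarrow> 's) \<Rightarrow> 'r sl2 \<Rightarrow> 's sl2" where
  "lft h a = (h (fst a), h (fst (snd a)), h (snd (snd a)))"

text \<open>The trace form tr(ab), a quarter of the Killing form of sl(2). It is the polarization of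
  \<open>quad\<close>, which is minus the determinant.\<close>

definition killing :: "'r::comm_ring_1 sl2 \<Rightarrow> 'r sl2 \<Rightarrow> 'r" where
  "killing a b = 2 * (fst a * fst b) + fst (snd a) * snd (snd b) + fst (snd b) * snd (snd a)"

definition quad :: "'r::comm_ring_1 sl2 \<Rightarrow> 'r" where
  "quad a = fst a * fst a + fst (snd a) * snd (snd a)"

lemmas sl2_defs = br_def sm_def lft_def prod_eq_iff

text \<open>Applied to the derivative along a frame vector, to its coefficientwise extension to
  Laurent series, and to the Euler operator.\<close>

locale derivation =
  fixes h :: "'r::comm_ring_1 \<Rightarrow> 'r"
  assumes add: "h (a + b) = h a + h b"
    and mult: "h (a * b) = h a * b + a * h b"
begin

lemma zero: "h 0 = 0"
  using add[of 0 0] by simp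

lemma neg: "h (- a) = - h a"
  using add[of a "- a"] zero by (simp add: eq_neg_iff_add_eq_0 add.commute)

lemma diff: "h (a - b) = h a - h b"
  using add[of a "- b"] neg by simp

lemma one: "h 1 = 0"
  using mult[of 1 1] by simp

lemma of_nat: "h (of_nat n) = 0"
  by (induction n) (simp_all add: zero one add)

lemma of_int: "h (of_int n) = 0"
  by (cases n rule: int_cases2) (simp_all add: of_nat neg)

lemma numeral: "h (numeral n) = 0"
  using of_nat[of "numeral n"] by simp

lemma sum: "h (sum f A) = (\<Sum>i\<in>A. h (f i))"
  by (induction A rule: infinite_finite_induct) (simp_all add: zero add)

lemmas rules = zero neg add diff mult one numeral

end

text \<open>\<open>de\<close> and \<open>df\<close> commute with the Euler operator
  \<open>dl\<close> but not with each other: their commutator is what d of the basis forms has to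
  compensate.\<close>

locale commuting_derivations = de: derivation de + df: derivation df + dl: derivation dl
  for de df dl :: "'r::comm_ring_1 \<Rightarrow> 'r" +
  assumes comm: "de (dl a) = dl (de a)" "df (dl a) = dl (df a)"

text \<open>Every equation along a frame vector is split into a derivative and a term such as this
  one in which the exterior derivation does not occur.\<close>

definition Y_term :: "('r::comm_ring_1 \<Rightarrow> 'r) \<Rightarrow> 'r sl2 \<Rightarrow> 'r \<Rightarrow> 'r sl2 \<Rightarrow> 'r sl2" where
  "Y_term dl \<phi> \<sigma> y = br \<phi> y + sm \<sigma> (lft dl y - y)"

definition S_term :: "('r::comm_ring_1 \<Rightarrow> 'r) \<Rightarrow> 'r sl2 \<Rightarrow> 'r \<Rightarrow> 'r sl2 \<Rightarrow> 'r sl2" where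
  "S_term dl \<phi> \<sigma> x = br \<phi> x + sm (dl \<sigma>) x + sm \<sigma> (lft dl x) - lft dl \<phi>"

definition SY_rel :: "('r::comm_ring_1 \<Rightarrow> 'r) \<Rightarrow> 'r sl2 \<Rightarrow> 'r sl2 \<Rightarrow> 'r sl2" where
  "SY_rel dl x y = br x y - y + lft dl y"

text \<open>The matrix component of the Kac-Moody bracket of \<open>(\<sigma>, \<phi>)\<close> and
  \<open>(\<tau>, \<psi>)\<close>.\<close>

definition curv :: "('r::comm_ring_1 \<Rightarrow> 'r) \<Rightarrow> 'r sl2 \<Rightarrow> 'r \<Rightarrow> 'r sl2 \<Rightarrow> 'r \<Rightarrow> 'r sl2" where
  "curv dl \<phi> \<sigma> \<psi> \<tau> = br \<phi> \<psi> + sm \<sigma> (lft dl \<psi>) - sm \<tau> (lft dl \<phi>)"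

text \<open>By the Jacobi identity the relation is transported like Y and S themselves. The Euler
  derivative of \<phi> enters through \<open>br Gx y\<close> and through \<open>lft dl Gy\<close>
  with opposite signs. Each remaining summand contains the left side of an equation or the relation
  \<open>r\<close>.\<close>

lemma SY_rel_derivative:
  fixes x y \<phi> :: "'r::comm_ring_1 sl2" and \<sigma> :: 'r
  assumes "derivation d" "derivation dl" and comm: "\<And>a. d (dl a) = dl (d a)"
  defines "r \<equiv> SY_rel dl x y"
  defines "Gy \<equiv> lft d y + Y_term dl \<phi> \<sigma> y"
  defines "Gx \<equiv> lft d x + S_term dl \<phi> \<sigma> x"
  shows "lft d r = br Gx y + br x Gy - Gy + lft dl Gy - br \<phi> r - sm (dl \<sigma>) r
    - sm \<sigma> (lft dl r - r)"
proof -
  interpret d: derivation d by fact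
  interpret dl: derivation dl by fact
  show ?thesis
    unfolding r_def Gy_def Gx_def SY_rel_def S_term_def Y_term_def
    by (simp add: sl2_defs d.rules dl.rules comm algebra_simps)
qed

text \<open>The trace form is invariant, so \<open>br \<phi> y\<close> contributes nothing. What is
  left of \<sigma> is the operator \<open>dl - 2\<close>, which kills multiples of
  \<lambda>^2.\<close>

lemma quad_derivative:
  fixes y \<phi> :: "'r::comm_ring_1 sl2" and \<sigma> :: 'r
  assumes "derivation d" "derivation dl"
  defines "Gy \<equiv> lft d y + Y_term dl \<phi> \<sigma> y"
  shows "d (quad y) = killing y Gy - \<sigma> * (dl (quad y) - 2 * quad y)"
proof -
  interpret d: derivation d by fact
  interpret dl: derivation dl by fact
  show ?thesis
    unfolding Gy_def quad_def Y_term_def killing_def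
    by (simp add: sl2_defs d.rules dl.rules algebra_simps)
qed

context commuting_derivations
begin

text \<open>\<open>F\<close>, \<open>S\<close> and \<open>TD\<close> are to be the contractions of T
  with \<phi>, with \<sigma> and with the derivatives of y. \<open>St\<close>, \<open>Ss\<close>,
  \<open>Ee\<close>, \<open>Ef\<close> and \<open>TE\<close> are left sides of equations or
  contractions of them. The two equations for y differ by the curvature acting on y, which the
  structure equations trade for \<open>F\<close> and \<open>S\<close>.\<close>

lemma Y_second_derivative:
  fixes y \<phi> \<psi> :: "'r sl2"
  assumes F: "F = St - (lft de \<psi> - lft df \<phi> + curv dl \<phi> \<sigma> \<psi> \<tau>)"
    and S: "S = Ss - (\<sigma> * dl \<tau> - \<tau> * dl \<sigma>)"
    and TD: "TD = TE - Y_term dl F S y"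
    and const: "de \<tau> = 0" "df \<sigma> = 0"
  defines "Ee \<equiv> lft de y + Y_term dl \<phi> \<sigma> y"
  defines "Ef \<equiv> lft df y + Y_term dl \<psi> \<tau> y"
  shows "lft de (lft df y) - lft df (lft de y) + TD =
    lft de Ef - lft df Ee - Y_term dl \<psi> \<tau> Ee + Y_term dl \<phi> \<sigma> Ef + TE
    - Y_term dl St Ss y"
  unfolding Ee_def Ef_def TD F S Y_term_def curv_def
  by (simp add: sl2_defs de.rules df.rules dl.rules comm const algebra_simps)

text \<open>The same computation for an affine action: the inhomogeneous part of
  \<open>S_term\<close> is minus the Euler derivative of \<phi>, so the equations themselves are
  acted on by the linear part only.\<close>

lemma S_second_derivative:
  fixes x \<phi> \<psi> :: "'r sl2"
  assumes F: "F = St - (lft de \<psi> - lft df \<phi> + curv dl \<phi> \<sigma> \<psi> \<tau>)"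
    and S: "S = Ss - (\<sigma> * dl \<tau> - \<tau> * dl \<sigma>)"
    and TD: "TD = TE - S_term dl F S x"
    and const: "de \<tau> = 0" "df \<sigma> = 0"
  defines "Ee \<equiv> lft de x + S_term dl \<phi> \<sigma> x"
  defines "Ef \<equiv> lft df x + S_term dl \<psi> \<tau> x"
  shows "lft de (lft df x) - lft df (lft de x) + TD =
    lft de Ef - lft df Ee - (br \<psi> Ee + sm (dl \<tau>) Ee + sm \<tau> (lft dl Ee))
    + (br \<phi> Ef + sm (dl \<sigma>) Ef + sm \<sigma> (lft dl Ef)) + TE - S_term dl St Ss x"
proof -
  have c: "dl (de \<tau>) = 0" "de (dl \<tau>) = 0" "df (dl \<sigma>) = 0" by (simp_all add: comm const dl.zero)
  show ?thesis
    unfolding Ee_def Ef_def TD F S S_term_def curv_def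
    by (simp add: sl2_defs de.rules df.rules dl.rules comm const c algebra_simps)
qed

text \<open>The scalar case. The factor is regarded as the vector field w times the Euler operator,
  on which \<sigma> acts by the bracket of vector fields.\<close>

lemma factor_second_derivative:
  fixes w \<sigma> \<tau> :: 'r
  assumes S: "S = Ss - (\<sigma> * dl \<tau> - \<tau> * dl \<sigma>)"
    and TD: "TD = TE - (S * dl w - w * dl S)"
    and const: "de \<tau> = 0" "df \<sigma> = 0"
  defines "Ee \<equiv> de w + (\<sigma> * dl w - w * dl \<sigma>)"
  defines "Ef \<equiv> df w + (\<tau> * dl w - w * dl \<tau>)"
  shows "de (df w) - df (de w) + TD =
    de Ef - df Ee - (\<tau> * dl Ee - Ee * dl \<tau>) + (\<sigma> * dl Ef - Ef * dl \<sigma>) + TE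
    - (Ss * dl w - w * dl Ss)"
proof -
  have c: "dl (de \<tau>) = 0" "de (dl \<tau>) = 0" "df (dl \<sigma>) = 0" by (simp_all add: comm const dl.zero)
  show ?thesis
    unfolding Ee_def Ef_def TD S
    by (simp add: de.rules df.rules dl.rules comm const c algebra_simps)
qed

end

text \<open>The second Bianchi identity for a Kac-Moody valued connection. The commutators of the
  three derivations are subtracted since they need not commute.\<close>

lemma Bianchi:
  fixes \<phi> \<psi> \<omega> :: "'r::comm_ring_1 sl2" and \<sigma> \<tau> \<upsilon> :: 'r
  assumes "derivation de" "derivation df" "derivation dg" "derivation dl"
    and comm: "\<And>a. de (dl a) = dl (de a)" "\<And>a. df (dl a) = dl (df a)" "\<And>a. dg (dl a) = dl (dg a)"
    and const: "de \<tau> = 0" "de \<upsilon> = 0" "df \<sigma> = 0" "df \<upsilon> = 0" "dg \<sigma> = 0" "dg \<tau> = 0"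
  defines "Bef \<equiv> lft de \<psi> - lft df \<phi> + curv dl \<phi> \<sigma> \<psi> \<tau>"
  defines "Bfg \<equiv> lft df \<omega> - lft dg \<psi> + curv dl \<psi> \<tau> \<omega> \<upsilon>"
  defines "Bge \<equiv> lft dg \<phi> - lft de \<omega> + curv dl \<omega> \<upsilon> \<phi> \<sigma>"
  shows "(lft dg Bef - lft de (lft df \<omega>) + lft df (lft de \<omega>)
      - curv dl Bef (\<sigma> * dl \<tau> - \<tau> * dl \<sigma>) \<omega> \<upsilon>)
    + (lft de Bfg - lft df (lft dg \<phi>) + lft dg (lft df \<phi>)
      - curv dl Bfg (\<tau> * dl \<upsilon> - \<upsilon> * dl \<tau>) \<phi> \<sigma>)
    + (lft df Bge - lft dg (lft de \<psi>) + lft de (lft dg \<psi>)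
      - curv dl Bge (\<upsilon> * dl \<sigma> - \<sigma> * dl \<upsilon>) \<psi> \<tau>) = 0"
proof -
  interpret de: derivation de by fact
  interpret df: derivation df by fact
  interpret dg: derivation dg by fact
  interpret dl: derivation dl by fact
  show ?thesis
    unfolding Bef_def Bfg_def Bge_def curv_def
    by (simp add: sl2_defs de.rules df.rules dg.rules dl.rules comm const algebra_simps)
qed

section \<open>Cancellation of the polar part of the connection\<close>

context derivation
begin

text \<open>Here \<open>\<phi>\<close> is split into a multiple of \<open>y\<close> or \<open>x\<close> and a remainder \<open>P\<close>, which will be the
  nonnegative part.\<close>

lemma Y_term_Y:
  assumes "\<phi> = sm u y + P"
  shows "Y_term h \<phi> 0 y = br P y"
  unfolding assms Y_term_def by (simp add: sl2_defs algebra_simps)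

lemma Y_term_S:
  assumes "\<phi> = sm v x + P"
  shows "Y_term h \<phi> v y = br P y + sm v (SY_rel h x y)"
  unfolding assms Y_term_def SY_rel_def by (simp add: sl2_defs algebra_simps)

lemma S_term_Y:
  assumes "\<phi> = sm u y + P" and "h u = k * u"
  shows "S_term h \<phi> 0 x = br P x - lft h P - sm ((k + 1) * u) y - sm u (SY_rel h x y)"
  unfolding assms(1) S_term_def SY_rel_def
  by (simp add: sl2_defs rules assms(2) algebra_simps)

lemma S_term_S:
  assumes "\<phi> = sm v x + P" and "h v = k * v"
  shows "S_term h \<phi> v x = br P x - lft h P"
  unfolding assms(1) S_term_def
  by (simp add: sl2_defs rules assms(2) algebra_simps)

end

context commuting_derivations
begin

lemma curv_Y:
  fixes y \<phi> :: "'r sl2" and \<sigma> :: 'r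
  assumes "\<psi> = sm u y + P" and "dl u = k * u" and "de u = 0"
  defines "Ee \<equiv> lft de y + Y_term dl \<phi> \<sigma> y"
  shows "lft de (sm u y) + curv dl \<phi> \<sigma> \<psi> 0 =
    sm u Ee + br \<phi> P + sm \<sigma> (lft dl P) + sm ((k + 1) * u * \<sigma>) y"
  unfolding assms(1) Ee_def Y_term_def curv_def
  by (simp add: sl2_defs de.rules dl.rules assms(2,3) algebra_simps)

lemma curv_S:
  fixes x \<phi> :: "'r sl2"
  assumes "\<psi> = sm v x + P" and "dl v = k * v" and "de v = 0"
  defines "Ee \<equiv> lft de x + S_term dl \<phi> 0 x"
  shows "lft de (sm v x) + curv dl \<phi> 0 \<psi> v = sm v Ee + br \<phi> P"
  unfolding assms(1) Ee_def S_term_def curv_def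
  by (simp add: sl2_defs de.rules dl.rules assms(2,3) algebra_simps)

lemma curv_YY:
  fixes y \<phi> \<psi> :: "'r sl2"
  assumes "\<phi> = sm u y + P" "\<psi> = sm v y + Q" and "de v = 0" "df u = 0"
  defines "Ee \<equiv> lft de y + Y_term dl \<phi> 0 y"
  defines "Ef \<equiv> lft df y + Y_term dl \<psi> 0 y"
  shows "lft de (sm v y) - lft df (sm u y) + curv dl \<phi> 0 \<psi> 0 = sm v Ee - sm u Ef + br P Q"
  unfolding assms(1,2) Ee_def Ef_def Y_term_def curv_def
  by (simp add: sl2_defs de.rules df.rules dl.rules assms(3,4) algebra_simps)

lemma curv_YS:
  fixes x y \<phi> \<psi> :: "'r sl2" and v :: 'r
  assumes "\<phi> = sm u y + P" "\<psi> = sm v x + Q" and "de v = 0" "df u = 0"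
  defines "Ee \<equiv> lft de x + S_term dl \<phi> 0 x"
  defines "Ef \<equiv> lft df y + Y_term dl \<psi> v y"
  shows "lft de (sm v x) - lft df (sm u y) + curv dl \<phi> 0 \<psi> v =
    sm v Ee - sm u Ef + br P Q + sm (u * v) (SY_rel dl x y)"
  unfolding assms(1,2) Ee_def Ef_def Y_term_def S_term_def SY_rel_def curv_def
  by (simp add: sl2_defs de.rules df.rules dl.rules assms(3,4) algebra_simps)

text \<open>The leftover multiple of x reflects the bracket of the vector fields u and v times the
  Euler operator. It has a pole, which d of the forms \<open>Sig k\<close> has to cancel.\<close>

lemma curv_SS:
  fixes x \<phi> \<psi> :: "'r sl2" and u v :: 'r
  assumes "\<phi> = sm u x + P" "\<psi> = sm v x + Q" and "de v = 0" "df u = 0"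
    and "dl u = k * u" "dl v = l * v"
  defines "Ee \<equiv> lft de x + S_term dl \<phi> u x"
  defines "Ef \<equiv> lft df x + S_term dl \<psi> v x"
  shows "lft de (sm v x) - lft df (sm u x) + curv dl \<phi> u \<psi> v =
    sm v Ee - sm u Ef + br P Q + sm ((l - k) * (u * v)) x"
  unfolding assms(1,2) Ee_def Ef_def S_term_def curv_def
  by (simp add: sl2_defs de.rules df.rules dl.rules assms(3-6) algebra_simps)

end

subsection \<open>Polynomials in the unknowns\<close>

lemma poly_mapping_add_induct [case_names zero single add]:
  fixes p :: "'a \<Rightarrow>\<^sub>0 'b::comm_monoid_add"
  assumes "P 0" "\<And>m c. P (Poly_Mapping.single m c)" "\<And>p q. P p \<Longrightarrow> P q \<Longrightarrow> P (p + q)"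
  shows "P p"
proof (induction p rule: Poly_Mapping.update_induct)
  case (update f a b)
  have "Poly_Mapping.update a b f = f + Poly_Mapping.single a b"
    by (rule poly_mapping_eqI)
      (use update in \<open>auto simp: lookup_update lookup_add lookup_single when_def in_keys_iff\<close>)
  then show ?case using update assms by simp
qed (rule assms)

lemma conj_coord_conj_coord [simp]: "conj_coord (conj_coord v) = v"
  by (cases v) simp_all

lemma inj_conj_coord: "inj conj_coord"
  by (rule injI) (metis conj_coord_conj_coord)

abbreviation conj_mon :: "(coord \<Rightarrow>\<^sub>0 nat) \<Rightarrow> coord \<Rightarrow>\<^sub>0 nat" where
  "conj_mon \<equiv> Poly_Mapping.map_key conj_coord"

lemma conj_mon_conj_mon [simp]: "conj_mon (conj_mon m) = m"
  by (simp add: map_key_compose inj_conj_coord comp_def map_key_id)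

lemma inj_conj_mon: "inj conj_mon"
  by (rule injI) (metis conj_mon_conj_mon)

lemma conj_mon_add: "conj_mon (m + m') = conj_mon m + conj_mon m'"
  by (rule map_key_plus[OF inj_conj_coord])

lemma lookup_bar: "Poly_Mapping.lookup (bar p) m = cnj (Poly_Mapping.lookup p (conj_mon m))"
  by (simp add: bar_def Poly_Mapping.map.rep_eq map_key.rep_eq[OF inj_conj_mon] when_def)

lemma bar_single: "bar (Poly_Mapping.single m c) = Poly_Mapping.single (conj_mon m) (cnj c)"
  by (rule poly_mapping_eqI) (auto simp: lookup_bar lookup_single when_def)

lemma bar_add: "bar (p + q) = bar p + bar q"
  by (rule poly_mapping_eqI) (simp add: lookup_bar lookup_add)

lemma bar_0 [simp]: "bar 0 = 0"
  by (rule poly_mapping_eqI) (simp add: lookup_bar)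

lemma bar_uminus: "bar (- p) = - bar p"
  by (rule poly_mapping_eqI) (simp add: lookup_bar)

lemma bar_diff: "bar (p - q) = bar p - bar q"
  by (rule poly_mapping_eqI) (simp add: lookup_bar lookup_minus)

lemma bar_bar [simp]: "bar (bar p) = p"
  by (rule poly_mapping_eqI) (simp add: lookup_bar)

lemma bar_mult: "bar (p * q) = bar p * bar q"
proof (induction p rule: poly_mapping_add_induct)
  case (single m c)
  show ?case
    by (induction q rule: poly_mapping_add_induct)
      (simp_all add: bar_add distrib_left mult_single bar_single conj_mon_add)
qed (simp_all add: bar_add distrib_right)

lemma bar_const [simp]: "bar (const z) = const (cnj z)"
  by (simp add: const_def bar_single map_key_zero[OF inj_conj_coord])

lemma bar_var [simp]: "bar (var v) = var (conj_coord v)"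
proof -
  have "conj_mon (Poly_Mapping.single v 1) = Poly_Mapping.single (conj_coord v) 1"
    using map_key_single[OF inj_conj_coord, of "conj_coord v" "1 :: nat"] by (simp del: One_nat_def)
  then show ?thesis by (simp add: var_def bar_single del: One_nat_def)
qed

lemma const_0 [simp]: "const 0 = 0" and const_1 [simp]: "const 1 = 1"
  and const_add: "const (a + b) = const a + const b"
  and const_uminus: "const (- a) = - const a"
  and const_mult: "const (a * b) = const a * const b"
  by (simp_all add: const_def single_add single_uminus mult_single)

lemma const_of_int: "const (of_int n) = of_int n"
  by (simp add: const_def single_of_int)

lemma bar_of_int [simp]: "bar (of_int n) = of_int n"
  by (metis bar_const complex_cnj_of_int const_of_int)

lemma bar_numeral [simp]: "bar (numeral n) = numeral n"
  using bar_of_int[of "numeral n"] by simp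

lemma bar_1 [simp]: "bar 1 = 1"
  using bar_of_int[of 1] by simp

lemma bar_sum: "bar (sum f A) = (\<Sum>i\<in>A. bar (f i))"
  by (induction A rule: infinite_finite_induct) (simp_all add: bar_add)

section \<open>Derivations of the polynomial ring with prescribed values\<close>

definition mon_deriv :: "(coord \<Rightarrow> fn) \<Rightarrow> (coord \<Rightarrow>\<^sub>0 nat) \<Rightarrow> fn" where
  "mon_deriv g m = (\<Sum>v\<in>Poly_Mapping.keys m. of_nat (Poly_Mapping.lookup m v) * g v *
     Poly_Mapping.single (m - Poly_Mapping.single v 1) 1)"

definition poly_deriv :: "(coord \<Rightarrow> fn) \<Rightarrow> fn \<Rightarrow> fn" where
  "poly_deriv g p = (\<Sum>m\<in>Poly_Mapping.keys p. const (Poly_Mapping.lookup p m) * mon_deriv g m)"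

text \<open>With a common index set the summands for m, m' and m + m' can be compared one by
  one.\<close>

lemma mon_deriv_superset:
  assumes "finite K" "Poly_Mapping.keys m \<subseteq> K"
  shows "mon_deriv g m = (\<Sum>v\<in>K. of_nat (Poly_Mapping.lookup m v) * g v *
     Poly_Mapping.single (m - Poly_Mapping.single v 1) 1)"
  unfolding mon_deriv_def
  by (rule sum.mono_neutral_left) (use assms in \<open>auto simp: in_keys_iff\<close>)

lemma poly_deriv_superset:
  assumes "finite K" "Poly_Mapping.keys p \<subseteq> K"
  shows "poly_deriv g p = (\<Sum>m\<in>K. const (Poly_Mapping.lookup p m) * mon_deriv g m)"
  unfolding poly_deriv_def
  by (rule sum.mono_neutral_left) (use assms in \<open>auto simp: in_keys_iff\<close>)

text \<open>Exponents are subtracted with truncation, so v must occur in m. Where it does not, the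
  factor \<open>lookup m v\<close> in \<open>mon_deriv\<close> is 0.\<close>

lemma add_minus_single:
  assumes "Poly_Mapping.lookup m v > 0"
  shows "m + m' - Poly_Mapping.single v (1::nat) = (m - Poly_Mapping.single v 1) + m'"
  by (rule poly_mapping_eqI)
    (use assms in \<open>auto simp: lookup_add lookup_minus lookup_single when_def\<close>)

lemma mon_deriv_add:
  "mon_deriv g (m + m') =
    mon_deriv g m * Poly_Mapping.single m' 1 + Poly_Mapping.single m 1 * mon_deriv g m'"
proof -
  define K where "K = Poly_Mapping.keys m \<union> Poly_Mapping.keys m'"
  let ?t = "\<lambda>m v. of_nat (Poly_Mapping.lookup m v) * g v *
    Poly_Mapping.single (m - Poly_Mapping.single v 1) (1::complex)"
  have K: "finite K" "Poly_Mapping.keys m \<subseteq> K" "Poly_Mapping.keys m' \<subseteq> K" "Poly_Mapping.keys (m + m') \<subseteq> K"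
    using Poly_Mapping.keys_add[of m m'] by (auto simp: K_def)
  have split: "?t (m + m') v = ?t m v * Poly_Mapping.single m' 1 + Poly_Mapping.single m 1 * ?t m' v"
    for v
  proof -
    have 1: "?t m v * Poly_Mapping.single m' 1 =
        of_nat (Poly_Mapping.lookup m v) * g v * Poly_Mapping.single (m + m' - Poly_Mapping.single v 1) 1"
      by (cases "Poly_Mapping.lookup m v = 0")
        (simp_all add: mult.assoc mult_single add_minus_single del: One_nat_def)
    have 2: "Poly_Mapping.single m 1 * ?t m' v =
        of_nat (Poly_Mapping.lookup m' v) * g v * Poly_Mapping.single (m + m' - Poly_Mapping.single v 1) 1"
      by (cases "Poly_Mapping.lookup m' v = 0")
        (simp_all add: mult.left_commute[of "Poly_Mapping.single m 1"] mult_single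
          add_minus_single[of m' v m] add.commute[of m] del: One_nat_def)
    show ?thesis unfolding 1 2 by (simp add: lookup_add algebra_simps)
  qed
  show ?thesis
    by (simp add: mon_deriv_superset[OF K(1)] K split sum.distrib sum_distrib_left sum_distrib_right
        del: One_nat_def)
qed

lemma poly_deriv_add: "poly_deriv g (p + q) = poly_deriv g p + poly_deriv g q"
proof -
  define K where "K = Poly_Mapping.keys p \<union> Poly_Mapping.keys q"
  have K: "finite K" "Poly_Mapping.keys p \<subseteq> K" "Poly_Mapping.keys q \<subseteq> K" "Poly_Mapping.keys (p + q) \<subseteq> K"
    using Poly_Mapping.keys_add[of p q] by (auto simp: K_def)
  show ?thesis
    by (simp add: poly_deriv_superset[OF K(1)] K lookup_add const_add distrib_right sum.distrib)
qed

lemma poly_deriv_single: "poly_deriv g (Poly_Mapping.single m c) = const c * mon_deriv g m"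
  by (cases "c = 0") (simp_all add: poly_deriv_def)

lemma single_eq_const: "Poly_Mapping.single m c = const c * Poly_Mapping.single m 1"
  by (simp add: const_def mult_single)

lemma derivation_poly_deriv: "derivation (poly_deriv g)"
proof
  have zero: "poly_deriv g 0 = 0" by (simp add: poly_deriv_def)
  fix p q :: fn
  show "poly_deriv g (p * q) = poly_deriv g p * q + p * poly_deriv g q"
  proof (induction p rule: poly_mapping_add_induct)
    case (single m c)
    show ?case
    proof (induction q rule: poly_mapping_add_induct)
      case (single m' c')
      have "poly_deriv g (Poly_Mapping.single m c * Poly_Mapping.single m' c') =
          const c * const c' * (mon_deriv g m * Poly_Mapping.single m' 1
            + Poly_Mapping.single m 1 * mon_deriv g m')"
        by (simp only: mult_single poly_deriv_single const_mult mon_deriv_add)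
      also have "\<dots> = const c * mon_deriv g m * Poly_Mapping.single m' c'
          + Poly_Mapping.single m c * (const c' * mon_deriv g m')"
        unfolding single_eq_const[of m c] single_eq_const[of m' c'] by (simp add: algebra_simps)
      finally show ?case by (simp only: poly_deriv_single)
    qed (simp_all add: zero poly_deriv_add algebra_simps)
  qed (simp_all add: zero poly_deriv_add algebra_simps)
qed (rule poly_deriv_add)

lemma poly_deriv_const: "poly_deriv g (const z) = 0"
  by (simp add: const_def poly_deriv_single mon_deriv_def)

lemma poly_deriv_var: "poly_deriv g (var v) = g v"
  by (simp add: var_def poly_deriv_single mon_deriv_def)


no_notation fps_nth (infixl "$" 75)
notation fls_nth (infixl "$$" 75)

subsection \<open>Laurent series modulo an ideal of coefficients\<close>

definition eul :: "'a::comm_ring_1 fls \<Rightarrow> 'a fls" where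
  "eul f = fls_X * fls_deriv f"

lemma eul_nth [simp]: "eul f $$ n = of_int n * f $$ n"
  by (simp add: eul_def fls_X_times_conv_shift)

lemma derivation_eul: "derivation eul"
  by standard (simp_all add: eul_def algebra_simps)

text \<open>Meaningful when d maps 0 to 0, so that the new series is bounded below. It is used for
  derivations and also for \<open>bar\<close>.\<close>

definition dmap :: "('a::comm_ring_1 \<Rightarrow> 'a) \<Rightarrow> 'a fls \<Rightarrow> 'a fls" where
  "dmap d f = Abs_fls (\<lambda>n. d (f $$ n))"

text \<open>Subdegrees may change when a map is applied to the coefficients. With arbitrary lower
  bounds a product and its image are sums over the same range.\<close>

lemma fls_times_nth_range:
  fixes f g :: "'a::comm_ring_1 fls"
  assumes "\<And>i. i < a \<Longrightarrow> f $$ i = 0" "\<And>i. i < b \<Longrightarrow> g $$ i = 0"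
  shows "(f * g) $$ n = (\<Sum>i=a..n - b. f $$ i * g $$ (n - i))"
proof -
  have "(f * g) $$ n = (\<Sum>i=fls_subdegree f..n - fls_subdegree g. f $$ i * g $$ (n - i))"
    by (rule fls_times_nth(2))
  also have "\<dots> = (\<Sum>i\<in>{min a (fls_subdegree f)..max (n - b) (n - fls_subdegree g)}. f $$ i * g $$ (n - i))"
    by (rule sum.mono_neutral_left) auto
  also have "\<dots> = (\<Sum>i=a..n - b. f $$ i * g $$ (n - i))"
    by (rule sum.mono_neutral_right) (auto simp: assms not_le)
  finally show ?thesis .
qed

context derivation
begin

lemma dmap_nth [simp]: "dmap h f $$ n = h (f $$ n)"
proof -
  obtain k where k: "\<forall>n<k. f $$ n = 0" by (rule fls_nth_vanishes_belowE)
  show ?thesis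
    unfolding dmap_def by (rule nth_Abs_fls_lower_bound[of k]) (simp add: k zero)
qed

lemma derivation_dmap: "derivation (dmap h)"
proof
  fix f g
  show "dmap h (f + g) = dmap h f + dmap h g"
    by (rule fls_eqI) (simp add: add)
  obtain a where a: "\<forall>n<a. f $$ n = 0" by (rule fls_nth_vanishes_belowE)
  obtain b where b: "\<forall>n<b. g $$ n = 0" by (rule fls_nth_vanishes_belowE)
  show "dmap h (f * g) = dmap h f * g + f * dmap h g"
  proof (rule fls_eqI)
    fix n
    have "(f * g) $$ n = (\<Sum>i=a..n - b. f $$ i * g $$ (n - i))"
      by (rule fls_times_nth_range) (simp_all add: a b)
    moreover have "(dmap h f * g) $$ n = (\<Sum>i=a..n - b. dmap h f $$ i * g $$ (n - i))"
      by (rule fls_times_nth_range) (simp_all add: a b zero)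
    moreover have "(f * dmap h g) $$ n = (\<Sum>i=a..n - b. f $$ i * dmap h g $$ (n - i))"
      by (rule fls_times_nth_range) (simp_all add: a b zero)
    ultimately show "dmap h (f * g) $$ n = (dmap h f * g + f * dmap h g) $$ n"
      by (simp add: sum mult sum.distrib)
  qed
qed

lemma dmap_eul: "dmap h (eul f) = eul (dmap h f)"
  by (rule fls_eqI) (simp add: mult of_int)

end

locale coeff_ideal =
  fixes I :: "'a::comm_ring_1 set"
  assumes zero: "0 \<in> I"
    and add: "\<lbrakk>a \<in> I; b \<in> I\<rbrakk> \<Longrightarrow> a + b \<in> I"
    and mult: "a \<in> I \<Longrightarrow> r * a \<in> I"
begin

lemma mult': "a \<in> I \<Longrightarrow> a * r \<in> I"
  using mult by (simp add: mult.commute)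

lemma neg: "a \<in> I \<Longrightarrow> - a \<in> I"
  using mult[of a "- 1"] by simp

lemma neg_iff: "- a \<in> I \<longleftrightarrow> a \<in> I"
  using neg[of a] neg[of "- a"] by auto

lemma diff: "\<lbrakk>a \<in> I; b \<in> I\<rbrakk> \<Longrightarrow> a - b \<in> I"
  using add[of a "- b"] neg by simp

lemma sum: "(\<And>i. i \<in> A \<Longrightarrow> f i \<in> I) \<Longrightarrow> sum f A \<in> I"
  by (induction A rule: infinite_finite_induct) (simp_all add: zero add)

text \<open>\<open>low k f\<close>: modulo \<open>I\<close>, only powers \<open>\<ge> k\<close> occur in \<open>f\<close>.\<close>

definition low :: "int \<Rightarrow> 'a fls \<Rightarrow> bool" where
  "low k f \<longleftrightarrow> (\<forall>n<k. f $$ n \<in> I)"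

definition nul :: "'a fls \<Rightarrow> bool" where
  "nul f \<longleftrightarrow> (\<forall>n. f $$ n \<in> I)"

definition low3 :: "int \<Rightarrow> 'a fls sl2 \<Rightarrow> bool" where
  "low3 k a \<longleftrightarrow> low k (fst a) \<and> low k (fst (snd a)) \<and> low k (snd (snd a))"

definition nul3 :: "'a fls sl2 \<Rightarrow> bool" where
  "nul3 a \<longleftrightarrow> nul (fst a) \<and> nul (fst (snd a)) \<and> nul (snd (snd a))"

lemma nul_iff_low: "nul f \<longleftrightarrow> (\<forall>k. low k f)"
  unfolding nul_def low_def by (meson gt_ex)

lemma nul3_iff_low3: "nul3 a \<longleftrightarrow> (\<forall>k. low3 k a)"
  unfolding nul3_def low3_def nul_iff_low by auto

lemma low_mono: "\<lbrakk>low k f; j \<le> k\<rbrakk> \<Longrightarrow> low j f"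
  unfolding low_def by auto

lemma low3_mono: "\<lbrakk>low3 k f; j \<le> k\<rbrakk> \<Longrightarrow> low3 j f"
  unfolding low3_def using low_mono by blast

lemma low_zero: "low k 0" and nul_zero: "nul 0"
  unfolding low_def nul_def by (simp_all add: zero)

lemma low_add: "\<lbrakk>low k f; low k g\<rbrakk> \<Longrightarrow> low k (f + g)"
  and low_diff: "\<lbrakk>low k f; low k g\<rbrakk> \<Longrightarrow> low k (f - g)"
  and low_neg: "low k f \<Longrightarrow> low k (- f)"
  and low_eul: "low k f \<Longrightarrow> low k (eul f)"
  unfolding low_def by (simp_all add: add diff neg mult)

lemma low_double: "low k f \<Longrightarrow> low k (2 * f)" and nul_double: "nul f \<Longrightarrow> nul (2 * f)"
  unfolding low_def nul_def by (simp_all add: mult)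

lemma low_mult:
  assumes "low j f" "low k g"
  shows "low (j + k) (f * g)"
  unfolding low_def
proof (intro allI impI)
  fix n assume n: "n < j + k"
  have "(f * g) $$ n = (\<Sum>i=fls_subdegree f..n - fls_subdegree g. f $$ i * g $$ (n - i))"
    by (rule fls_times_nth(2))
  also have "\<dots> \<in> I"
  proof (rule sum)
    fix i
    have "f $$ i \<in> I \<or> g $$ (n - i) \<in> I"
      using assms n unfolding low_def by (cases "i < j") auto
    then show "f $$ i * g $$ (n - i) \<in> I"
      using mult mult' by blast
  qed
  finally show "(f * g) $$ n \<in> I" .
qed

text \<open>A Laurent series has some order b, and a null series has every order, in particular k -
  b. Boundedness below is thus essential, and it is why the adjoints are first rewritten in
  1/\<lambda>.\<close>

lemma nul_mult: "nul f \<Longrightarrow> nul (f * g)" and nul_mult': "nul f \<Longrightarrow> nul (g * f)"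
proof -
  assume f: "nul f"
  obtain b where b: "\<forall>n<b. g $$ n = 0" by (rule fls_nth_vanishes_belowE)
  have g: "low b g" unfolding low_def using b zero by simp
  show "nul (f * g)"
    unfolding nul_iff_low
  proof
    fix k show "low k (f * g)"
      using low_mult[OF _ g, of "k - b" f] f unfolding nul_iff_low by simp
  qed
  then show "nul (g * f)" by (simp add: mult.commute)
qed

lemma low_mult_le: "\<lbrakk>low j f; low k g; n \<le> j + k\<rbrakk> \<Longrightarrow> low n (f * g)"
  using low_mult low_mono by blast

lemma nul_rules:
  "\<lbrakk>nul f; nul g\<rbrakk> \<Longrightarrow> nul (f + g)" "\<lbrakk>nul f; nul g\<rbrakk> \<Longrightarrow> nul (f - g)"
  "nul f \<Longrightarrow> nul (- f)" "nul f \<Longrightarrow> nul (eul f)"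
  unfolding nul_iff_low by (simp_all add: low_add low_diff low_neg low_eul)

lemma low3_rules:
  "\<lbrakk>low3 k a; low3 k b\<rbrakk> \<Longrightarrow> low3 k (a + b)" "\<lbrakk>low3 k a; low3 k b\<rbrakk> \<Longrightarrow> low3 k (a - b)"
  "low3 k a \<Longrightarrow> low3 k (- a)" "low3 k a \<Longrightarrow> low3 k (lft eul a)"
  unfolding low3_def lft_def by (simp_all add: low_add low_diff low_neg low_eul)

lemma low3_sm: "\<lbrakk>low j f; low3 k a; n \<le> j + k\<rbrakk> \<Longrightarrow> low3 n (sm f a)"
  unfolding low3_def sm_def by (auto intro: low_mult_le)

lemma low3_br:
  assumes "low3 j a" "low3 k b" "n \<le> j + k"
  shows "low3 n (br a b)"
proof -
  have *: "low n (f * g)" "low n (g * f)" if "low j f" "low k g" for f g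
    using low_mult_le[OF that assms(3)] by (simp_all add: mult.commute)
  show ?thesis
    using assms unfolding low3_def br_def
    by (auto intro!: low_double low_diff intro: *)
qed

lemma nul3_rules:
  "\<lbrakk>nul3 a; nul3 b\<rbrakk> \<Longrightarrow> nul3 (a + b)" "\<lbrakk>nul3 a; nul3 b\<rbrakk> \<Longrightarrow> nul3 (a - b)"
  "nul3 a \<Longrightarrow> nul3 (- a)" "nul3 a \<Longrightarrow> nul3 (lft eul a)"
  and nul3_prod: "nul3 a \<Longrightarrow> nul3 (sm f a)" "nul f \<Longrightarrow> nul3 (sm f c)"
  "nul3 a \<Longrightarrow> nul3 (br a c)" "nul3 a \<Longrightarrow> nul3 (br c a)"
  unfolding nul3_def lft_def sm_def br_def
  by (auto intro!: nul_rules nul_double intro: nul_mult nul_mult')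

lemma nul3_sum: "(\<And>c. c \<in> A \<Longrightarrow> nul3 (f c)) \<Longrightarrow> nul3 (sum f A)"
proof (induction A rule: infinite_finite_induct)
  case (insert c A) then show ?case by (simp add: nul3_rules)
qed (simp_all add: nul3_def nul_zero)

lemma nul3_low3: "nul3 a \<Longrightarrow> low3 k a"
  by (simp add: nul3_iff_low3)

end

subsection \<open>Traceless matrix series\<close>

definition mser :: "fn fls sl2 \<Rightarrow> mseries" where
  "mser a n = mat2 (fst a $$ n) (fst (snd a) $$ n) (snd (snd a) $$ n) (- (fst a $$ n))"

definition tri :: "mseries \<Rightarrow> fn fls sl2" where
  "tri A = (Abs_fls (\<lambda>n. A n $ 1 $ 1), Abs_fls (\<lambda>n. A n $ 1 $ 2), Abs_fls (\<lambda>n. A n $ 2 $ 1))"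

lemma mat2_nth [simp]:
  "mat2 p q r s $ 1 $ 1 = p" "mat2 p q r s $ 1 $ 2 = q"
  "mat2 p q r s $ 2 $ 1 = r" "mat2 p q r s $ 2 $ 2 = s"
  by (simp_all add: mat2_def)

lemma mat2_eq_iff: "A = B \<longleftrightarrow> A $ 1 $ 1 = B $ 1 $ 1 \<and> A $ 1 $ 2 = B $ 1 $ 2 \<and>
    A $ 2 $ 1 = B $ 2 $ 1 \<and> A $ 2 $ 2 = B $ 2 $ 2" for A B :: mat2
  by (simp only: vec_eq_iff[where 'b=2] vec_eq_iff[of "_ :: fn ^ 2"] forall_2 conj_assoc)

lemma matrix_mult_2: "(A ** B) $ i $ j = A $ i $ 1 * B $ 1 $ j + A $ i $ 2 * B $ 2 $ j" for A B :: mat2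
  by (simp add: matrix_matrix_mult_def sum_2)

lemma mat_mult_2: "(mat f ** A) $ i $ j = f * A $ i $ j" for A :: mat2
  using exhaust_2[of i] by (elim disjE) (simp_all add: matrix_mult_2 mat_def)

lemma tri_nth:
  assumes "\<And>n. n < k \<Longrightarrow> A n = 0"
  shows "fst (tri A) $$ n = A n $ 1 $ 1" "fst (snd (tri A)) $$ n = A n $ 1 $ 2"
    "snd (snd (tri A)) $$ n = A n $ 2 $ 1"
  unfolding tri_def fst_conv snd_conv
  by (rule nth_Abs_fls_lower_bound[of k]; simp add: assms)+

lemma mser_tri:
  assumes "\<And>n. n < k \<Longrightarrow> A n = 0" and "\<And>n. A n $ 2 $ 2 = - A n $ 1 $ 1"
  shows "mser (tri A) = A"
  by (rule ext) (simp add: mser_def mat2_eq_iff tri_nth[OF assms(1)] assms(2))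

lemma mser_inject: "mser a = mser b \<longleftrightarrow> a = b"
  by (auto simp: mser_def fun_eq_iff mat2_eq_iff prod_eq_iff fls_eq_iff)

lemma mser_add: "mser (a + b) n = mser a n + mser b n"
  and mser_diff: "mser (a - b) n = mser a n - mser b n"
  and mser_neg: "mser (- a) n = - mser a n"
  by (simp_all add: mser_def mat2_eq_iff)

lemma sprod_nth: "sprod (fls_nth f) (fls_nth g) n = (f * g) $$ n"
proof -
  obtain a where a: "\<forall>n<a. f $$ n = 0" by (rule fls_nth_vanishes_belowE)
  obtain b where b: "\<forall>n<b. g $$ n = 0" by (rule fls_nth_vanishes_belowE)
  have "{i. f $$ i * g $$ (n - i) \<noteq> 0} \<subseteq> {a..n - b}"
  proof
    fix i assume "i \<in> {i. f $$ i * g $$ (n - i) \<noteq> 0}"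
    then have "f $$ i \<noteq> 0" "g $$ (n - i) \<noteq> 0" by auto
    then have "\<not> i < a" "\<not> n - i < b" using a b by blast+
    then show "i \<in> {a..n - b}" by auto
  qed
  then have "sprod (fls_nth f) (fls_nth g) n = (\<Sum>i=a..n - b. f $$ i * g $$ (n - i))"
    unfolding sprod_def by (intro Sum_any.expand_superset) auto
  also have "\<dots> = (f * g) $$ n"
    by (rule fls_times_nth_range[symmetric]) (simp_all add: a b)
  finally show ?thesis .
qed

lemma euler_nth: "euler (fls_nth f) = fls_nth (eul f)"
  by (rule ext) (simp add: euler_def)

lemma mser_vanishes_below:
  obtains k where "\<And>n. n < k \<Longrightarrow> mser a n = 0"
proof -
  obtain p where p: "\<forall>n<p. fst a $$ n = 0" by (rule fls_nth_vanishes_belowE)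
  obtain q where q: "\<forall>n<q. fst (snd a) $$ n = 0" by (rule fls_nth_vanishes_belowE)
  obtain r where r: "\<forall>n<r. snd (snd a) $$ n = 0" by (rule fls_nth_vanishes_belowE)
  show thesis
    by (rule that[of "min p (min q r)"]) (simp add: mser_def mat2_eq_iff p q r)
qed

lemma mprod_nth:
  assumes A: "\<And>n. n < a \<Longrightarrow> A n = 0" and B: "\<And>n. n < b \<Longrightarrow> B n = 0"
  shows "mprod A B n = (\<Sum>i=a..n - b. A i ** B (n - i))"
proof -
  have "{i. A i ** B (n - i) \<noteq> 0} \<subseteq> {a..n - b}"
  proof
    fix i assume i: "i \<in> {i. A i ** B (n - i) \<noteq> 0}"
    have "A i \<noteq> 0" "B (n - i) \<noteq> 0" using i by (auto simp: mat2_eq_iff matrix_mult_2)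
    then have "\<not> i < a" "\<not> n - i < b" using A B by blast+
    then show "i \<in> {a..n - b}" by auto
  qed
  then show ?thesis unfolding mprod_def by (intro Sum_any.expand_superset) auto
qed

lemma mprod_entry:
  assumes A: "\<And>n. n < a \<Longrightarrow> A n = 0" and B: "\<And>n. n < b \<Longrightarrow> B n = 0"
    and f: "\<And>n. f $$ n = A n $ i $ 1" "\<And>n. f' $$ n = A n $ i $ 2"
    and g: "\<And>n. g $$ n = B n $ 1 $ j" "\<And>n. g' $$ n = B n $ 2 $ j"
  shows "mprod A B n $ i $ j = (f * g + f' * g') $$ n"
proof -
  have "(f * g) $$ n = (\<Sum>i=a..n - b. f $$ i * g $$ (n - i))"
    by (rule fls_times_nth_range) (simp_all add: f g A B)
  moreover have "(f' * g') $$ n = (\<Sum>i=a..n - b. f' $$ i * g' $$ (n - i))"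
    by (rule fls_times_nth_range) (simp_all add: f g A B)
  ultimately show ?thesis
    by (simp add: mprod_nth[OF A B] matrix_mult_2 f g sum.distrib)
qed

lemma mprod_mser:
  "mprod (mser a) (mser b) n = mat2
     ((fst a * fst b + fst (snd a) * snd (snd b)) $$ n)
     ((fst a * fst (snd b) + fst (snd a) * (- fst b)) $$ n)
     ((snd (snd a) * fst b + (- fst a) * snd (snd b)) $$ n)
     ((snd (snd a) * fst (snd b) + (- fst a) * (- fst b)) $$ n)"
proof -
  obtain k where k: "\<And>n. n < k \<Longrightarrow> mser a n = 0" using mser_vanishes_below[of a] by blast
  obtain l where l: "\<And>n. n < l \<Longrightarrow> mser b n = 0" using mser_vanishes_below[of b] by blast
  show ?thesis
    unfolding mat2_eq_iff mat2_nth
    by (intro conjI; rule mprod_entry[OF k l]; simp add: mser_def)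
qed

lemma lie_mser: "lie (mser a) (mser b) = mser (br a b)"
  by (rule ext, unfold lie_def mprod_mser mser_def mat2_eq_iff mat2_nth vector_minus_component
      fls_minus_nth[symmetric] fls_uminus_nth[symmetric])
    (simp only: br_def fst_conv snd_conv, intro conjI arg_cong[where f="\<lambda>f. f $$ _"];
      simp add: algebra_simps)

lemma smprod_mser: "smprod (fls_nth f) (mser a) = mser (sm f a)"
proof
  fix n
  obtain p where p: "\<forall>n<p. f $$ n = 0" by (rule fls_nth_vanishes_belowE)
  obtain k where k: "\<And>n. n < k \<Longrightarrow> mser a n = 0" using mser_vanishes_below[of a] by blast
  have "{i. mat (f $$ i) ** mser a (n - i) \<noteq> 0} \<subseteq> {p..n - k}"
  proof
    fix i assume i: "i \<in> {i. mat (f $$ i) ** mser a (n - i) \<noteq> 0}"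
    have "f $$ i \<noteq> 0" "mser a (n - i) \<noteq> 0" using i by (auto simp: mat2_eq_iff mat_mult_2)
    then have "\<not> i < p" "\<not> n - i < k" using p k by blast+
    then show "i \<in> {p..n - k}" by auto
  qed
  then have *: "smprod (fls_nth f) (mser a) n = (\<Sum>i=p..n - k. mat (f $$ i) ** mser a (n - i))"
    unfolding smprod_def by (intro Sum_any.expand_superset) auto
  have g: "g $$ m = 0" if "g \<in> {fst a, fst (snd a), snd (snd a)}" "m < k" for g m
    using k[of m] that by (auto simp: mser_def mat2_eq_iff)
  have "(f * g) $$ n = (\<Sum>i=p..n - k. f $$ i * g $$ (n - i))"
    if "g \<in> {fst a, fst (snd a), snd (snd a)}" for g
    by (rule fls_times_nth_range) (use p g that in auto)
  then show "smprod (fls_nth f) (mser a) n = mser (sm f a) n"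
    by (simp add: * mat2_eq_iff mat_mult_2 mser_def sm_def sum_negf)
qed

lemma meuler_mser: "meuler (mser a) = mser (lft eul a)"
  by (rule ext) (simp add: meuler_def mat2_eq_iff mat_mult_2 mser_def lft_def)

lemma mext0_mser:
  assumes "derivation (D e)"
  shows "mext0 D (mser a) e = mser (lft (dmap (D e)) a)"
proof -
  interpret derivation "D e" by fact
  show ?thesis
    by (rule ext) (simp add: mext0_def ext0_def mat2_eq_iff mser_def lft_def neg)
qed

lemma mvanishes_mser:
  assumes "coeff_ideal I"
  shows "mvanishes I (mser a) \<longleftrightarrow> coeff_ideal.nul3 I a"
proof -
  interpret coeff_ideal I by fact
  show ?thesis
    by (auto simp: mvanishes_def mser_def nul3_def nul_def forall_2 neg_iff)
qed

lemma vanishes_fls_nth: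
  assumes "coeff_ideal I"
  shows "vanishes I (fls_nth f) \<longleftrightarrow> coeff_ideal.nul I f"
  by (simp add: vanishes_def coeff_ideal.nul_def[OF assms])

text \<open>\<open>rv\<close> substitutes \<open>1/\<lambda>\<close> for \<open>\<lambda>\<close>; it turns series bounded above into Laurent series.\<close>

definition rv :: "(int \<Rightarrow> 'a) \<Rightarrow> int \<Rightarrow> 'a" where
  "rv A n = A (- n)"

lemma rv_rv [simp]: "rv (rv A) = A"
  by (simp add: rv_def fun_eq_iff)

lemma Sum_any_neg: "Sum_any (\<lambda>i::int. f (- i)) = Sum_any f"
  by (rule Sum_any.reindex_cong[where l=uminus, symmetric])
    (simp_all add: bij_uminus comp_def)

lemma mprod_rv: "mprod (rv A) (rv B) = rv (mprod A B)"
proof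
  fix n
  show "mprod (rv A) (rv B) n = rv (mprod A B) n"
    unfolding mprod_def rv_def
    by (subst Sum_any_neg[symmetric]) simp
qed

lemma lie_rv: "lie (rv A) (rv B) = rv (lie A B)"
  by (rule ext, unfold lie_def mprod_rv) (simp add: rv_def lie_def)

lemma smprod_rv: "smprod (rv f) (rv A) = rv (smprod f A)"
proof
  fix n
  show "smprod (rv f) (rv A) n = rv (smprod f A) n"
    unfolding smprod_def rv_def
    by (subst Sum_any_neg[symmetric]) simp
qed

lemma sprod_rv: "sprod (rv f) (rv g) = rv (sprod f g)"
proof
  fix n
  show "sprod (rv f) (rv g) n = rv (sprod f g) n"
    unfolding sprod_def rv_def
    by (subst Sum_any_neg[symmetric]) simp
qed

text \<open>Inversion of \<lambda> reverses the Euler operator; this sign is the origin of the minus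
  signs in \<open>x2\<close> and \<open>\<sigma>2_nth\<close>.\<close>

lemma euler_rv: "euler (rv f) n = - rv (euler f) n"
  by (simp add: euler_def rv_def)

lemma meuler_rv: "meuler (rv A) n = - rv (meuler A) n"
  by (simp add: meuler_def rv_def mat2_eq_iff mat_mult_2)

lemma mext0_rv: "mext0 D (rv A) e = rv (mext0 D A e)"
  by (rule ext) (simp add: mext0_def rv_def)

lemma mvanishes_rv: "mvanishes I (rv A) \<longleftrightarrow> mvanishes I A"
  unfolding mvanishes_def rv_def by (metis minus_minus)

lemma vanishes_rv: "vanishes I (rv f) \<longleftrightarrow> vanishes I f"
  unfolding vanishes_def rv_def by (metis minus_minus)

subsection \<open>Consequences of the equations in one view\<close>

text \<open>Linearity in the pair of \<phi> and \<sigma> lets the contraction with T pass through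
  these terms. Where \<phi> or \<sigma> is differentiated, the coefficients must be free of
  \<lambda>, as those of T are.\<close>

lemma Y_term_add: "Y_term dl (a + b) (s + t) y = Y_term dl a s y + Y_term dl b t y"
  and Y_term_sm: "Y_term dl (sm c a) (c * s) y = sm c (Y_term dl a s y)"
  and Y_term_zero: "Y_term dl 0 0 y = 0"
  by (simp_all add: Y_term_def sl2_defs algebra_simps)

lemma sm_zero_left: "sm 0 a = 0"
  by (simp add: sl2_defs)

context derivation
begin

lemma S_term_add: "S_term h (a + b) (s + t) x = S_term h a s x + S_term h b t x"
  and S_term_sm: "h c = 0 \<Longrightarrow> S_term h (sm c a) (c * s) x = sm c (S_term h a s x)"
  and S_term_zero: "S_term h 0 0 x = 0"
  by (simp_all add: S_term_def sl2_defs rules algebra_simps)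

lemma curv_add: "curv h (a + b) (s + t) \<psi> \<tau> = curv h a s \<psi> \<tau> + curv h b t \<psi> \<tau>"
  and curv_sm: "h c = 0 \<Longrightarrow> curv h (sm c a) (c * s) \<psi> \<tau> = sm c (curv h a s \<psi> \<tau>)"
  and curv_zero: "curv h 0 0 \<psi> \<tau> = 0"
  and curv_swap: "curv h \<psi> \<tau> a s = - curv h a s \<psi> \<tau>"
  by (simp_all add: curv_def sl2_defs rules algebra_simps)

lemma Y_term_sum:
  "Y_term h (\<Sum>c\<in>A. sm (t c) (\<phi> c)) (\<Sum>c\<in>A. t c * \<sigma> c) y = (\<Sum>c\<in>A. sm (t c) (Y_term h (\<phi> c) (\<sigma> c) y))"
  by (induction A rule: infinite_finite_induct) (simp_all add: Y_term_zero Y_term_add Y_term_sm)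

lemma S_term_sum:
  assumes "\<And>c. c \<in> A \<Longrightarrow> h (t c) = 0"
  shows "S_term h (\<Sum>c\<in>A. sm (t c) (\<phi> c)) (\<Sum>c\<in>A. t c * \<sigma> c) x
    = (\<Sum>c\<in>A. sm (t c) (S_term h (\<phi> c) (\<sigma> c) x))"
  using assms
  by (induction A rule: infinite_finite_induct) (simp_all add: S_term_zero S_term_add S_term_sm)

lemma curv_sum:
  assumes "\<And>c. c \<in> A \<Longrightarrow> h (t c) = 0"
  shows "curv h (\<Sum>c\<in>A. sm (t c) (\<phi> c)) (\<Sum>c\<in>A. t c * \<sigma> c) \<psi> \<tau>
    = (\<Sum>c\<in>A. sm (t c) (curv h (\<phi> c) (\<sigma> c) \<psi> \<tau>))"
  using assms
  by (induction A rule: infinite_finite_induct) (simp_all add: curv_zero curv_add curv_sm)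

lemma lft_add: "lft h (a + b) = lft h a + lft h b"
  by (simp add: sl2_defs rules)

end

lemma sm_add: "sm c (a + b) = sm c a + sm c b"
  by (simp add: sl2_defs algebra_simps)

lemma eul_const: "eul (fls_const c) = 0"
  by (simp add: eul_def)

definition T_support ::
  "nat \<Rightarrow> (basis_form \<Rightarrow> basis_form \<Rightarrow> basis_form \<Rightarrow> fn) \<Rightarrow> basis_form \<Rightarrow> basis_form \<Rightarrow> basis_form set" where
  "T_support N T e f = {c. c \<in> coframe N \<and> T c e f \<noteq> 0}"

text \<open>The terms of d of a 1-form in which d falls on the basis forms, as in the last sum of
  \<open>ext1\<close>.\<close>

definition tsum ::
  "nat \<Rightarrow> (basis_form \<Rightarrow> basis_form \<Rightarrow> basis_form \<Rightarrow> fn) \<Rightarrow> (basis_form \<Rightarrow> fn fls) \<Rightarrow> basis_form \<Rightarrow>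
      basis_form \<Rightarrow> fn fls" where
  "tsum N T \<sigma> e f = (\<Sum>c\<in>T_support N T e f. fls_const (T c e f) * \<sigma> c)"

definition tsum3 ::
  "nat \<Rightarrow> (basis_form \<Rightarrow> basis_form \<Rightarrow> basis_form \<Rightarrow> fn) \<Rightarrow> (basis_form \<Rightarrow> fn fls sl2) \<Rightarrow> basis_form \<Rightarrow>
      basis_form \<Rightarrow> fn fls sl2" where
  "tsum3 N T \<phi> e f = (\<Sum>c\<in>T_support N T e f. sm (fls_const (T c e f)) (\<phi> c))"

text \<open>Free of T, so that T can later be solved for from it.\<close>

definition curvature ::
  "(basis_form \<Rightarrow> fn \<Rightarrow> fn) \<Rightarrow> (basis_form \<Rightarrow> fn fls sl2) \<Rightarrow> (basis_form \<Rightarrow> fn fls) \<Rightarrow> basis_form \<Rightarrow>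
      basis_form \<Rightarrow> fn fls sl2" where
  "curvature D \<phi> \<sigma> e f = lft (dmap (D e)) (\<phi> f) - lft (dmap (D f)) (\<phi> e)
     + curv eul (\<phi> e) (\<sigma> e) (\<phi> f) (\<sigma> f)"

definition dd ::
  "nat \<Rightarrow> (basis_form \<Rightarrow> fn \<Rightarrow> fn) \<Rightarrow> (basis_form \<Rightarrow> basis_form \<Rightarrow> basis_form \<Rightarrow> fn) \<Rightarrow> basis_form \<Rightarrow>
      basis_form \<Rightarrow> fn fls sl2 \<Rightarrow> fn fls sl2" where
  "dd N D T e f a = lft (dmap (D e)) (lft (dmap (D f)) a) - lft (dmap (D f)) (lft (dmap (D e)) a)
     + tsum3 N T (\<lambda>c. lft (dmap (D c)) a) e f"

locale cmc_view = coeff_ideal I for I :: "fn set" +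
  fixes N :: nat and D :: "basis_form \<Rightarrow> fn \<Rightarrow> fn" and T :: "basis_form \<Rightarrow> basis_form \<Rightarrow> basis_form \<Rightarrow> fn"
    and y x :: "fn fls sl2" and \<phi> :: "basis_form \<Rightarrow> fn fls sl2" and \<sigma> :: "basis_form \<Rightarrow> fn fls"
  assumes deriv: "e \<in> coframe N \<Longrightarrow> derivation (D e)"
    and sigma_const: "\<lbrakk>e \<in> coframe N; f \<in> coframe N\<rbrakk> \<Longrightarrow> dmap (D e) (\<sigma> f) = 0"
    and Y_equation: "e \<in> coframe N \<Longrightarrow> nul3 (lft (dmap (D e)) y + Y_term eul (\<phi> e) (\<sigma> e) y)"
    and S_equation: "e \<in> coframe N \<Longrightarrow> nul3 (lft (dmap (D e)) x + S_term eul (\<phi> e) (\<sigma> e) x)"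
    and struct: "\<lbrakk>e \<in> coframe N; f \<in> coframe N\<rbrakk> \<Longrightarrow> nul3 (tsum3 N T \<phi> e f + curvature D \<phi> \<sigma> e f)"
    and sigma_struct: "\<lbrakk>e \<in> coframe N; f \<in> coframe N\<rbrakk> \<Longrightarrow>
      nul (tsum N T \<sigma> e f + (\<sigma> e * eul (\<sigma> f) - \<sigma> f * eul (\<sigma> e)))"
begin

lemma dmap_derivation: "e \<in> coframe N \<Longrightarrow> derivation (dmap (D e))"
  using deriv derivation.derivation_dmap by blast

lemma D_eul: "e \<in> coframe N \<Longrightarrow> dmap (D e) (eul a) = eul (dmap (D e) a)"
  using deriv derivation.dmap_eul by blast

lemma commuting: "\<lbrakk>e \<in> coframe N; f \<in> coframe N\<rbrakk> \<Longrightarrow> commuting_derivations (dmap (D e)) (dmap (D f)) eul"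
  by (intro commuting_derivations.intro commuting_derivations_axioms.intro
      dmap_derivation derivation_eul D_eul)

text \<open>Here c stands for 4 \<gamma> \<lambda>^2. Having Euler weight 2, it can be subtracted in
  \<open>quad_derivative\<close> without changing the \<sigma> term.\<close>

lemma quad_preserved:
  assumes e: "e \<in> coframe N" and z: "nul (quad y - c)" and "dmap (D e) c = 0" "eul c = 2 * c"
  shows "nul (dmap (D e) (quad y - c))"
proof -
  interpret d: derivation "dmap (D e)" using e by (rule dmap_derivation)
  interpret dl: derivation eul by (rule derivation_eul)
  let ?Z = "lft (dmap (D e)) y + Y_term eul (\<phi> e) (\<sigma> e) y"
  have "dmap (D e) (quad y - c) = killing y ?Z - \<sigma> e * (eul (quad y - c) - 2 * (quad y - c))"
    using quad_derivative[OF d.derivation_axioms derivation_eul, of y "\<phi> e" "\<sigma> e"] assms(3,4)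
    by (simp add: d.rules dl.rules algebra_simps)
  moreover have "nul (killing y ?Z)"
    using Y_equation[OF e] unfolding killing_def nul3_def
    by (auto intro!: nul_rules nul_double intro: nul_mult nul_mult')
  ultimately show ?thesis
    using z nul_rules(2)[OF nul_rules(4)[OF z] nul_double[OF z]] by (auto intro!: nul_rules nul_mult')
qed

lemma SY_preserved:
  assumes e: "e \<in> coframe N" and z: "nul3 (SY_rel eul x y)"
  shows "nul3 (lft (dmap (D e)) (SY_rel eul x y))"
  unfolding SY_rel_derivative[OF dmap_derivation[OF e] derivation_eul D_eul[OF e], of x y "\<phi> e" "\<sigma> e"]
  using Y_equation[OF e] S_equation[OF e] z by (auto intro!: nul3_rules intro: nul3_prod)

text \<open>The hypothesis under which an equation modulo I may be differentiated; it enters every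
  computation of d^2 below.\<close>

definition preserved :: bool where
  "preserved \<longleftrightarrow> (\<forall>e\<in>coframe N. \<forall>r\<in>I. D e r \<in> I)"

lemma nul3_D: "\<lbrakk>preserved; e \<in> coframe N; nul3 a\<rbrakk> \<Longrightarrow> nul3 (lft (dmap (D e)) a)"
  unfolding preserved_def nul3_def nul_def lft_def
  by (simp add: derivation.dmap_nth[OF deriv])

lemma nul3_Y_term: "\<lbrakk>nul3 a; nul s\<rbrakk> \<Longrightarrow> nul3 (Y_term eul a s b)"
  and nul3_S_term: "\<lbrakk>nul3 a; nul s\<rbrakk> \<Longrightarrow> nul3 (S_term eul a s b)"
  and nul3_curv: "\<lbrakk>nul3 a; nul s\<rbrakk> \<Longrightarrow> nul3 (curv eul a s b t)"
  and nul3_Y_term': "nul3 b \<Longrightarrow> nul3 (Y_term eul a s b)"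
  unfolding Y_term_def S_term_def curv_def
  by (auto intro!: nul3_rules intro: nul3_prod nul_rules)

lemma tsum3_D:
  assumes "\<And>c. c \<in> coframe N \<Longrightarrow> nul3 (lft (dmap (D c)) a + E c)"
  shows "nul3 (tsum3 N T (\<lambda>c. lft (dmap (D c)) a) e f + tsum3 N T E e f)"
  unfolding tsum3_def sum.distrib[symmetric] sm_add[symmetric]
  by (rule nul3_sum, rule nul3_prod) (auto simp: T_support_def intro: assms)

lemma dd_Y:
  assumes pres: preserved and e: "e \<in> coframe N" and f: "f \<in> coframe N"
  shows "nul3 (dd N D T e f y)"
proof -
  interpret commuting_derivations "dmap (D e)" "dmap (D f)" eul using commuting e f .
  let ?F = "tsum3 N T \<phi> e f" and ?S = "tsum N T \<sigma> e f"
  let ?St = "?F + curvature D \<phi> \<sigma> e f"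
  let ?Ss = "?S + (\<sigma> e * eul (\<sigma> f) - \<sigma> f * eul (\<sigma> e))"
  let ?TD = "tsum3 N T (\<lambda>c. lft (dmap (D c)) y) e f"
  let ?TY = "tsum3 N T (\<lambda>c. Y_term eul (\<phi> c) (\<sigma> c) y) e f"
  let ?Ee = "lft (dmap (D e)) y + Y_term eul (\<phi> e) (\<sigma> e) y"
  let ?Ef = "lft (dmap (D f)) y + Y_term eul (\<phi> f) (\<sigma> f) y"
  have TY: "?TY = Y_term eul ?F ?S y"
    by (simp add: tsum3_def tsum_def dl.Y_term_sum)
  have "dd N D T e f y = lft (dmap (D e)) ?Ef - lft (dmap (D f)) ?Ee - Y_term eul (\<phi> f) (\<sigma> f) ?Ee
      + Y_term eul (\<phi> e) (\<sigma> e) ?Ef + (?TD + ?TY) - Y_term eul ?St ?Ss y"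
    unfolding dd_def
    by (rule Y_second_derivative[where F="?F" and S="?S"])
      (simp_all add: curvature_def TY sigma_const e f)
  moreover have "nul3 (?TD + ?TY)"
    by (rule tsum3_D) (rule Y_equation)
  moreover note Y_equation[OF e] Y_equation[OF f]
  ultimately show ?thesis
    using struct[OF e f] sigma_struct[OF e f]
      nul3_D[OF pres e Y_equation[OF f]] nul3_D[OF pres f Y_equation[OF e]]
    by (auto intro!: nul3_rules intro: nul3_Y_term nul3_Y_term')
qed

lemma dd_S:
  assumes pres: preserved and e: "e \<in> coframe N" and f: "f \<in> coframe N"
  shows "nul3 (dd N D T e f x)"
proof -
  interpret commuting_derivations "dmap (D e)" "dmap (D f)" eul using commuting e f .
  let ?F = "tsum3 N T \<phi> e f" and ?S = "tsum N T \<sigma> e f"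
  let ?St = "?F + curvature D \<phi> \<sigma> e f"
  let ?Ss = "?S + (\<sigma> e * eul (\<sigma> f) - \<sigma> f * eul (\<sigma> e))"
  let ?TD = "tsum3 N T (\<lambda>c. lft (dmap (D c)) x) e f"
  let ?TS = "tsum3 N T (\<lambda>c. S_term eul (\<phi> c) (\<sigma> c) x) e f"
  let ?Ee = "lft (dmap (D e)) x + S_term eul (\<phi> e) (\<sigma> e) x"
  let ?Ef = "lft (dmap (D f)) x + S_term eul (\<phi> f) (\<sigma> f) x"
  have TS: "?TS = S_term eul ?F ?S x"
    by (simp add: tsum3_def tsum_def dl.S_term_sum eul_const)
  have "dd N D T e f x = lft (dmap (D e)) ?Ef - lft (dmap (D f)) ?Ee
      - (br (\<phi> f) ?Ee + sm (eul (\<sigma> f)) ?Ee + sm (\<sigma> f) (lft eul ?Ee))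
      + (br (\<phi> e) ?Ef + sm (eul (\<sigma> e)) ?Ef + sm (\<sigma> e) (lft eul ?Ef))
      + (?TD + ?TS) - S_term eul ?St ?Ss x"
    unfolding dd_def
    by (rule S_second_derivative[where F="?F" and S="?S"])
      (simp_all add: curvature_def TS sigma_const e f)
  moreover have "nul3 (?TD + ?TS)"
    by (rule tsum3_D) (rule S_equation)
  moreover note S_equation[OF e] S_equation[OF f]
  ultimately show ?thesis
    using struct[OF e f] sigma_struct[OF e f]
      nul3_D[OF pres e S_equation[OF f]] nul3_D[OF pres f S_equation[OF e]]
    by (auto intro!: nul3_rules nul3_S_term intro: nul3_prod)
qed

text \<open>Applying d to the structure equation gives d^2 of the basis forms times the components
  of \<phi>, plus the cyclic sum of \<open>Z\<close>. The lemma says that this second part lies in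
  the ideal; d^2 on \<phi> enters through the commutators of the derivations.\<close>

lemma Bianchi_structure:
  assumes pres: preserved and mem: "e \<in> coframe N" "f \<in> coframe N" "g \<in> coframe N"
    and dd: "\<And>e f g. \<lbrakk>e \<in> coframe N; f \<in> coframe N; g \<in> coframe N\<rbrakk> \<Longrightarrow> nul3 (dd N D T e f (\<phi> g))"
  defines "Z \<equiv> \<lambda>e f g. lft (dmap (D g)) (curvature D \<phi> \<sigma> e f)
    + tsum3 N T (\<lambda>c. curvature D \<phi> \<sigma> c g + lft (dmap (D g)) (\<phi> c)) e f"
  shows "nul3 (Z e f g + Z f g e + Z g e f)"
proof -
  let ?B = "curvature D \<phi> \<sigma>" and ?s = "\<lambda>e f. \<sigma> e * eul (\<sigma> f) - \<sigma> f * eul (\<sigma> e)"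
  let ?R = "\<lambda>e f g. lft (dmap (D g)) (?B e f) - lft (dmap (D e)) (lft (dmap (D f)) (\<phi> g))
    + lft (dmap (D f)) (lft (dmap (D e)) (\<phi> g)) - curv eul (?B e f) (?s e f) (\<phi> g) (\<sigma> g)"
  let ?W = "\<lambda>e f g. dd N D T e f (\<phi> g)
    + curv eul (tsum3 N T \<phi> e f + ?B e f) (tsum N T \<sigma> e f + ?s e f) (\<phi> g) (\<sigma> g)"
  interpret dl: derivation eul by (rule derivation_eul)
  \<comment> \<open>In \<open>curvature\<close> at c and g the term with \<open>D g\<close> on
    \<phi> c cancels the summand added in \<open>Z\<close>. The rest assembles into d^2 of \<phi> g
    and a contraction of the structure equations.\<close>
  have Z: "Z e f g = ?R e f g + ?W e f g" for e f g
  proof -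
    have "tsum3 N T (\<lambda>c. ?B c g + lft (dmap (D g)) (\<phi> c)) e f =
        tsum3 N T (\<lambda>c. lft (dmap (D c)) (\<phi> g)) e f
        + tsum3 N T (\<lambda>c. curv eul (\<phi> c) (\<sigma> c) (\<phi> g) (\<sigma> g)) e f"
      unfolding tsum3_def sum.distrib[symmetric] sm_add[symmetric] curvature_def
      by (simp add: algebra_simps)
    also have "tsum3 N T (\<lambda>c. curv eul (\<phi> c) (\<sigma> c) (\<phi> g) (\<sigma> g)) e f =
        curv eul (tsum3 N T \<phi> e f) (tsum N T \<sigma> e f) (\<phi> g) (\<sigma> g)"
      by (simp add: tsum3_def tsum_def dl.curv_sum eul_const)
    finally show ?thesis
      unfolding Z_def dd_def dl.curv_add by (simp add: algebra_simps)
  qed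
  have "?R e f g + ?R f g e + ?R g e f = 0"
    unfolding curvature_def
    by (rule Bianchi) (simp_all add: mem dmap_derivation derivation_eul D_eul sigma_const)
  then have "Z e f g + Z f g e + Z g e f = ?W e f g + ?W f g e + ?W g e f"
    unfolding Z by (simp add: algebra_simps eq_neg_iff_add_eq_0)
  moreover have *: "nul3 (?W e f g)" if "e \<in> coframe N" "f \<in> coframe N" "g \<in> coframe N" for e f g
    using dd[OF that] struct[OF that(1,2)] sigma_struct[OF that(1,2)]
    by (auto intro!: nul3_rules(1) nul3_curv)
  ultimately show ?thesis
    by (simp only:) (rule nul3_rules(1)[OF nul3_rules(1)]; rule *; rule mem)
qed

text \<open>In the cyclic sum of \<open>?W\<close> the double brackets of components of \<sigma>
  cancel by the Jacobi identity for vector fields, and \<open>Z\<close> remains.\<close>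

lemma sigma_Jacobi:
  assumes mem: "e \<in> coframe N" "f \<in> coframe N" "g \<in> coframe N"
  defines "Z \<equiv> \<lambda>e f g. (\<Sum>c\<in>T_support N T e f. fls_const (T c e f) * (\<sigma> c * eul (\<sigma> g) - \<sigma> g * eul (\<sigma> c)))"
  shows "nul (Z e f g + Z f g e + Z g e f)"
proof -
  interpret dl: derivation eul by (rule derivation_eul)
  let ?s = "\<lambda>e f. \<sigma> e * eul (\<sigma> f) - \<sigma> f * eul (\<sigma> e)"
  let ?E = "\<lambda>e f. tsum N T \<sigma> e f + ?s e f"
  let ?W = "\<lambda>e f g. ?E e f * eul (\<sigma> g) - \<sigma> g * eul (?E e f)"
  have Z: "Z e f g = tsum N T \<sigma> e f * eul (\<sigma> g) - \<sigma> g * eul (tsum N T \<sigma> e f)" for e f g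
    unfolding Z_def tsum_def
    by (simp add: dl.sum dl.mult eul_const sum_distrib_left sum_distrib_right right_diff_distrib
        sum_subtractf mult_ac)
  have "Z e f g + Z f g e + Z g e f = ?W e f g + ?W f g e + ?W g e f"
    unfolding Z by (simp add: dl.rules algebra_simps)
  moreover have *: "nul (?W e f g)" if "e \<in> coframe N" "f \<in> coframe N" for e f g
    using sigma_struct[OF that] nul_rules(2)[OF nul_mult nul_mult'[OF nul_rules(4)]] by blast
  ultimately show ?thesis
    by (simp only:) (rule nul_rules(1)[OF nul_rules(1)]; rule *; rule mem)
qed

text \<open>Apply d to an equation in which d of the basis form b occurs with a constant factor
  \<kappa>. By \<open>Z\<close> the other part \<omega> is closed modulo I. The factor must be a
  unit, because from a product in the ideal one cannot pass to a factor in general.\<close>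

lemma ext2_in_ideal:
  assumes pres: preserved and mem: "e \<in> coframe N" "f \<in> coframe N" "g \<in> coframe N"
    and \<kappa>: "\<kappa>' * \<kappa> = 1" "\<And>e. e \<in> coframe N \<Longrightarrow> D e \<kappa> = 0"
    and T: "\<And>e f. \<lbrakk>e \<in> coframe N; f \<in> coframe N\<rbrakk> \<Longrightarrow> \<kappa> * T b e f + \<omega> e f \<in> I"
    and Z: "(D g (\<omega> e f) + (\<Sum>c\<in>T_support N T e f. T c e f * \<omega> c g))
      + (D e (\<omega> f g) + (\<Sum>c\<in>T_support N T f g. T c f g * \<omega> c e))
      + (D f (\<omega> g e) + (\<Sum>c\<in>T_support N T g e. T c g e * \<omega> c f)) \<in> I"
  shows "ext2 N D T (T b) e f g \<in> I"
proof -
  let ?Z = "\<lambda>e f g. D g (\<omega> e f) + (\<Sum>c\<in>T_support N T e f. T c e f * \<omega> c g)"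
  let ?E = "\<lambda>e f. \<kappa> * T b e f + \<omega> e f"
  let ?W = "\<lambda>e f g. D g (?E e f) + (\<Sum>c\<in>T_support N T e f. T c e f * ?E c g)"
  let ?V = "\<lambda>e f g. D g (T b e f) + (\<Sum>c\<in>T_support N T e f. T c e f * T b c g)"
  have WV: "?W e f g = \<kappa> * ?V e f g + ?Z e f g" if "g \<in> coframe N" for e f g
  proof -
    interpret d: derivation "D g" using deriv that .
    show ?thesis
      by (simp add: d.add d.mult \<kappa>(2) that algebra_simps sum.distrib sum_distrib_left)
  qed
  have W: "?W e f g \<in> I" if "e \<in> coframe N" "f \<in> coframe N" "g \<in> coframe N" for e f g
  proof (rule add)
    show "D g (?E e f) \<in> I"
      using pres T[OF that(1,2)] that(3) unfolding preserved_def by blast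
    show "(\<Sum>c\<in>T_support N T e f. T c e f * ?E c g) \<in> I"
      by (rule sum, rule mult, rule T) (use that(3) in \<open>auto simp: T_support_def\<close>)
  qed
  have "ext2 N D T (T b) e f g = ?V e f g + ?V f g e + ?V g e f"
    by (simp add: ext2_def T_support_def add_ac)
  then have "\<kappa> * ext2 N D T (T b) e f g + (?Z e f g + ?Z f g e + ?Z g e f)
      = ?W e f g + ?W f g e + ?W g e f"
    unfolding WV[OF mem(1)] WV[OF mem(2)] WV[OF mem(3)] by (simp add: algebra_simps)
  also have "\<dots> \<in> I" by (rule add[OF add]; rule W; rule mem)
  finally have "\<kappa> * ext2 N D T (T b) e f g \<in> I"
    using diff[OF _ Z] by fastforce
  then have "\<kappa>' * (\<kappa> * ext2 N D T (T b) e f g) \<in> I" by (rule mult)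
  then show ?thesis by (simp add: mult.assoc[symmetric] \<kappa>)
qed

text \<open>Only \<open>\<phi> Rho\<close> has a diagonal coefficient at \<open>\<lambda>\<^sup>0\<close>, and it is constant; in this coefficient the terms
  \<open>T c e f\<close> times \<open>D g (\<phi> c)\<close> of the Bianchi identity drop out.\<close>

lemma Rho_closed:
  assumes pres: preserved and mem: "e \<in> coframe N" "f \<in> coframe N" "g \<in> coframe N"
    and dd: "\<And>e f g. \<lbrakk>e \<in> coframe N; f \<in> coframe N; g \<in> coframe N\<rbrakk> \<Longrightarrow> nul3 (dd N D T e f (\<phi> g))"
    and \<kappa>: "\<kappa>' * \<kappa> = 1" "\<And>e. e \<in> coframe N \<Longrightarrow> D e \<kappa> = 0"
    and coeff: "\<And>c. c \<in> coframe N \<Longrightarrow> fst (\<phi> c) $$ 0 = (if c = Rho then \<kappa> else 0)"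
    and fin: "\<And>e f. \<lbrakk>e \<in> coframe N; f \<in> coframe N\<rbrakk> \<Longrightarrow> finite (T_support N T e f)"
  shows "ext2 N D T (T Rho) e f g \<in> I"
proof -
  let ?\<omega> = "\<lambda>e f. fst (curvature D \<phi> \<sigma> e f) $$ 0"
  let ?Z = "\<lambda>e f g. D g (?\<omega> e f) + (\<Sum>c\<in>T_support N T e f. T c e f * ?\<omega> c g)"
  have tsum: "fst (tsum3 N T a e f) $$ 0 = (\<Sum>c\<in>T_support N T e f. T c e f * fst (a c) $$ 0)" for a e f
    by (simp add: tsum3_def fst_sum fls_nth_sum sm_def)
  have Rho: "Rho \<in> coframe N" by (simp add: coframe_def)
  show ?thesis
  proof (rule ext2_in_ideal[where \<omega>="?\<omega>", OF pres mem \<kappa>])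
    fix e f assume ef: "e \<in> coframe N" "f \<in> coframe N"
    have "(\<Sum>c\<in>T_support N T e f. T c e f * fst (\<phi> c) $$ 0) =
        (\<Sum>c\<in>T_support N T e f. if c = Rho then T c e f * \<kappa> else 0)"
      by (rule sum.cong) (auto simp: T_support_def coeff)
    also have "\<dots> = \<kappa> * T Rho e f"
      using fin[OF ef] Rho by (auto simp: T_support_def mult.commute)
    finally have "fst (tsum3 N T \<phi> e f + curvature D \<phi> \<sigma> e f) $$ 0 = \<kappa> * T Rho e f + ?\<omega> e f"
      by (simp add: tsum)
    then show "\<kappa> * T Rho e f + ?\<omega> e f \<in> I"
      using struct[OF ef] unfolding nul3_def nul_def by metis
  next
    have "fst (lft (dmap (D g)) (curvature D \<phi> \<sigma> e f)
        + tsum3 N T (\<lambda>c. curvature D \<phi> \<sigma> c g + lft (dmap (D g)) (\<phi> c)) e f) $$ 0 = ?Z e f g"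
      if "g \<in> coframe N" for e f g
    proof -
      interpret d: derivation "D g" using deriv that .
      show ?thesis
        by (auto simp: tsum lft_def coeff T_support_def d.zero \<kappa>(2) that intro!: sum.cong)
    qed
    then show "?Z e f g + ?Z f g e + ?Z g e f \<in> I"
      using Bianchi_structure[OF pres mem dd] mem unfolding nul3_def nul_def
      by (metis (no_types, lifting) fst_add fls_plus_nth)
  qed
qed

text \<open>Each \<open>Sig k\<close> owns one power of \<lambda> in \<sigma>, so a single
  coefficient isolates its differential. All coefficients of \<sigma> are constants, hence the
  derivative of \<omega> vanishes and only the Jacobi identity is left.\<close>

lemma Sig_closed:
  assumes pres: preserved and mem: "e \<in> coframe N" "f \<in> coframe N" "g \<in> coframe N"
    and \<kappa>: "\<kappa>' * \<kappa> = 1" "\<And>e. e \<in> coframe N \<Longrightarrow> D e \<kappa> = 0"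
    and b: "b \<in> coframe N"
    and coeff: "\<And>c. c \<in> coframe N \<Longrightarrow> \<sigma> c $$ j = (if c = b then \<kappa> else 0)"
    and fin: "\<And>e f. \<lbrakk>e \<in> coframe N; f \<in> coframe N\<rbrakk> \<Longrightarrow> finite (T_support N T e f)"
  shows "ext2 N D T (T b) e f g \<in> I"
proof -
  let ?s = "\<lambda>e f. \<sigma> e * eul (\<sigma> f) - \<sigma> f * eul (\<sigma> e)"
  let ?\<omega> = "\<lambda>e f. ?s e f $$ j"
  let ?Z = "\<lambda>e f g. D g (?\<omega> e f) + (\<Sum>c\<in>T_support N T e f. T c e f * ?\<omega> c g)"
  show ?thesis
  proof (rule ext2_in_ideal[where \<omega>="?\<omega>", OF pres mem \<kappa>])
    fix e f assume ef: "e \<in> coframe N" "f \<in> coframe N"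
    have "tsum N T \<sigma> e f $$ j = (\<Sum>c\<in>T_support N T e f. if c = b then T c e f * \<kappa> else 0)"
      unfolding tsum_def fls_nth_sum by (rule sum.cong) (auto simp: T_support_def coeff)
    also have "\<dots> = \<kappa> * T b e f"
      using fin[OF ef] b by (auto simp: T_support_def mult.commute)
    finally have "(tsum N T \<sigma> e f + ?s e f) $$ j = \<kappa> * T b e f + ?\<omega> e f" by simp
    then show "\<kappa> * T b e f + ?\<omega> e f \<in> I"
      using sigma_struct[OF ef] unfolding nul_def by metis
  next
    have Z: "(\<Sum>c\<in>T_support N T e f. fls_const (T c e f) * ?s c g) $$ j = ?Z e f g"
      if "e \<in> coframe N" "f \<in> coframe N" "g \<in> coframe N" for e f g
    proof -
      interpret d: derivation "dmap (D g)" using dmap_derivation that(3) .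
      have "dmap (D g) (?s e f) = 0"
        by (simp add: d.rules D_eul sigma_const that derivation.zero[OF derivation_eul])
      then have "D g (?\<omega> e f) = 0"
        using derivation.dmap_nth[OF deriv[OF that(3)], of "?s e f" j] by simp
      then show ?thesis by (simp add: fls_nth_sum)
    qed
    show "?Z e f g + ?Z f g e + ?Z g e f \<in> I"
      using sigma_Jacobi[OF mem] unfolding nul_def
      unfolding Z[OF mem(1,2,3), symmetric] Z[OF mem(2,3,1), symmetric] Z[OF mem(3,1,2), symmetric]
      by (metis (no_types, lifting) fls_plus_nth)
  qed
qed

end

subsection \<open>The shape of the connection form\<close>

definition lmonom :: "'a::comm_ring_1 \<Rightarrow> int \<Rightarrow> 'a fls" where
  "lmonom c j = fls_shift (- j) (fls_const c)"

lemma mono_nth: "lmonom c j $$ n = (if n = j then c else 0)"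
  by (auto simp: lmonom_def)

lemma mono_times_nth: "(lmonom c j * f) $$ n = c * f $$ (n - j)"
  by (simp add: lmonom_def fls_shifted_times_simps)

lemma mono_mult: "lmonom a i * lmonom b j = lmonom (a * b) (i + j)"
  by (rule fls_eqI) (auto simp: mono_times_nth mono_nth)

lemma eul_mono: "eul (lmonom c j) = fls_const (of_int j) * lmonom c j"
  by (rule fls_eqI) (simp add: mono_nth)

lemma (in derivation) dmap_mono: "h c = 0 \<Longrightarrow> dmap h (lmonom c j) = 0"
  by (rule fls_eqI) (simp add: mono_nth zero)

text \<open>Exact vanishing rather than vanishing modulo the ideal: it survives any derivation, also
  one not yet known to preserve the ideal.\<close>

definition reg3 :: "'a::comm_ring_1 fls sl2 \<Rightarrow> bool" where
  "reg3 a \<longleftrightarrow> (\<forall>n<0. fst a $$ n = 0 \<and> fst (snd a) $$ n = 0 \<and> snd (snd a) $$ n = 0)"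

lemma (in derivation) reg3_dmap: "reg3 a \<Longrightarrow> reg3 (lft (dmap h) a)"
  by (simp add: reg3_def lft_def zero)

lemma (in coeff_ideal) reg3_low3: "reg3 a \<Longrightarrow> low3 0 a"
  by (simp add: reg3_def low3_def low_def zero)

lemma (in coeff_ideal) low_mono_coeff: "k \<le> j \<Longrightarrow> low k (lmonom c j)"
  by (simp add: low_def mono_nth zero)

lemma (in coeff_ideal) low_const: "low 0 (fls_const a)"
  by (simp add: low_def zero)

lemma curvature_swap: "curvature D \<phi> \<sigma> f e = - curvature D \<phi> \<sigma> e f"
  by (simp add: curvature_def derivation.curv_swap[OF derivation_eul, of "\<phi> f"])

text \<open>In the first view \<open>p\<close> is \<open>DT\<close>, in the second \<open>DTbar\<close>. According to \<open>pole\<close> the forms along \<open>Sig k\<close>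
  have only negative or only positive powers of \<open>\<lambda>\<close>.\<close>

locale shaped = coeff_ideal I for I :: "fn set" +
  fixes N :: nat and y x :: "fn fls sl2" and \<phi> :: "basis_form \<Rightarrow> fn fls sl2" and \<sigma> :: "basis_form \<Rightarrow> fn fls"
    and p q :: "nat \<Rightarrow> basis_form" and pole :: bool and c :: complex
  assumes pq: "p = DT \<and> q = DTbar \<or> p = DTbar \<and> q = DT"
    and y_low: "low3 1 y" and x_low: "low3 (- (2 * int N + 1)) x"
    and SY: "nul3 (SY_rel eul x y)"
    and p_shape: "m \<le> N \<Longrightarrow> \<exists>P. reg3 P \<and> \<phi> (p m) = sm (lmonom (const c) (- (2 * int m + 2))) y + P"
      "m \<le> N \<Longrightarrow> \<sigma> (p m) = 0"
    and q_shape: "m \<le> N \<Longrightarrow> reg3 (\<phi> (q m))" "m \<le> N \<Longrightarrow> \<sigma> (q m) = 0"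
    and Rho_shape: "reg3 (\<phi> Rho)" "\<sigma> Rho = 0"
    and pole_shape: "\<lbrakk>pole; N < k\<rbrakk> \<Longrightarrow> \<exists>P. reg3 P \<and> \<phi> (Sig k) = sm (lmonom 1 (- 2 * int k)) x + P"
      "\<lbrakk>pole; N < k\<rbrakk> \<Longrightarrow> \<sigma> (Sig k) = lmonom 1 (- 2 * int k)"
    and no_pole_shape: "\<lbrakk>\<not> pole; N < k\<rbrakk> \<Longrightarrow> reg3 (\<phi> (Sig k))"
      "\<lbrakk>\<not> pole; N < k\<rbrakk> \<Longrightarrow> \<sigma> (Sig k) = lmonom (- 1) (2 * int k)"
begin

text \<open>The regular case includes \<open>Sig k\<close> without a pole. There \<sigma> need not
  vanish but has order at least 2N+2, because k is at least N+1.\<close>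

lemma coframe_cases:
  assumes "e \<in> coframe N"
  obtains (Y) m where "m \<le> N" "e = p m"
    | (S) k where "pole" "N < k" "e = Sig k"
    | (regular) "reg3 (\<phi> e)" "\<sigma> e = 0 \<or> \<not> pole" "low (2 * int N + 2) (\<sigma> e)" "\<And>k. e = Sig k \<Longrightarrow> \<not> pole"
proof -
  from assms pq consider m where "m \<le> N" "e = p m" | m where "m \<le> N" "e = q m" "\<And>k. e \<noteq> Sig k"
    | "e = Rho" | k where "N < k" "e = Sig k"
    unfolding coframe_def by (auto simp: Suc_le_eq)
  then show thesis
  proof cases
    case (4 k)
    then show thesis
      using S[of k] regular by (cases pole) (auto simp: no_pole_shape low_mono_coeff)
  qed (use Y regular in \<open>auto simp: q_shape Rho_shape low_zero\<close>)
qed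

text \<open>Order 0 would do for solving the equation of Y. Order 1 shows moreover that the
  derivative of a^1 stays in the ideal.\<close>

lemma low_Y_term:
  assumes "e \<in> coframe N"
  shows "low3 1 (Y_term eul (\<phi> e) (\<sigma> e) y)"
  using assms
proof (cases rule: coframe_cases)
  case (Y m)
  then obtain P where P: "reg3 P" "\<phi> e = sm (lmonom (const c) (- (2 * int m + 2))) y + P"
    using p_shape by blast
  show ?thesis
    using derivation.Y_term_Y[OF derivation_eul P(2)] low3_br[OF reg3_low3[OF P(1)] y_low]
    by (simp add: Y p_shape)
next
  case (S k)
  then obtain P where P: "reg3 P" "\<phi> e = sm (lmonom 1 (- 2 * int k)) x + P"
    using pole_shape by blast
  show ?thesis
    using derivation.Y_term_S[OF derivation_eul P(2), of y] low3_br[OF reg3_low3[OF P(1)] y_low]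
      nul3_low3[OF nul3_prod(1)[OF SY]]
    by (auto simp: S pole_shape intro!: low3_rules)
next
  case regular
  have "low3 1 (sm (\<sigma> e) (lft eul y - y))"
    by (rule low3_sm[OF regular(3), where k=1]) (auto intro!: low3_rules y_low)
  moreover have "low3 1 (br (\<phi> e) y)"
    using low3_br[OF reg3_low3[OF regular(1)] y_low] by simp
  ultimately show ?thesis
    unfolding Y_term_def by (intro low3_rules(1))
qed

text \<open>The bound is the lowest power in S, so its equation can be solved. The critical case is
  \<open>p N\<close>: by \<open>S_term_Y\<close> it leaves y times a monomial of order -(2N+2), and
  y has order 1.\<close>

lemma low_S_term:
  assumes "e \<in> coframe N"
  shows "low3 (- (2 * int N + 1)) (S_term eul (\<phi> e) (\<sigma> e) x)"
proof -
  have P_low: "low3 (- (2 * int N + 1)) (br P x - lft eul P)" if "reg3 P" for P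
    using reg3_low3[OF that] x_low
    by (intro low3_rules low3_br[of 0 P _ x]) (auto intro: low3_mono)
  from assms show ?thesis
  proof (cases rule: coframe_cases)
    case (Y m)
    let ?u = "lmonom (const c) (- (2 * int m + 2))"
    from Y obtain P where P: "reg3 P" "\<phi> e = sm ?u y + P"
      using p_shape by blast
    have "low (- (2 * int N + 2)) ((fls_const (of_int (- (2 * int m + 2))) + 1) * ?u)"
      by (rule low_mult_le[of 0 _ "- (2 * int N + 2)"])
        (use Y in \<open>auto simp: low_def zero mono_nth\<close>)
    then have "low3 (- (2 * int N + 1)) (sm ((fls_const (of_int (- (2 * int m + 2))) + 1) * ?u) y)"
      by (rule low3_sm[OF _ y_low]) simp
    then show ?thesis
      using derivation.S_term_Y[OF derivation_eul P(2) eul_mono, of x] P_low[OF P(1)]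
        nul3_low3[OF nul3_prod(1)[OF SY]]
      by (auto simp: Y p_shape intro!: low3_rules)
  next
    case (S k)
    then obtain P where P: "reg3 P" "\<phi> e = sm (lmonom 1 (- 2 * int k)) x + P"
      using pole_shape by blast
    show ?thesis
      using derivation.S_term_S[OF derivation_eul P(2) eul_mono] P_low[OF P(1)]
      by (simp add: S pole_shape)
  next
    case regular
    have "low3 (- (2 * int N + 1)) (sm s a)"
      if "low (2 * int N + 2) s" "low3 (- (2 * int N + 1)) a" for s a
      using that by (rule low3_sm) simp
    moreover have S_term: "S_term eul (\<phi> e) (\<sigma> e) x = (br (\<phi> e) x - lft eul (\<phi> e))
        + sm (eul (\<sigma> e)) x + sm (\<sigma> e) (lft eul x)"
      by (simp add: S_term_def algebra_simps)
    ultimately show ?thesis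
      using P_low[OF regular(1)] regular(3) x_low low_eul[OF regular(3)] low3_rules(4)[OF x_low]
        low3_rules(1)[OF low3_rules(1)]
      unfolding S_term by blast
  qed
qed

text \<open>The negative part of the curvature is that of \<open>curvature_pole\<close>.\<close>

definition curvature_pole :: "basis_form \<Rightarrow> basis_form \<Rightarrow> fn fls sl2" where
  "curvature_pole e f = (case (e, f) of (Sig a, Sig b) \<Rightarrow>
     if pole then sm (lmonom (of_int (2 * (int a - int b))) (- 2 * int (a + b))) x else 0 | _ \<Rightarrow> 0)"

end

context shaped
begin

lemma curvature_pole_swap: "curvature_pole f e = - curvature_pole e f"
proof -
  have swap: "sm (lmonom (of_int (2 * (int b - int a))) j) x = - sm (lmonom (of_int (2 * (int a -
      int b))) j) x"
    for a b j
    by (simp add: sm_def prod_eq_iff fls_eq_iff mono_times_nth) (simp add: algebra_simps)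
  show ?thesis
  proof (cases "\<exists>a b. e = Sig a \<and> f = Sig b")
    case True
    then obtain a b where "e = Sig a" "f = Sig b" by blast
    then show ?thesis
      unfolding curvature_pole_def by (simp only: basis_form.case prod.case add.commute[of b a])
        (simp only: swap[of b a] minus_zero split: if_split, simp)
  qed (auto simp: curvature_pole_def split: basis_form.splits)
qed

lemma curvature_low_swap:
  assumes "low3 0 (curvature D \<phi> \<sigma> e f - curvature_pole e f)"
  shows "low3 0 (curvature D \<phi> \<sigma> f e - curvature_pole f e)"
  using low3_rules(3)[OF assms]
  unfolding curvature_swap[of D _ _ f e] curvature_pole_swap[of f e] by (simp add: algebra_simps)

text \<open>The structure equations are absent here: the curvature is estimated before d of the
  basis forms has been constructed from it.\<close>

context
  fixes D :: "basis_form \<Rightarrow> fn \<Rightarrow> fn"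
  assumes deriv: "\<And>e. e \<in> coframe N \<Longrightarrow> derivation (D e)"
    and D_const: "\<And>e. e \<in> coframe N \<Longrightarrow> D e (const c) = 0"
    and Y_equation: "\<And>e. e \<in> coframe N \<Longrightarrow> nul3 (lft (dmap (D e)) y + Y_term eul (\<phi> e) (\<sigma> e) y)"
    and S_equation: "\<And>e. e \<in> coframe N \<Longrightarrow> nul3 (lft (dmap (D e)) x + S_term eul (\<phi> e) (\<sigma> e) x)"
begin

lemma commuting: "\<lbrakk>e \<in> coframe N; f \<in> coframe N\<rbrakk> \<Longrightarrow> commuting_derivations (dmap (D e)) (dmap (D f)) eul"
  by (intro commuting_derivations.intro commuting_derivations_axioms.intro
      derivation.derivation_dmap derivation.dmap_eul deriv derivation_eul)

lemma low3_D_reg: "\<lbrakk>e \<in> coframe N; reg3 P\<rbrakk> \<Longrightarrow> low3 0 (lft (dmap (D e)) P)"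
  using deriv derivation.reg3_dmap reg3_low3 by blast

lemma low3_br_reg: "\<lbrakk>reg3 P; reg3 Q\<rbrakk> \<Longrightarrow> low3 0 (br P Q)"
  using low3_br[OF reg3_low3 reg3_low3] by simp

lemma D_mono: "e \<in> coframe N \<Longrightarrow> dmap (D e) (lmonom (const c) j) = 0" "e \<in> coframe N \<Longrightarrow> dmap (D e)
    (lmonom 1 j) = 0"
  using derivation.dmap_mono[OF deriv] derivation.one[OF deriv] D_const by blast+

lemma nul3_sm_Y: "e \<in> coframe N \<Longrightarrow> low3 0 (sm u (lft (dmap (D e)) y + Y_term eul (\<phi> e) (\<sigma> e) y))"
  and nul3_sm_S: "e \<in> coframe N \<Longrightarrow> low3 0 (sm u (lft (dmap (D e)) x + S_term eul (\<phi> e) (\<sigma> e) x))"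
  by (rule nul3_low3, rule nul3_prod, erule Y_equation S_equation)+

lemma curvature_low_regular:
  assumes e: "e \<in> coframe N" and f: "f \<in> coframe N"
    and reg: "reg3 (\<phi> e)" "\<sigma> e = 0 \<or> \<not> pole" "low (2 * int N + 2) (\<sigma> e)"
  shows "low3 0 (curvature D \<phi> \<sigma> e f)"
proof -
  interpret commuting_derivations "dmap (D e)" "dmap (D f)" eul using commuting e f .
  have low_s: "low3 0 (sm (\<sigma> e) a)" if "low3 0 a" for a
    using low3_sm[OF reg(3) that] by simp
  note De = low3_D_reg[OF f reg(1)]
  show ?thesis
    using f
  proof (cases rule: coframe_cases)
    case (Y m)
    let ?u = "lmonom (const c) (- (2 * int m + 2))" and ?k = "fls_const (of_int (- (2 * int m + 2)) :: fn)"
    from Y obtain P where P: "reg3 P" "\<phi> f = sm ?u y + P"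
      using p_shape by blast
    have \<sigma>: "\<sigma> f = 0" using Y p_shape by simp
    have "curvature D \<phi> \<sigma> e f =
        (lft (dmap (D e)) (sm ?u y) + curv eul (\<phi> e) (\<sigma> e) (\<phi> f) 0)
        + lft (dmap (D e)) P - lft (dmap (D f)) (\<phi> e)"
      by (simp add: curvature_def \<sigma> P(2) de.lft_add algebra_simps)
    also have "lft (dmap (D e)) (sm ?u y) + curv eul (\<phi> e) (\<sigma> e) (\<phi> f) 0 =
        sm ?u (lft (dmap (D e)) y + Y_term eul (\<phi> e) (\<sigma> e) y) + br (\<phi> e) P
        + sm (\<sigma> e) (lft eul P) + sm ((?k + 1) * ?u * \<sigma> e) y"
      by (rule curv_Y[OF P(2) eul_mono D_mono(1)[OF e]])
    finally have eq: "curvature D \<phi> \<sigma> e f = \<dots> + lft (dmap (D e)) P - lft (dmap (D f)) (\<phi> e)" .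
    have "low (- (2 * int N + 2)) ((?k + 1) * ?u)"
      by (rule low_mult_le[of 0 _ "- (2 * int N + 2)"])
        (use Y in \<open>auto simp: low_def zero mono_nth\<close>)
    \<comment> \<open>The pole of order at most 2N+2 meets a \<sigma> of order at least
      2N+2.\<close>
    then have "low 0 ((?k + 1) * ?u * \<sigma> e)"
      by (rule low_mult_le[OF _ reg(3)]) simp
    then have "low3 0 (sm ((?k + 1) * ?u * \<sigma> e) y)"
      by (rule low3_sm[OF _ y_low]) simp
    then show ?thesis
      unfolding eq
      by (intro low3_rules(1,2) nul3_sm_Y e low3_br_reg reg(1) P(1) low_s
          low3_rules(4)[OF reg3_low3] low3_D_reg f)
  next
    case (S k)
    let ?v = "lmonom 1 (- 2 * int k)"
    from S obtain P where P: "reg3 P" "\<phi> f = sm ?v x + P"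
      using pole_shape by blast
    \<comment> \<open>Polar and regular \<open>Sig\<close> forms never coexist in one view, so a
      regular form has no \<sigma> here.\<close>
    have \<sigma>: "\<sigma> f = ?v" "\<sigma> e = 0" using S pole_shape reg(2) by simp_all
    have "curvature D \<phi> \<sigma> e f =
        (lft (dmap (D e)) (sm ?v x) + curv eul (\<phi> e) 0 (\<phi> f) ?v)
        + lft (dmap (D e)) P - lft (dmap (D f)) (\<phi> e)"
      by (simp add: curvature_def \<sigma> P(2) de.lft_add algebra_simps)
    also have "lft (dmap (D e)) (sm ?v x) + curv eul (\<phi> e) 0 (\<phi> f) ?v =
        sm ?v (lft (dmap (D e)) x + S_term eul (\<phi> e) 0 x) + br (\<phi> e) P"
      by (rule curv_S[OF P(2) eul_mono D_mono(2)[OF e]])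
    finally show ?thesis
      using nul3_sm_S[OF e, of ?v] unfolding \<sigma>
      by (auto intro!: low3_rules(1,2) low3_br_reg reg(1) P(1) low3_D_reg e f)
  next
    case regular
    have "low3 0 (sm (\<sigma> f) (lft eul (\<phi> e)))"
      using low3_sm[OF regular(3) low3_rules(4)[OF reg3_low3[OF reg(1)]]] by simp
    then show ?thesis
      unfolding curvature_def curv_def
      by (intro low3_rules(1,2) low3_D_reg e f low3_br_reg reg(1) regular(1) low_s
          low3_rules(4)[OF reg3_low3] \<open>low3 0 (sm (\<sigma> f) (lft eul (\<phi> e)))\<close>)
  qed
qed

lemma curvature_low_YY:
  assumes e: "e \<in> coframe N" "m \<le> N" "e = p m" and f: "f \<in> coframe N" "n \<le> N" "f = p n"
  shows "low3 0 (curvature D \<phi> \<sigma> e f)"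
proof -
  interpret commuting_derivations "dmap (D e)" "dmap (D f)" eul using commuting e f by blast
  let ?u = "lmonom (const c) (- (2 * int m + 2))" and ?v = "lmonom (const c) (- (2 * int n + 2))"
  from e obtain P where P: "reg3 P" "\<phi> e = sm ?u y + P" using p_shape by blast
  from f obtain Q where Q: "reg3 Q" "\<phi> f = sm ?v y + Q" using p_shape by blast
  have \<sigma>: "\<sigma> e = 0" "\<sigma> f = 0" using e f p_shape by simp_all
  have "curvature D \<phi> \<sigma> e f =
      (lft (dmap (D e)) (sm ?v y) - lft (dmap (D f)) (sm ?u y) + curv eul (\<phi> e) 0 (\<phi> f) 0)
      + lft (dmap (D e)) Q - lft (dmap (D f)) P"
    by (simp add: curvature_def \<sigma> P(2) Q(2) de.lft_add df.lft_add algebra_simps)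
  also have "lft (dmap (D e)) (sm ?v y) - lft (dmap (D f)) (sm ?u y) + curv eul (\<phi> e) 0 (\<phi> f) 0 =
      sm ?v (lft (dmap (D e)) y + Y_term eul (\<phi> e) 0 y)
      - sm ?u (lft (dmap (D f)) y + Y_term eul (\<phi> f) 0 y) + br P Q"
    by (rule curv_YY[OF P(2) Q(2)]) (use e f in \<open>simp_all add: D_mono\<close>)
  finally show ?thesis
    using nul3_sm_Y[OF e(1), of ?v] nul3_sm_Y[OF f(1), of ?u] unfolding \<sigma>
    by (auto intro!: low3_rules(1,2) low3_br_reg P(1) Q(1) low3_D_reg e(1) f(1))
qed

lemma curvature_low_YS:
  assumes e: "e \<in> coframe N" "m \<le> N" "e = p m" and f: "f \<in> coframe N" "pole" "N < k" "f = Sig k"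
  shows "low3 0 (curvature D \<phi> \<sigma> e f)"
proof -
  interpret commuting_derivations "dmap (D e)" "dmap (D f)" eul using commuting e f by blast
  let ?u = "lmonom (const c) (- (2 * int m + 2))" and ?v = "lmonom 1 (- 2 * int k)"
  from e obtain P where P: "reg3 P" "\<phi> e = sm ?u y + P" using p_shape by blast
  from f obtain Q where Q: "reg3 Q" "\<phi> f = sm ?v x + Q" using pole_shape by blast
  have \<sigma>: "\<sigma> e = 0" "\<sigma> f = ?v" using e f p_shape pole_shape by simp_all
  have "curvature D \<phi> \<sigma> e f =
      (lft (dmap (D e)) (sm ?v x) - lft (dmap (D f)) (sm ?u y) + curv eul (\<phi> e) 0 (\<phi> f) ?v)
      + lft (dmap (D e)) Q - lft (dmap (D f)) P"
    by (simp add: curvature_def \<sigma> P(2) Q(2) de.lft_add df.lft_add algebra_simps)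
  also have "lft (dmap (D e)) (sm ?v x) - lft (dmap (D f)) (sm ?u y) + curv eul (\<phi> e) 0 (\<phi> f) ?v =
      sm ?v (lft (dmap (D e)) x + S_term eul (\<phi> e) 0 x)
      - sm ?u (lft (dmap (D f)) y + Y_term eul (\<phi> f) ?v y) + br P Q + sm (?u * ?v) (SY_rel eul x y)"
    by (rule curv_YS[OF P(2) Q(2)]) (use e f in \<open>simp_all add: D_mono\<close>)
  finally show ?thesis
    using nul3_sm_S[OF e(1), of ?v] nul3_sm_Y[OF f(1), of ?u] nul3_low3[OF nul3_prod(1)[OF SY]]
    unfolding \<sigma>
    by (auto intro!: low3_rules(1,2) low3_br_reg P(1) Q(1) low3_D_reg e(1) f(1))
qed

lemma curvature_low_SS:
  assumes e: "e \<in> coframe N" "pole" "N < k" "e = Sig k" and f: "f \<in> coframe N" "N < l" "f = Sig l"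
  shows "low3 0 (curvature D \<phi> \<sigma> e f - curvature_pole e f)"
proof -
  interpret commuting_derivations "dmap (D e)" "dmap (D f)" eul using commuting e f by blast
  let ?u = "lmonom 1 (- 2 * int k)" and ?v = "lmonom 1 (- 2 * int l)"
  let ?k = "fls_const (of_int (- 2 * int k)) :: fn fls" and ?l = "fls_const (of_int (- 2 * int l)) :: fn fls"
  from e obtain P where P: "reg3 P" "\<phi> e = sm ?u x + P" using pole_shape by blast
  from e f obtain Q where Q: "reg3 Q" "\<phi> f = sm ?v x + Q" using pole_shape by blast
  have \<sigma>: "\<sigma> e = ?u" "\<sigma> f = ?v" using e f pole_shape by simp_all
  have eq1: "curvature D \<phi> \<sigma> e f =
      (lft (dmap (D e)) (sm ?v x) - lft (dmap (D f)) (sm ?u x) + curv eul (\<phi> e) ?u (\<phi> f) ?v)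
      + lft (dmap (D e)) Q - lft (dmap (D f)) P"
    by (simp add: curvature_def \<sigma> P(2) Q(2) de.lft_add df.lft_add algebra_simps)
  have eq2: "lft (dmap (D e)) (sm ?v x) - lft (dmap (D f)) (sm ?u x) + curv eul (\<phi> e) ?u (\<phi> f) ?v =
      sm ?v (lft (dmap (D e)) x + S_term eul (\<phi> e) ?u x)
      - sm ?u (lft (dmap (D f)) x + S_term eul (\<phi> f) ?v x) + br P Q + sm ((?l - ?k) * (?u * ?v)) x"
    by (rule curv_SS[OF P(2) Q(2)]) (use e f in \<open>simp_all add: D_mono eul_mono\<close>)
  have eq3: "(?l - ?k) * (?u * ?v) = lmonom (of_int (2 * (int k - int l))) (- 2 * int (k + l))"
    by (rule fls_eqI) (simp add: mono_mult left_diff_distrib mono_nth algebra_simps)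
  have pole_eq: "curvature_pole e f = sm (lmonom (of_int (2 * (int k - int l))) (- 2 * int (k + l))) x"
    unfolding curvature_pole_def by (simp add: e f)
  have "curvature D \<phi> \<sigma> e f - curvature_pole e f =
      sm ?v (lft (dmap (D e)) x + S_term eul (\<phi> e) ?u x)
      - sm ?u (lft (dmap (D f)) x + S_term eul (\<phi> f) ?v x) + br P Q
      + lft (dmap (D e)) Q - lft (dmap (D f)) P"
    unfolding eq1 eq2 eq3 pole_eq by simp
  then show ?thesis
    using nul3_sm_S[OF e(1), of ?v] nul3_sm_S[OF f(1), of ?u]
    unfolding \<sigma>
    by (auto intro!: low3_rules(1,2) low3_br_reg P(1) Q(1) low3_D_reg e(1) f(1))
qed

lemma curvature_low:
  assumes e: "e \<in> coframe N" and f: "f \<in> coframe N"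
  shows "low3 0 (curvature D \<phi> \<sigma> e f - curvature_pole e f)"
proof -
  have Y_pole: "curvature_pole (p m) f = 0" "curvature_pole f (p m) = 0" for m f
    using pq by (auto simp: curvature_pole_def split: basis_form.splits)
  have reg_pole: "curvature_pole e f = 0" "curvature_pole f e = 0" if "\<And>k. e = Sig k \<Longrightarrow> \<not> pole" for e f
    using that by (auto simp: curvature_pole_def split: basis_form.splits)
  \<comment> \<open>All pairs whose first form is not a polar \<open>Sig\<close>. By antisymmetry
    only pairs of polar \<open>Sig\<close> forms remain, the ones with a nonzero
    \<open>curvature_pole\<close>.\<close>
  have half: "low3 0 (curvature D \<phi> \<sigma> e f - curvature_pole e f)"
    if e: "e \<in> coframe N" "\<And>k. e = Sig k \<Longrightarrow> \<not> pole" and f: "f \<in> coframe N" for e f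
    using e(1)
  proof (cases rule: coframe_cases)
    case (Y m)
    from f show ?thesis
    proof (cases rule: coframe_cases)
      case Y': (Y n)
      then show ?thesis using curvature_low_YY[OF e(1) Y f Y'] Y Y_pole by simp
    next
      case (S k)
      then show ?thesis using curvature_low_YS[OF e(1) Y f S] Y Y_pole by simp
    next
      case regular
      then show ?thesis
        using curvature_low_swap[of D f e] curvature_low_regular[OF f e(1)] Y Y_pole by simp
    qed
  next
    case (S k)
    then show ?thesis using e by blast
  next
    case regular
    then show ?thesis using curvature_low_regular[OF e(1) f] reg_pole by simp
  qed
  from e show ?thesis
  proof (cases rule: coframe_cases)
    case (S k)
    from f show ?thesis
    proof (cases rule: coframe_cases)
      case S': (S l)
      then show ?thesis using curvature_low_SS[OF e S f] by blast
    next
      case (Y n)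
      then show ?thesis using half[OF f _ e] curvature_low_swap pq by blast
    next
      case regular
      then show ?thesis using half[OF f _ e] curvature_low_swap by blast
    qed
  qed (use half[OF e _ f] pq in blast)+
qed

end

end

subsection \<open>The two views of the system\<close>

fun flip :: "sgn \<Rightarrow> sgn" where
  "flip Plus = Minus"
| "flip Minus = Plus"

fun \<sigma>1 :: "sgn \<Rightarrow> basis_form \<Rightarrow> fn fls" where
  "\<sigma>1 Plus (Sig k) = lmonom (- 1) (2 * int k)"
| "\<sigma>1 Minus (Sig k) = lmonom 1 (- 2 * int k)"
| "\<sigma>1 _ _ = 0"

definition y1 :: "fn fls sl2" where "y1 = tri Y_ser"
definition x1 :: "nat \<Rightarrow> fn fls sl2" where "x1 N = tri (S_ser N)"
definition \<phi>1 :: "nat \<Rightarrow> sgn \<Rightarrow> basis_form \<Rightarrow> fn fls sl2" where "\<phi>1 N s e = tri (phi_hat N s e)"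

definition y2 :: "fn fls sl2" where "y2 = tri (rv (adj Y_ser))"
definition x2 :: "nat \<Rightarrow> fn fls sl2" where "x2 N = - tri (rv (adj (S_ser N)))"
definition \<phi>2 :: "nat \<Rightarrow> sgn \<Rightarrow> basis_form \<Rightarrow> fn fls sl2" where "\<phi>2 N s e = tri (rv (phi_hat N s e))"

text \<open>For one sign, minus \<sigma> at 1/\<lambda> is \<sigma> of the opposite sign.\<close>

abbreviation \<sigma>2 :: "sgn \<Rightarrow> basis_form \<Rightarrow> fn fls" where "\<sigma>2 s \<equiv> \<sigma>1 (flip s)"

lemma Y_ser_trace: "Y_ser n $ 2 $ 2 = - Y_ser n $ 1 $ 1"
  by (simp add: Y_ser_def const_uminus)

lemma S_ser_trace: "S_ser N n $ 2 $ 2 = - S_ser N n $ 1 $ 1"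
  by (simp add: S_ser_def)

lemma adj_nth: "adj A n $ i $ j = bar (A (- n) $ j $ i)"
  by (simp add: adj_def)

lemma Y_ser_neg: "n < 0 \<Longrightarrow> Y_ser n = 0"
  by (simp add: Y_ser_def)

lemma S_ser_low: "n < - (2 * int N + 1) \<Longrightarrow> S_ser N n = 0"
  by (simp add: S_ser_def)

lemma mser_y1: "mser y1 = Y_ser"
  unfolding y1_def by (rule mser_tri[of 0]) (simp_all add: Y_ser_neg Y_ser_trace)

lemma mser_x1: "mser (x1 N) = S_ser N"
  unfolding x1_def by (rule mser_tri[of "- (2 * int N + 1)"]) (simp_all add: S_ser_low S_ser_trace)

lemma mser_y2: "mser y2 = rv (adj Y_ser)"
  unfolding y2_def
  by (rule mser_tri[of 0]) (simp_all add: mat2_eq_iff rv_def adj_nth Y_ser_neg Y_ser_trace bar_uminus)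

lemma mser_minus_x2: "mser (- x2 N) = rv (adj (S_ser N))"
  unfolding x2_def minus_minus
  by (rule mser_tri[of "- (2 * int N + 1)"])
    (simp_all add: mat2_eq_iff rv_def adj_nth S_ser_low S_ser_trace bar_uminus)

lemma U_neg_nth: "U_neg m n = (if n < 0 then mat (const (1 / (2 * \<i>))) ** Y_ser (n + (2 * int m + 2)) else 0)"
  unfolding U_neg_def neg_part_def shift_def diff_minus_eq_add by auto

lemma S_neg_nth: "S_neg N k n = (if n < 0 then S_ser N (n + 2 * int k) else 0)"
  by (auto simp: S_neg_def neg_part_def shift_def)

lemma U_neg_trace: "U_neg m n $ 2 $ 2 = - U_neg m n $ 1 $ 1"
  by (simp add: U_neg_nth mat_mult_2 Y_ser_trace)

lemma S_neg_trace: "S_neg N k n $ 2 $ 2 = - S_neg N k n $ 1 $ 1"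
  by (simp add: S_neg_nth S_ser_trace)

lemma phi_hat_trace: "phi_hat N s e n $ 2 $ 2 = - phi_hat N s e n $ 1 $ 1"
  by (cases "(N, s, e)" rule: phi_hat.cases)
    (simp_all add: U_neg_trace S_neg_trace adj_nth bar_uminus const_uminus)

text \<open>Each component of the connection is a Laurent polynomial, so it can be read as a Laurent
  series both in \<lambda> and in 1/\<lambda>.\<close>

lemma phi_hat_support:
  obtains b where "\<And>n. \<bar>n\<bar> > b \<Longrightarrow> phi_hat N s e n = 0"
proof -
  have "\<exists>b. \<forall>n. \<bar>n\<bar> > b \<longrightarrow> phi_hat N s e n = 0"
  proof (cases "(N, s, e)" rule: phi_hat.cases)
    case (1 N s)
    then show ?thesis by (auto intro!: exI[of _ 0])
  next
    case (2 N s m)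
    then show ?thesis
      by (auto intro!: exI[of _ "2 * int m + 2"] simp: abs_if mat2_eq_iff U_neg_nth mat_mult_2
          Y_ser_neg split: if_splits)
  next
    case (3 N s m)
    then show ?thesis
      by (auto intro!: exI[of _ "2 * int m + 2"] simp: abs_if mat2_eq_iff adj_nth U_neg_nth
          mat_mult_2 Y_ser_neg split: if_splits)
  next
    case (4 N k)
    then show ?thesis
      by (auto intro!: exI[of _ "2 * int N + 1 + 2 * int k"] simp: abs_if mat2_eq_iff adj_nth
          S_neg_nth S_ser_low split: if_splits)
  next
    case (5 N k)
    then show ?thesis
      by (auto intro!: exI[of _ "2 * int N + 1 + 2 * int k"] simp: abs_if S_neg_nth S_ser_low
          split: if_splits)
  qed
  then show thesis using that by blast
qed

lemma mser_\<phi>1: "mser (\<phi>1 N s e) = phi_hat N s e"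
proof -
  obtain b where b: "\<And>n. \<bar>n\<bar> > b \<Longrightarrow> phi_hat N s e n = 0" using phi_hat_support by blast
  show ?thesis
    unfolding \<phi>1_def by (rule mser_tri[of "- \<bar>b\<bar>"]) (simp_all add: b phi_hat_trace)
qed

lemma mser_\<phi>2: "mser (\<phi>2 N s e) = rv (phi_hat N s e)"
proof -
  obtain b where b: "\<And>n. \<bar>n\<bar> > b \<Longrightarrow> phi_hat N s e n = 0" using phi_hat_support by blast
  show ?thesis
    unfolding \<phi>2_def by (rule mser_tri[of "- \<bar>b\<bar>"]) (simp_all add: b phi_hat_trace rv_def)
qed

lemma fls_nth_\<sigma>1: "fls_nth (\<sigma>1 s e) = sigma s e"
  by (cases "(s, e)" rule: \<sigma>1.cases) (auto simp: mono_nth fun_eq_iff)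

lemma \<sigma>2_nth: "\<sigma>2 s e $$ n = - (\<sigma>1 s e $$ (- n))"
  by (cases "(s, e)" rule: \<sigma>1.cases) (auto simp: mono_nth)

lemma sigma_eq_rv: "sigma s e = rv (fls_nth (- \<sigma>2 s e))"
  by (rule ext) (simp add: rv_def \<sigma>2_nth fls_nth_\<sigma>1[symmetric])

lemma dmap_\<sigma>1: "derivation d \<Longrightarrow> dmap d (\<sigma>1 s e) = 0"
  by (cases "(s, e)" rule: \<sigma>1.cases)
    (simp_all add: derivation.dmap_mono derivation.one derivation.neg derivation.zero
        derivation.derivation_dmap)

lemma mser_sm_mono: "mser (sm (lmonom c j) a) n = mat c ** mser a (n - j)"
  by (simp add: mat2_eq_iff mat_mult_2 mser_def sm_def mono_times_nth)

lemma mser_sm_mono_neg: "mser (sm (lmonom c (- j)) a) n = mat c ** mser a (n + j)"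
  by (simp add: mser_sm_mono)

lemma reg3_iff: "reg3 a \<longleftrightarrow> (\<forall>n<0. mser a n = 0)"
  by (auto simp: reg3_def mser_def mat2_eq_iff)

lemma mat_1_mult: "mat 1 ** A = A" for A :: mat2
  by (simp add: mat2_eq_iff mat_mult_2)

text \<open>The conjugate transpose with \<open>\<lambda>\<close> kept fixed.\<close>

definition bt :: "fn fls sl2 \<Rightarrow> fn fls sl2" where
  "bt a = (dmap bar (fst a), dmap bar (snd (snd a)), dmap bar (fst (snd a)))"

lemma bar_nth [simp]: "dmap bar f $$ n = bar (f $$ n)"
proof -
  obtain k where k: "\<forall>n<k. f $$ n = 0" by (rule fls_nth_vanishes_belowE)
  show ?thesis
    unfolding dmap_def by (rule nth_Abs_fls_lower_bound[of k]) (simp add: k)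
qed

lemma bar_fls_mult: "dmap bar (f * g) = dmap bar f * dmap bar g"
proof (rule fls_eqI)
  fix n
  obtain a where a: "\<forall>n<a. f $$ n = 0" by (rule fls_nth_vanishes_belowE)
  obtain b where b: "\<forall>n<b. g $$ n = 0" by (rule fls_nth_vanishes_belowE)
  have "(f * g) $$ n = (\<Sum>i=a..n - b. f $$ i * g $$ (n - i))"
    by (rule fls_times_nth_range) (simp_all add: a b)
  moreover have "(dmap bar f * dmap bar g) $$ n = (\<Sum>i=a..n - b. dmap bar f $$ i * dmap bar g $$ (n - i))"
    by (rule fls_times_nth_range) (simp_all add: a b)
  ultimately show "dmap bar (f * g) $$ n = (dmap bar f * dmap bar g) $$ n"
    by (simp add: bar_sum bar_mult)
qed

lemma bar_fls_rules:
  "dmap bar (f + g) = dmap bar f + dmap bar g" "dmap bar (f - g) = dmap bar f - dmap bar g"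
  "dmap bar (- f) = - dmap bar f" "dmap bar (eul f) = eul (dmap bar f)"
  by (rule fls_eqI; simp add: bar_add bar_diff bar_uminus bar_mult)+

lemma bar_fls_2: "dmap bar 2 = 2"
proof -
  have "dmap bar 1 = 1" by (rule fls_eqI) simp
  then show ?thesis using bar_fls_rules(1)[of 1 1] by simp
qed

lemma y2_eq: "y2 = bt y1"
proof -
  have "mser (bt y1) n = mser y2 n" for n
    unfolding mser_y2 rv_def mat2_eq_iff adj_nth minus_minus mser_y1[symmetric]
    by (simp add: mser_def bt_def bar_uminus)
  then have "mser y2 = mser (bt y1)" by (simp add: fun_eq_iff)
  then show ?thesis by (simp only: mser_inject)
qed

lemma x2_eq: "x2 N = - bt (x1 N)"
proof -
  have "mser (bt (x1 N)) n = mser (- x2 N) n" for n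
    unfolding mser_minus_x2 rv_def mat2_eq_iff adj_nth minus_minus mser_x1[symmetric]
    by (simp add: mser_def bt_def bar_uminus)
  then have "mser (bt (x1 N)) = mser (- x2 N)" by (simp add: fun_eq_iff)
  then have "bt (x1 N) = - x2 N" by (simp only: mser_inject)
  then show ?thesis by simp
qed

text \<open>Transposition reverses commutators, and the minus sign in \<open>x2\<close> restores
  them.\<close>

lemma SY_rel_2: "SY_rel eul (x2 N) y2 = bt (SY_rel eul (x1 N) y1)"
  unfolding y2_eq x2_eq
  by (simp add: SY_rel_def bt_def sl2_defs bar_fls_rules bar_fls_mult bar_fls_2 algebra_simps)

lemma quad_2: "quad y2 = dmap bar (quad y1)"
  unfolding y2_eq by (simp add: quad_def bt_def bar_fls_rules bar_fls_mult algebra_simps)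

subsection \<open>The ideal of relations\<close>

lemma module_fn: "module ((*) :: fn \<Rightarrow> fn \<Rightarrow> fn)"
  by standard (simp_all add: algebra_simps)

lemma coeff_ideal_rel_ideal: "coeff_ideal (rel_ideal N \<gamma>)"
  unfolding rel_ideal_def
  by standard (simp_all add: module.span_zero[OF module_fn] module.span_add[OF module_fn]
      module.span_scale[OF module_fn])

lemma relation_in_ideal:
  assumes "r \<in> relations N \<gamma>"
  shows "r \<in> rel_ideal N \<gamma>" "bar r \<in> rel_ideal N \<gamma>"
  unfolding rel_ideal_def by (rule module.span_base[OF module_fn]; use assms in blast)+

lemma rel_ideal_bar: "r \<in> rel_ideal N \<gamma> \<Longrightarrow> bar r \<in> rel_ideal N \<gamma>"
proof -
  interpret coeff_ideal "rel_ideal N \<gamma>" by (rule coeff_ideal_rel_ideal)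
  assume "r \<in> rel_ideal N \<gamma>"
  then show ?thesis
    unfolding rel_ideal_def
  proof (induction rule: module.span_induct_alt[OF module_fn, consumes 1, case_names base step])
    case base
    then show ?case by (simp add: module.span_zero[OF module_fn])
  next
    case (step a r r')
    then have "bar r \<in> rel_ideal N \<gamma>" using relation_in_ideal by auto
    then show ?case
      using step add mult unfolding rel_ideal_def[symmetric] bar_add bar_mult by blast
  qed
qed

context
  fixes N :: nat and \<gamma> :: complex and I :: "fn set"
  defines "I \<equiv> rel_ideal N \<gamma>"
begin

interpretation coeff_ideal I
  unfolding I_def by (rule coeff_ideal_rel_ideal)

lemma mdet_eq: "mdet Y_ser n = - (quad y1 $$ n)"
proof -
  have 1: "(\<lambda>i. Y_ser i $ 1 $ 1) = fls_nth (fst y1)" "(\<lambda>i. Y_ser i $ 2 $ 2) = fls_nth (- fst y1)"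
    "(\<lambda>i. Y_ser i $ 1 $ 2) = fls_nth (fst (snd y1))" "(\<lambda>i. Y_ser i $ 2 $ 1) = fls_nth (snd (snd y1))"
    unfolding mser_y1[symmetric] by (auto simp: mser_def fun_eq_iff)
  show ?thesis unfolding mdet_def 1 sprod_nth by (simp add: quad_def)
qed

lemma det_relation: "nul (quad y1 - lmonom (const (4 * \<gamma>)) 2)"
  unfolding nul_def
proof
  fix n
  have "mdet Y_ser n + (if n = 2 then const (4 * \<gamma>) else 0) \<in> I"
    unfolding I_def by (rule relation_in_ideal(1)) (auto simp: relations_def)
  then have "- (mdet Y_ser n + (if n = 2 then const (4 * \<gamma>) else 0)) \<in> I" by (rule neg)
  then show "(quad y1 - lmonom (const (4 * \<gamma>)) 2) $$ n \<in> I"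
    by (simp add: mdet_eq mono_nth split: if_splits)
qed

lemma SY_series: "mser (SY_rel eul (x1 N) y1) n = lie (S_ser N) Y_ser n - (Y_ser n - meuler Y_ser n)"
  unfolding mser_x1[symmetric] mser_y1[symmetric] lie_mser meuler_mser SY_rel_def
  by (simp add: mser_add mser_diff)

lemma SY_relation: "nul3 (SY_rel eul (x1 N) y1)"
proof -
  have "mvanishes I (mser (SY_rel eul (x1 N) y1))"
    unfolding mvanishes_def SY_series I_def
    by (intro allI relation_in_ideal(1)) (auto simp: relations_def)
  then show ?thesis using mvanishes_mser coeff_ideal_axioms by blast
qed

text \<open>The generator a^1 of the ideal removes the coefficient at \<lambda> to the power
  0.\<close>

lemma y1_low: "low3 1 y1"
proof -
  have a: "var (Fn (ACoef 1)) \<in> I"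
    unfolding I_def by (rule relation_in_ideal(1)) (auto simp: relations_def)
  have "mser y1 n $ i $ j \<in> I" if "n < 1" for n i j
  proof -
    from that consider "n < 0" | "n = 0" by linarith
    then show ?thesis
      using a exhaust_2[of i] exhaust_2[of j] unfolding mser_y1
      by cases (auto simp: Y_ser_def zero mult neg_iff)
  qed
  from this[of _ 1 1] this[of _ 1 2] this[of _ 2 1] show ?thesis
    by (auto simp: low3_def low_def mser_def)
qed

lemma x1_low: "low3 (- (2 * int N + 1)) (x1 N)"
proof -
  have "mser (x1 N) n = 0" if "n < - (2 * int N + 1)" for n
    unfolding mser_x1 using that by (rule S_ser_low)
  then show ?thesis
    by (auto simp: low3_def low_def mser_def mat2_eq_iff zero)
qed

lemma bar_I: "r \<in> I \<Longrightarrow> bar r \<in> I"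
  unfolding I_def by (rule rel_ideal_bar)

lemma nul3_bt: "nul3 a \<Longrightarrow> nul3 (bt a)"
  by (simp add: nul3_def nul_def bt_def bar_I)

lemma low3_bt: "low3 k a \<Longrightarrow> low3 k (bt a)"
  by (simp add: low3_def low_def bt_def bar_I)

lemma det_relation_2:
  assumes "cnj \<gamma> = \<gamma>"
  shows "nul (quad y2 - lmonom (const (4 * \<gamma>)) 2)"
proof -
  have "quad y2 - lmonom (const (4 * \<gamma>)) 2 = dmap bar (quad y1 - lmonom (const (4 * \<gamma>)) 2)"
    by (rule fls_eqI) (simp add: quad_2 bar_diff mono_nth assms)
  then show ?thesis using det_relation by (simp add: nul_def bar_I)
qed

lemma shaped_1: "shaped I N y1 (x1 N) (\<phi>1 N s) (\<sigma>1 s) DT DTbar (s = Minus) (1 / (2 * \<i>))"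
proof
  show "DT = DT \<and> DTbar = DTbar \<or> DT = DTbar \<and> DTbar = DT" by simp
  fix m
  show "\<exists>P. reg3 P \<and> \<phi>1 N s (DT m) = sm (lmonom (const (1 / (2 * \<i>))) (- (2 * int m + 2))) y1 + P"
    by (intro exI[of _ "\<phi>1 N s (DT m) - sm (lmonom (const (1 / (2 * \<i>))) (- (2 * int m + 2))) y1"] conjI)
      (unfold reg3_iff mser_diff mser_sm_mono_neg mser_\<phi>1 mser_y1, simp_all add: U_neg_nth)
  show "\<sigma>1 s (DT m) = 0" "\<sigma>1 s (DTbar m) = 0" "\<sigma>1 s Rho = 0" by (cases s; simp)+
  show "reg3 (\<phi>1 N s (DTbar m))" "reg3 (\<phi>1 N s Rho)"
    by (auto simp: reg3_iff mser_\<phi>1 mat2_eq_iff adj_nth U_neg_nth)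
next
  fix k
  show "\<exists>P. reg3 P \<and> \<phi>1 N s (Sig k) = sm (lmonom 1 (- 2 * int k)) (x1 N) + P" if "s = Minus"
    using that
    by (intro exI[of _ "\<phi>1 N s (Sig k) - sm (lmonom 1 (- 2 * int k)) (x1 N)"] conjI)
      (auto simp: reg3_iff mser_diff mser_sm_mono mser_\<phi>1 mser_x1 S_neg_nth mat_1_mult)
  show "reg3 (\<phi>1 N s (Sig k))" if "s \<noteq> Minus"
    using that by (cases s) (auto simp: reg3_iff mser_\<phi>1 mat2_eq_iff adj_nth S_neg_nth)
  show "\<sigma>1 s (Sig k) = lmonom 1 (- 2 * int k)" if "s = Minus" using that by simp
  show "\<sigma>1 s (Sig k) = lmonom (- 1) (2 * int k)" if "s \<noteq> Minus" using that by (cases s) auto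
qed (rule y1_low x1_low SY_relation)+

text \<open>The constant is the same as in the first view: it is purely imaginary, so conjugation
  and the sign in front of the adjoint of U cancel. Poles along \<open>Sig\<close> now belong to the
  opposite sign, since \<lambda> is inverted.\<close>

lemma shaped_2: "shaped I N y2 (x2 N) (\<phi>2 N s) (\<sigma>2 s) DTbar DT (s = Plus) (1 / (2 * \<i>))"
proof
  show "DTbar = DT \<and> DT = DTbar \<or> DTbar = DTbar \<and> DT = DT" by simp
  fix m
  show "\<exists>P. reg3 P \<and> \<phi>2 N s (DTbar m) = sm (lmonom (const (1 / (2 * \<i>))) (- (2 * int m + 2))) y2 + P"
    by (intro exI[of _ "\<phi>2 N s (DTbar m) - sm (lmonom (const (1 / (2 * \<i>))) (- (2 * int m + 2))) y2"] conjI)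
      (unfold reg3_iff mser_diff mser_sm_mono_neg mser_\<phi>2 mser_y2,
        auto simp: mat2_eq_iff rv_def adj_nth U_neg_nth mat_mult_2 bar_mult bar_uminus const_uminus
          algebra_simps)
  show "\<sigma>2 s (DT m) = 0" "\<sigma>2 s (DTbar m) = 0" "\<sigma>2 s Rho = 0" by (cases s; simp)+
  show "reg3 (\<phi>2 N s (DT m))" "reg3 (\<phi>2 N s Rho)"
    by (auto simp: reg3_iff mser_\<phi>2 mat2_eq_iff rv_def U_neg_nth)
next
  fix k
  have *: "mser (sm (lmonom 1 (- 2 * int k)) (x2 N)) n = - rv (adj (S_ser N)) (n + 2 * int k)" for n
    unfolding mser_sm_mono mat_1_mult mser_minus_x2[symmetric] mser_neg by simp
  show "\<exists>P. reg3 P \<and> \<phi>2 N s (Sig k) = sm (lmonom 1 (- 2 * int k)) (x2 N) + P" if "s = Plus"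
    using that
    by (intro exI[of _ "\<phi>2 N s (Sig k) - sm (lmonom 1 (- 2 * int k)) (x2 N)"] conjI)
      (unfold reg3_iff mser_diff * mser_\<phi>2, auto simp: rv_def mat2_eq_iff adj_nth S_neg_nth add.commute)
  show "reg3 (\<phi>2 N s (Sig k))" if "s \<noteq> Plus"
    using that by (cases s) (auto simp: reg3_iff mser_\<phi>2 rv_def mat2_eq_iff S_neg_nth)
  show "\<sigma>2 s (Sig k) = lmonom 1 (- 2 * int k)" if "s = Plus" using that by simp
  show "\<sigma>2 s (Sig k) = lmonom (- 1) (2 * int k)" if "s \<noteq> Plus" using that by (cases s) auto
next
  show "low3 1 y2" unfolding y2_eq using y1_low by (rule low3_bt)
  show "low3 (- (2 * int N + 1)) (x2 N)" unfolding x2_eq using x1_low by (intro low3_rules low3_bt)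
  show "nul3 (SY_rel eul (x2 N) y2)" unfolding SY_rel_2 using SY_relation by (rule nul3_bt)
qed

end

subsection \<open>The equations of the system as equations of Laurent series\<close>

lemma sprod_zero: "sprod (\<lambda>_. 0) f n = 0" "sprod f (\<lambda>_. 0) n = 0"
  by (simp_all add: sprod_def)

lemma smprod_zero: "smprod (\<lambda>_. 0) A n = 0"
proof -
  have "mat 0 ** B = 0" for B :: mat2 by (simp add: mat2_eq_iff mat_mult_2)
  then show ?thesis by (simp add: smprod_def)
qed

lemma euler_zero: "euler (\<lambda>_. 0) = (\<lambda>_. 0)"
  by (simp add: euler_def fun_eq_iff)

lemma rv_apply: "rv A n = A (- n)"
  by (simp add: rv_def)

context
  fixes N :: nat and I :: "fn set"
  assumes I: "coeff_ideal I"
begin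

interpretation coeff_ideal I by (rule I)

lemma nul3_sm_mono: "nul3 (sm (lmonom 1 j) a) \<longleftrightarrow> nul3 a"
proof -
  have "nul (lmonom 1 j * f) \<longleftrightarrow> nul f" for f :: "fn fls"
    unfolding nul_def mono_times_nth by (simp, metis add_diff_cancel)
  then show ?thesis by (simp add: nul3_def sm_def)
qed

lemma mvanishesI: "A = mser a \<Longrightarrow> mvanishes I A \<longleftrightarrow> nul3 a"
  using mvanishes_mser[OF I] by simp

text \<open>The Euler derivative of the factor 1/\<lambda> in \<open>Y_hat\<close> is the origin of
  the summand -y in \<open>Y_term\<close>; afterwards this unit factor is dropped.\<close>

lemma Y_hat_equation_iff:
  assumes "derivation (D e)"
  shows "km_vanishes I (km_add (km_ext0 D Y_hat e) (km_bracket (Phi_km N s e) Y_hat))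
    \<longleftrightarrow> nul3 (lft (dmap (D e)) y1 + Y_term eul (\<phi>1 N s e) (\<sigma>1 s e) y1)"
proof -
  interpret d: derivation "D e" by fact
  interpret dd: derivation "dmap (D e)" by (rule d.derivation_dmap)
  interpret dl: derivation eul by (rule derivation_eul)
  let ?u = "lmonom 1 (- 1) :: fn fls"
  define z where "z = sm ?u y1"
  let ?X = "km_add (km_ext0 D Y_hat e) (km_bracket (Phi_km N s e) Y_hat)"
  have z: "shift (- 1) Y_ser = mser z"
    unfolding z_def
    by (rule ext, unfold mser_sm_mono_neg mser_y1) (simp add: shift_def mat_1_mult)
  have 1: "vanishes I (fst ?X)"
    by (simp add: vanishes_def km_add_def km_ext0_def Y_hat_def Phi_km_def ext0_def euler_zero
        sprod_zero d.zero zero)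
  have du: "dmap (D e) ?u = 0" by (rule d.dmap_mono) (rule d.one)
  have eu: "eul ?u = - ?u" by (rule fls_eqI) (simp add: mono_nth)
  have "snd ?X n = mser (lft (dmap (D e)) z + br (\<phi>1 N s e) z + sm (\<sigma>1 s e) (lft eul z)) n" for n
    unfolding mser_add mext0_mser[where D=D and e=e, OF assms, symmetric] lie_mser[symmetric]
        smprod_mser[symmetric]
      meuler_mser[symmetric] mser_\<phi>1 fls_nth_\<sigma>1
    by (simp add: km_add_def km_ext0_def Y_hat_def Phi_km_def z mext0_def smprod_zero)
  then have 2: "snd ?X = mser (lft (dmap (D e)) z + br (\<phi>1 N s e) z + sm (\<sigma>1 s e) (lft eul z))"
    by (rule ext)
  have 3: "lft (dmap (D e)) z + br (\<phi>1 N s e) z + sm (\<sigma>1 s e) (lft eul z) =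
      sm ?u (lft (dmap (D e)) y1 + Y_term eul (\<phi>1 N s e) (\<sigma>1 s e) y1)"
    by (simp add: z_def Y_term_def sl2_defs dd.rules dl.rules du eu algebra_simps)
  show ?thesis
    unfolding km_vanishes_def mvanishesI[OF 2] 3 nul3_sm_mono using 1 by simp
qed

lemma S_equation_iff:
  assumes "derivation (D e)"
  shows "mvanishes I (\<lambda>n. mext0 D (S_ser N) e n + lie (phi_hat N s e) (S_ser N) n
            + smprod (euler (sigma s e)) (S_ser N) n + smprod (sigma s e) (meuler (S_ser N)) n
            - meuler (phi_hat N s e) n)
    \<longleftrightarrow> nul3 (lft (dmap (D e)) (x1 N) + S_term eul (\<phi>1 N s e) (\<sigma>1 s e) (x1 N))"
proof (rule mvanishesI, rule ext)
  fix n
  show "mext0 D (S_ser N) e n + lie (phi_hat N s e) (S_ser N) n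
            + smprod (euler (sigma s e)) (S_ser N) n + smprod (sigma s e) (meuler (S_ser N)) n
            - meuler (phi_hat N s e) n
     = mser (lft (dmap (D e)) (x1 N) + S_term eul (\<phi>1 N s e) (\<sigma>1 s e) (x1 N)) n"
    unfolding S_term_def mser_add mser_diff mext0_mser[where D=D and e=e, OF assms, symmetric]
      lie_mser[symmetric] smprod_mser[symmetric]
      meuler_mser[symmetric] mser_\<phi>1 mser_x1 fls_nth_\<sigma>1 euler_nth[symmetric]
    by (simp add: add_ac)
qed

lemma Y_adjoint_iff:
  assumes "derivation (D e)"
  shows "mvanishes I (\<lambda>n. mext0 D (adj Y_ser) e n + lie (phi_hat N s e) (adj Y_ser) n
            + smprod (sigma s e) (\<lambda>m. meuler (adj Y_ser) m + adj Y_ser m) n)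
    \<longleftrightarrow> nul3 (lft (dmap (D e)) y2 + Y_term eul (\<phi>2 N s e) (\<sigma>2 s e) y2)"
    (is "mvanishes I ?L \<longleftrightarrow> nul3 ?R")
proof -
  interpret derivation "D e" by fact
  have a: "adj Y_ser = rv (mser y2)" "phi_hat N s e = rv (mser (\<phi>2 N s e))"
    by (simp_all add: mser_y2 mser_\<phi>2)
  have m: "(\<lambda>m. meuler (rv (mser y2)) m + rv (mser y2) m) = rv (mser (y2 - lft eul y2))"
    by (rule ext) (simp add: meuler_rv meuler_mser mser_diff rv_apply)
  have "?L = rv (mser (lft (dmap (D e)) y2 + br (\<phi>2 N s e) y2 + sm (- \<sigma>2 s e) (y2 - lft eul y2)))"
    unfolding a m mext0_rv mext0_mser[where D=D and e=e, OF assms] lie_rv lie_mser sigma_eq_rv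
        smprod_rv smprod_mser
    by (rule ext) (simp add: rv_apply mser_add)
  also have "lft (dmap (D e)) y2 + br (\<phi>2 N s e) y2 + sm (- \<sigma>2 s e) (y2 - lft eul y2) = ?R"
    by (simp add: Y_term_def sl2_defs algebra_simps)
  finally show ?thesis
    using mvanishes_rv[of I "mser ?R"] mvanishesI[OF refl, of ?R] by (simp only:)
qed

lemma S_adjoint_iff:
  assumes "derivation (D e)"
  shows "mvanishes I (\<lambda>n. mext0 D (adj (S_ser N)) e n + lie (phi_hat N s e) (adj (S_ser N)) n
            + smprod (euler (sigma s e)) (adj (S_ser N)) n
            + smprod (sigma s e) (meuler (adj (S_ser N))) n
            - meuler (phi_hat N s e) n)
    \<longleftrightarrow> nul3 (lft (dmap (D e)) (x2 N) + S_term eul (\<phi>2 N s e) (\<sigma>2 s e) (x2 N))"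
    (is "mvanishes I ?L \<longleftrightarrow> nul3 ?R")
proof -
  interpret derivation "D e" by fact
  interpret dd: derivation "dmap (D e)" by (rule derivation_dmap)
  interpret dl: derivation eul by (rule derivation_eul)
  let ?x = "- x2 N" and ?\<phi> = "\<phi>2 N s e" and ?\<sigma> = "\<sigma>2 s e"
  have a: "adj (S_ser N) = rv (mser ?x)" "phi_hat N s e = rv (mser ?\<phi>)"
    by (simp_all add: mser_minus_x2 mser_\<phi>2)
  have m: "meuler (rv (mser b)) = rv (mser (- lft eul b))" for b
    by (rule ext) (simp add: meuler_rv meuler_mser mser_neg rv_apply)
  have es: "euler (rv (fls_nth (- ?\<sigma>))) = rv (fls_nth (eul ?\<sigma>))"
    by (rule ext) (simp add: euler_rv euler_nth rv_apply)
  have "?L = rv (mser (lft (dmap (D e)) ?x + br ?\<phi> ?x + sm (eul ?\<sigma>) ?x + sm (- ?\<sigma>) (- lft eul ?x)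
      - (- lft eul ?\<phi>)))"
    unfolding a m mext0_rv mext0_mser[where D=D and e=e, OF assms] lie_rv lie_mser sigma_eq_rv es
        smprod_rv smprod_mser
    by (rule ext) (simp only: rv_apply mser_add mser_diff)
  also have "lft (dmap (D e)) ?x + br ?\<phi> ?x + sm (eul ?\<sigma>) ?x + sm (- ?\<sigma>) (- lft eul ?x)
      - (- lft eul ?\<phi>) = - ?R"
    by (simp add: S_term_def sl2_defs dd.rules dl.rules algebra_simps)
  finally have "mvanishes I ?L \<longleftrightarrow> nul3 (- ?R)"
    using mvanishes_rv[of I "mser (- ?R)"] mvanishesI[OF refl, of "- ?R"] by (simp only:)
  also have "\<dots> \<longleftrightarrow> nul3 ?R" by (metis minus_minus nul3_rules(3))
  finally show ?thesis .
qed

text \<open>The coefficients of the factor for the sign \<open>+\<close>; for the sign \<open>-\<close> they are read backwards.\<close>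

definition w1 :: "fn fls" where
  "w1 = Abs_fls (exp_u N Plus)"

lemma fls_nth_w1: "fls_nth w1 = exp_u N Plus"
  unfolding w1_def by (rule ext, rule nth_Abs_fls_lower_bound[of "2 * int N + 2"]) (simp add: exp_u_def)

lemma exp_u_Minus: "exp_u N Minus = rv (fls_nth w1)"
  by (rule ext) (simp add: fls_nth_w1 rv_apply exp_u_def)

text \<open>For \<open>Minus\<close> the coefficients are read in 1/\<lambda>. The signs of the
  Euler operator and of \<sigma> then cancel, so both signs share the equation of
  \<open>Plus\<close>.\<close>

lemma exp_u_equation_iff:
  assumes "derivation (D e)"
  shows "vanishes I (\<lambda>n. ext0 D (exp_u N s n) e
            + sprod (sigma s e) (euler (exp_u N s)) n - sprod (exp_u N s) (euler (sigma s e)) n)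
    \<longleftrightarrow> nul (dmap (D e) w1 + (\<sigma>1 Plus e * eul w1 - w1 * eul (\<sigma>1 Plus e)))"
    (is "vanishes I ?L \<longleftrightarrow> nul ?R")
proof (cases s)
  interpret derivation "D e" by fact
  case Plus
  have "?L = fls_nth ?R"
    unfolding Plus fls_nth_w1[symmetric] fls_nth_\<sigma>1[symmetric] euler_nth sprod_nth
    by (rule ext) (simp add: ext0_def)
  then show ?thesis using vanishes_fls_nth[OF I] by simp
next
  interpret derivation "D e" by fact
  case Minus
  have e1: "euler (rv (fls_nth (- \<sigma>1 Plus e))) = rv (fls_nth (eul (\<sigma>1 Plus e)))"
    and e2: "euler (rv (fls_nth w1)) = rv (fls_nth (- eul w1))"
    by (rule ext, simp add: euler_rv euler_nth rv_apply)+
  have "?L = rv (fls_nth ?R)"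
    unfolding Minus exp_u_Minus sigma_eq_rv flip.simps e1 e2 sprod_rv
    by (rule ext) (simp add: ext0_def rv_apply sprod_nth)
  then show ?thesis using vanishes_rv[of I "fls_nth ?R"] vanishes_fls_nth[OF I] by simp
qed

lemma sigma_struct_iff:
  assumes "derivation (D e)" "derivation (D f)"
  shows "vanishes I (fst (km_add (km_ext1 N D T (Phi_km N s) e f) (km_bracket (Phi_km N s e) (Phi_km N s f))))
    \<longleftrightarrow> nul (tsum N T (\<sigma>1 s) e f + (\<sigma>1 s e * eul (\<sigma>1 s f) - \<sigma>1 s f * eul (\<sigma>1 s e)))"
    (is "vanishes I ?L \<longleftrightarrow> nul ?R")
proof -
  have D: "D e (\<sigma>1 s f $$ n) = 0" "D f (\<sigma>1 s e $$ n) = 0" for n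
    using dmap_\<sigma>1[OF assms(1), of s f] dmap_\<sigma>1[OF assms(2), of s e]
      derivation.dmap_nth[OF assms(1), of "\<sigma>1 s f" n] derivation.dmap_nth[OF assms(2), of "\<sigma>1 s e" n]
    by simp_all
  have "?L = fls_nth ?R"
    by (rule ext) (simp add: km_add_def km_ext1_def Phi_km_def ext1_def tsum_def fls_nth_sum
        T_support_def D sprod_nth euler_nth mult.commute flip: fls_nth_\<sigma>1)
  then show ?thesis using vanishes_fls_nth[OF I] by simp
qed

lemma tsum3_nth:
  "fst (tsum3 N T a e f) $$ n = (\<Sum>c\<in>T_support N T e f. T c e f * fst (a c) $$ n)"
  "fst (snd (tsum3 N T a e f)) $$ n = (\<Sum>c\<in>T_support N T e f. T c e f * fst (snd (a c)) $$ n)"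
  "snd (snd (tsum3 N T a e f)) $$ n = (\<Sum>c\<in>T_support N T e f. T c e f * snd (snd (a c)) $$ n)"
  by (simp_all add: tsum3_def fst_sum snd_sum fls_nth_sum sm_def)

lemma mser_tsum3:
  "mser (tsum3 N T a e f) n $ i $ j = (\<Sum>c\<in>T_support N T e f. T c e f * mser (a c) n $ i $ j)"
  using exhaust_2[of i] exhaust_2[of j] by (auto simp: mser_def tsum3_nth sum_negf)

lemma struct_iff:
  assumes "derivation (D e)" "derivation (D f)"
  shows "mvanishes I (snd (km_add (km_ext1 N D T (Phi_km N s) e f) (km_bracket (Phi_km N s e)
      (Phi_km N s f))))
    \<longleftrightarrow> nul3 (tsum3 N T (\<phi>1 N s) e f + curvature D (\<phi>1 N s) (\<sigma>1 s) e f)"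
    (is "mvanishes I ?L \<longleftrightarrow> nul3 ?R")
proof (rule mvanishesI, rule ext)
  fix n
  have m: "mser (lft (dmap (D e)) a) n = (\<chi> i j. D e (mser a n $ i $ j))"
    "mser (lft (dmap (D f)) a) n = (\<chi> i j. D f (mser a n $ i $ j))" for a
    using mext0_mser[where D=D and e=e, OF assms(1), of a] mext0_mser[where D=D and e=f, OF assms(2), of a]
    by (auto simp: mext0_def ext0_def fun_eq_iff)
  show "?L n = mser ?R n"
    unfolding curvature_def curv_def mser_add mser_diff m lie_mser[symmetric] smprod_mser[symmetric]
      meuler_mser[symmetric] mser_\<phi>1 fls_nth_\<sigma>1
    by (simp add: mat2_eq_iff mser_tsum3 mser_\<phi>1 km_add_def km_ext1_def Phi_km_def ext1_def
        T_support_def mult.commute)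
qed

lemma struct_2:
  assumes "derivation (D e)" "derivation (D f)"
  shows "mser (tsum3 N T (\<phi>2 N s) e f + curvature D (\<phi>2 N s) (\<sigma>2 s) e f) =
    rv (mser (tsum3 N T (\<phi>1 N s) e f + curvature D (\<phi>1 N s) (\<sigma>1 s) e f))"
proof
  fix n
  have m: "mser (lft (dmap (D e)) a) n = (\<chi> i j. D e (mser a n $ i $ j))"
    "mser (lft (dmap (D f)) a) n = (\<chi> i j. D f (mser a n $ i $ j))" for a n
    using mext0_mser[where D=D and e=e, OF assms(1), of a] mext0_mser[where D=D and e=f, OF assms(2), of a]
    by (auto simp: mext0_def ext0_def fun_eq_iff)
  have br: "mser (br (\<phi>2 N s e) (\<phi>2 N s f)) = rv (mser (br (\<phi>1 N s e) (\<phi>1 N s f)))"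
    unfolding lie_mser[symmetric] mser_\<phi>1 mser_\<phi>2 lie_rv ..
  have sm: "mser (sm (\<sigma>2 s e) (lft eul (\<phi>2 N s f))) = rv (mser (sm (\<sigma>1 s e) (lft eul (\<phi>1 N s f))))" for e f
  proof -
    have 1: "fls_nth (\<sigma>2 s e) = rv (fls_nth (- \<sigma>1 s e))"
      by (rule ext) (simp add: \<sigma>2_nth rv_apply)
    have 2: "mser (lft eul (\<phi>2 N s f)) = rv (mser (- lft eul (\<phi>1 N s f)))"
      unfolding meuler_mser[symmetric] mser_\<phi>2 mser_\<phi>1[symmetric]
      by (rule ext) (simp add: meuler_rv meuler_mser mser_neg rv_apply)
    have "sm (- \<sigma>1 s e) (- a) = sm (\<sigma>1 s e) a" for a by (simp add: sl2_defs)
    then show ?thesis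
      unfolding smprod_mser[symmetric] 1 2 smprod_rv by (simp add: smprod_mser del: fls_uminus_nth)
  qed
  have ts: "mser (tsum3 N T (\<phi>2 N s) e f) n = mser (tsum3 N T (\<phi>1 N s) e f) (- n)"
    by (simp add: mat2_eq_iff mser_tsum3 mser_\<phi>1 mser_\<phi>2 rv_apply)
  show "mser (tsum3 N T (\<phi>2 N s) e f + curvature D (\<phi>2 N s) (\<sigma>2 s) e f) n =
    rv (mser (tsum3 N T (\<phi>1 N s) e f + curvature D (\<phi>1 N s) (\<sigma>1 s) e f)) n"
    unfolding curvature_def curv_def rv_apply mser_add mser_diff m br sm ts
    by (simp add: rv_apply mser_\<phi>1 mser_\<phi>2)
qed

lemma sigma_struct_2:
  "fls_nth (tsum N T (\<sigma>2 s) e f + (\<sigma>2 s e * eul (\<sigma>2 s f) - \<sigma>2 s f * eul (\<sigma>2 s e))) n =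
    - ((tsum N T (\<sigma>1 s) e f + (\<sigma>1 s e * eul (\<sigma>1 s f) - \<sigma>1 s f * eul (\<sigma>1 s e))) $$ (- n))"
proof -
  have 1: "fls_nth (\<sigma>2 s e) = rv (fls_nth (- \<sigma>1 s e))" for e
    by (rule ext) (simp add: \<sigma>2_nth rv_apply)
  have 2: "fls_nth (eul (\<sigma>2 s e)) = rv (fls_nth (eul (\<sigma>1 s e)))" for e
    by (rule ext) (simp add: \<sigma>2_nth rv_apply)
  have 3: "(\<sigma>2 s e * eul (\<sigma>2 s f)) $$ n = - ((\<sigma>1 s e * eul (\<sigma>1 s f)) $$ (- n))" for e f
    unfolding sprod_nth[symmetric] 1 2 sprod_rv by (simp add: rv_apply sprod_nth del: fls_uminus_nth) simp
  have "tsum N T (\<sigma>2 s) e f $$ n = - (tsum N T (\<sigma>1 s) e f $$ (- n))"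
    by (simp add: tsum_def fls_nth_sum \<sigma>2_nth sum_negf)
  then show ?thesis by (simp add: 3)
qed

end

subsection \<open>Compatibility\<close>

lemma bar_mser: "bar (mser a n $ i $ j) = mser (bt a) n $ j $ i"
  using exhaust_2[of i] exhaust_2[of j] by (auto simp: mser_def bt_def bar_uminus)

lemma mser_D:
  fixes D :: "basis_form \<Rightarrow> fn \<Rightarrow> fn"
  assumes "derivation (D e)"
  shows "mser (lft (dmap (D e)) a) n $ i $ j = D e (mser a n $ i $ j)"
  using fun_cong[OF mext0_mser[where D=D and e=e, OF assms], of a n, symmetric]
  by (simp add: mext0_def ext0_def)

lemma nul3_mser_nth:
  assumes "coeff_ideal I" "coeff_ideal.nul3 I a"
  shows "mser a n $ i $ j \<in> I"
  using assms(2) unfolding mvanishes_mser[OF assms(1), symmetric] mvanishes_def by blast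

lemma nul3_mserI:
  assumes "coeff_ideal I" "\<And>n i j. mser a n $ i $ j \<in> I"
  shows "coeff_ideal.nul3 I a"
  using assms(2) unfolding mvanishes_mser[OF assms(1), symmetric] mvanishes_def by blast

text \<open>Makes d^2 = 0 on the connection form a linear consequence of d^2 = 0 on the coefficients
  of Y, S and their adjoints.\<close>

lemma phi_hat_entry:
  "(\<exists>z. phi_hat N s g n $ i $ j = const z) \<or>
   (\<exists>z A m k l. A \<in> {Y_ser, S_ser N, adj Y_ser, adj (S_ser N)} \<and> phi_hat N s g n $ i $ j = const z
       * A m $ k $ l)"
proof -
  have zero: ?thesis if "phi_hat N s g n $ i $ j = 0"
    using that by (metis const_0)
  have *: ?thesis if "A \<in> {Y_ser, S_ser N, adj Y_ser, adj (S_ser N)}" "phi_hat N s g n $ i $ j =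
      const z * A m $ k $ l"
    for z A m k l
    using that by blast
  show ?thesis
  proof (cases "(N, s, g)" rule: phi_hat.cases)
    case (1 N' s')
    then show ?thesis
      using exhaust_2[of i] exhaust_2[of j] by (auto intro: exI[of _ 0])
  next
    case (2 N' s' m)
    then show ?thesis
      using zero *[of Y_ser] by (cases "n < 0") (auto simp: U_neg_nth mat_mult_2)
  next
    case (3 N' s' m)
    show ?thesis
    proof (cases "n > 0")
      case True
      then have "phi_hat N s g n $ i $ j =
          const (- cnj (1 / (2 * \<i>))) * adj Y_ser (- (- n + (2 * int m + 2))) $ i $ j"
        using 3 unfolding adj_nth minus_minus by (simp add: U_neg_nth mat_mult_2 bar_mult
            bar_uminus const_uminus adj_nth)
      then show ?thesis by (intro *) auto
    qed (use 3 zero in \<open>auto simp: adj_nth U_neg_nth\<close>)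
  next
    case (4 N' l)
    show ?thesis
    proof (cases "n > 0")
      case True
      then have "phi_hat N s g n $ i $ j = const (- 1) * adj (S_ser N) (- (- n + 2 * int l)) $ i $ j"
        using 4 unfolding adj_nth minus_minus by (simp add: S_neg_nth const_uminus adj_nth)
      then show ?thesis by (intro *) auto
    qed (use 4 zero in \<open>auto simp: adj_nth S_neg_nth\<close>)
  next
    case (5 N' k)
    then have "phi_hat N s g n $ i $ j = const 1 * S_ser N (n + 2 * int k) $ i $ j" if "n < 0"
      using that by (simp add: S_neg_nth)
    then show ?thesis
      using 5 zero *[of "S_ser N" 1] by (cases "n < 0") (auto simp: S_neg_nth)
  qed
qed

lemma fst_phi_0:
  "fst (\<phi>1 N s c) $$ 0 = (if c = Rho then const (\<i> / 2) else 0)"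
proof -
  have "fst (\<phi>1 N s c) $$ 0 = phi_hat N s c 0 $ 1 $ 1"
    using fun_cong[OF mser_\<phi>1, of N s c 0] by (auto simp: mser_def mat2_eq_iff)
  also have "\<dots> = (if c = Rho then const (\<i> / 2) else 0)"
    by (cases "(N, s, c)" rule: phi_hat.cases) (simp_all add: U_neg_nth S_neg_nth adj_nth)
  finally show ?thesis .
qed

lemma \<sigma>1_nth:
  "\<sigma>1 Plus c $$ n = (case c of Sig k \<Rightarrow> if n = 2 * int k then - 1 else 0 | _ \<Rightarrow> 0)"
  "\<sigma>1 Minus c $$ n = (case c of Sig k \<Rightarrow> if n = - 2 * int k then 1 else 0 | _ \<Rightarrow> 0)"
  by (cases c; simp add: mono_nth)+

section \<open>Consequences for an arbitrary solution\<close>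

locale cmc_system =
  fixes N :: nat and \<gamma> :: complex and s :: sgn
    and D :: "basis_form \<Rightarrow> fn \<Rightarrow> fn" and T :: "basis_form \<Rightarrow> form2"
  assumes real_gamma: "cnj \<gamma> = \<gamma>"
    and ext: "exterior_derivation N D T"
    and sys: "extended_CMC_system N \<gamma> s D T"
begin

abbreviation I :: "fn set" where "I \<equiv> rel_ideal N \<gamma>"

lemma deriv: "e \<in> coframe N \<Longrightarrow> derivation (D e)"
  using ext unfolding exterior_derivation_def derivation_def by blast

lemma D_const: "e \<in> coframe N \<Longrightarrow> D e (const z) = 0"
  using ext unfolding exterior_derivation_def by blast

lemma finite_support: "\<lbrakk>e \<in> coframe N; f \<in> coframe N\<rbrakk> \<Longrightarrow> finite (T_support N T e f)"
  using ext unfolding exterior_derivation_def T_support_def by blast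

sublocale coeff_ideal I
  by (rule coeff_ideal_rel_ideal)

lemma struct_eqs:
  assumes e: "e \<in> coframe N" and f: "f \<in> coframe N"
  shows "nul3 (tsum3 N T (\<phi>1 N s) e f + curvature D (\<phi>1 N s) (\<sigma>1 s) e f)"
    and "nul (tsum N T (\<sigma>1 s) e f + (\<sigma>1 s e * eul (\<sigma>1 s f) - \<sigma>1 s f * eul (\<sigma>1 s e)))"
proof -
  have "km_vanishes I (km_add (km_ext1 N D T (Phi_km N s) e f) (km_bracket (Phi_km N s e) (Phi_km N s f)))"
    using sys e f unfolding extended_CMC_system_def by blast
  then show "nul3 (tsum3 N T (\<phi>1 N s) e f + curvature D (\<phi>1 N s) (\<sigma>1 s) e f)"
    and "nul (tsum N T (\<sigma>1 s) e f + (\<sigma>1 s e * eul (\<sigma>1 s f) - \<sigma>1 s f * eul (\<sigma>1 s e)))"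
    unfolding km_vanishes_def
    using struct_iff[OF coeff_ideal_axioms deriv[OF e] deriv[OF f]]
      sigma_struct_iff[OF coeff_ideal_axioms deriv[OF e] deriv[OF f]] by blast+
qed

sublocale v1: cmc_view I N D T y1 "x1 N" "\<phi>1 N s" "\<sigma>1 s"
proof (intro cmc_view.intro cmc_view_axioms.intro coeff_ideal_axioms)
  fix e assume e: "e \<in> coframe N"
  note d = deriv[OF e]
  show "derivation (D e)" by (rule d)
  show "nul3 (lft (dmap (D e)) y1 + Y_term eul (\<phi>1 N s e) (\<sigma>1 s e) y1)"
    using sys e unfolding extended_CMC_system_def Y_hat_equation_iff[where D=D and e=e, OF
        coeff_ideal_axioms d, symmetric] by blast
  show "nul3 (lft (dmap (D e)) (x1 N) + S_term eul (\<phi>1 N s e) (\<sigma>1 s e) (x1 N))"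
    using sys e unfolding extended_CMC_system_def S_hat_equation_def S_equation_iff[where D=D and
        e=e, OF coeff_ideal_axioms d, symmetric]
    by blast
  fix f assume f: "f \<in> coframe N"
  show "dmap (D e) (\<sigma>1 s f) = 0" using d by (rule dmap_\<sigma>1)
qed (rule struct_eqs; assumption)+

sublocale v2: cmc_view I N D T y2 "x2 N" "\<phi>2 N s" "\<sigma>2 s"
proof (intro cmc_view.intro cmc_view_axioms.intro coeff_ideal_axioms)
  fix e assume e: "e \<in> coframe N"
  note d = deriv[OF e]
  show "derivation (D e)" by (rule d)
  show "nul3 (lft (dmap (D e)) y2 + Y_term eul (\<phi>2 N s e) (\<sigma>2 s e) y2)"
    using sys e unfolding extended_CMC_system_def adjoint_equations_def Y_adjoint_iff[where D=D
        and e=e, OF coeff_ideal_axioms d, symmetric] by blast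
  show "nul3 (lft (dmap (D e)) (x2 N) + S_term eul (\<phi>2 N s e) (\<sigma>2 s e) (x2 N))"
    using sys e unfolding extended_CMC_system_def adjoint_equations_def S_adjoint_iff[where D=D
        and e=e, OF coeff_ideal_axioms d, symmetric]
    by blast
  fix f assume f: "f \<in> coframe N"
  show "dmap (D e) (\<sigma>2 s f) = 0" using d by (rule dmap_\<sigma>1)
  show "nul3 (tsum3 N T (\<phi>2 N s) e f + curvature D (\<phi>2 N s) (\<sigma>2 s) e f)"
    using nul3_mser_nth[OF coeff_ideal_axioms struct_eqs(1)[OF e f]]
    by (intro nul3_mserI[OF coeff_ideal_axioms]) (simp add: struct_2[OF coeff_ideal_axioms d
        deriv[OF f]] rv_apply)
  show "nul (tsum N T (\<sigma>2 s) e f + (\<sigma>2 s e * eul (\<sigma>2 s f) - \<sigma>2 s f * eul (\<sigma>2 s e)))"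
    using struct_eqs(2)[OF e f] unfolding nul_def sigma_struct_2[OF coeff_ideal_axioms] by (simp
        only: neg_iff simp_thms)
qed

text \<open>The coefficient of the equation of Y at \<lambda> to the power 0, where by
  \<open>low_Y_term\<close> everything but the derivative lies in the ideal.\<close>

lemma D_low:
  assumes e: "e \<in> coframe N"
  shows "D e (fst y1 $$ 0) \<in> I" "D e (fst y2 $$ 0) \<in> I"
proof -
  interpret d: derivation "D e" using deriv[OF e] .
  have *: "D e (fst y $$ 0) \<in> I" if "nul3 (lft (dmap (D e)) y + K)" "low3 1 K" for y K
  proof -
    have "D e (fst y $$ 0) + fst K $$ 0 \<in> I"
      using that(1) by (auto simp: nul3_def nul_def lft_def dest: spec[of _ 0])
    moreover have "fst K $$ 0 \<in> I"
      using that(2) by (auto simp: low3_def low_def)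
    ultimately show ?thesis using diff by fastforce
  qed
  show "D e (fst y1 $$ 0) \<in> I" "D e (fst y2 $$ 0) \<in> I"
    using * v1.Y_equation[OF e] shaped.low_Y_term[OF shaped_1[of N \<gamma> s] e]
      v2.Y_equation[OF e] shaped.low_Y_term[OF shaped_2[of N \<gamma> s] e] by blast+
qed

lemma D_relation:
  assumes e: "e \<in> coframe N" and r: "r \<in> relations N \<gamma>"
  shows "D e r \<in> I" "D e (bar r) \<in> I"
proof -
  interpret d: derivation "D e" using deriv[OF e] .
  let ?c = "lmonom (const (4 * \<gamma>)) 2"
  have lmonom: "dmap (D e) ?c = 0" "eul ?c = 2 * ?c"
    using D_const[OF e] by (auto intro!: d.dmap_mono fls_eqI simp: mono_nth d.zero)
  have q1: "D e ((quad y1 - ?c) $$ n) \<in> I" for n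
    using v1.quad_preserved[OF e det_relation lmonom] by (auto simp: nul_def simp del: fls_minus_nth)
  have q2: "D e ((quad y2 - ?c) $$ n) \<in> I" for n
    using v2.quad_preserved[OF e det_relation_2[OF real_gamma] lmonom] by (auto simp: nul_def simp
        del: fls_minus_nth)
  have s1: "D e (mser (SY_rel eul (x1 N) y1) n $ i $ j) \<in> I" for n i j
    using nul3_mser_nth[OF coeff_ideal_axioms v1.SY_preserved[OF e SY_relation]]
    unfolding mser_D[where D=D and e=e, OF d.derivation_axioms] .
  have s2: "D e (mser (SY_rel eul (x2 N) y2) n $ i $ j) \<in> I" for n i j
    using nul3_mser_nth[OF coeff_ideal_axioms v2.SY_preserved[OF e shaped.SY[OF shaped_2[of N \<gamma> s]]]]
    unfolding mser_D[where D=D and e=e, OF d.derivation_axioms] .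
  from r consider "r = var (Fn (ACoef 1))"
    | n where "r = mdet Y_ser n + (if n = 2 then const (4 * \<gamma>) else 0)"
    | n i j where "r = (lie (S_ser N) Y_ser n - (Y_ser n - meuler Y_ser n)) $ i $ j"
    unfolding relations_def by blast
  then have "D e r \<in> I \<and> D e (bar r) \<in> I"
  proof cases
    case 1
    have "fst y1 $$ 0 = const (- \<i>) * r" "fst y2 $$ 0 = const \<i> * bar r"
      using fun_cong[OF mser_y1, of 0] fun_cong[OF mser_y2, of 0]
      by (auto simp: 1 Y_ser_def mat2_eq_iff mser_def rv_apply adj_nth bar_mult)
    then have "const (- \<i>) * D e r \<in> I" "const \<i> * D e (bar r) \<in> I"
      using D_low[OF e] D_const[OF e] by (simp_all add: d.mult)
    then have "const \<i> * (const (- \<i>) * D e r) \<in> I" "const (- \<i>) * (const \<i> * D e (bar r)) \<in> I"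
      using mult by blast+
    then show ?thesis by (simp add: mult.assoc[symmetric] const_mult[symmetric])
  next
    case (2 n)
    have "r = - ((quad y1 - ?c) $$ n)" by (simp add: 2 mdet_eq mono_nth)
    moreover have "bar r = - ((quad y2 - ?c) $$ n)"
      by (simp add: 2 mdet_eq mono_nth quad_2 bar_add bar_uminus bar_diff real_gamma)
    ultimately show ?thesis using q1[of n] q2[of n] by (simp only: d.neg neg_iff)
  next
    case (3 n i j)
    have "r = mser (SY_rel eul (x1 N) y1) n $ i $ j" unfolding 3 SY_series ..
    then show ?thesis using s1 s2 by (simp add: bar_mser SY_rel_2)
  qed
  then show "D e r \<in> I" "D e (bar r) \<in> I" by blast+
qed

lemma D_ideal:
  assumes e: "e \<in> coframe N" and r: "r \<in> I"
  shows "D e r \<in> I"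
proof -
  interpret d: derivation "D e" using deriv[OF e] .
  show ?thesis
    using r unfolding rel_ideal_def
  proof (induction rule: module.span_induct_alt[OF module_fn, consumes 1, case_names base step])
    case base
    then show ?case by (simp add: d.zero module.span_zero[OF module_fn])
  next
    case (step a r r')
    then have "D e r \<in> I" "r \<in> I"
      using D_relation[OF e] relation_in_ideal by auto
    then have "D e (a * r + r') \<in> I"
      using step(2) unfolding rel_ideal_def[symmetric] d.add d.mult by (intro add mult)
    then show ?case unfolding rel_ideal_def .
  qed
qed

lemma preserved: "v1.preserved" "v2.preserved"
  unfolding v1.preserved_def v2.preserved_def using D_ideal by blast+

lemma mser_dd:
  assumes e: "e \<in> coframe N" and f: "f \<in> coframe N"
  shows "mser (dd N D T e f a) n $ i $ j = ext1 N D T (ext0 D (mser a n $ i $ j)) e f"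
proof -
  have "(\<Sum>c\<in>T_support N T e f. T c e f * mser (lft (dmap (D c)) a) n $ i $ j) =
      (\<Sum>c\<in>T_support N T e f. D c (mser a n $ i $ j) * T c e f)"
    by (rule sum.cong) (auto simp: T_support_def mser_D deriv mult.commute)
  then show ?thesis
    by (simp add: dd_def mser_add mser_diff mser_tsum3[OF coeff_ideal_axioms]
        mser_D[where D=D and e=e, OF deriv[OF e]] mser_D[where D=D and e=f, OF deriv[OF f]]
            ext1_def ext0_def T_support_def)
qed

lemma ext1_uminus:
  assumes e: "e \<in> coframe N" and f: "f \<in> coframe N"
  shows "ext1 N D T (ext0 D (- p)) e f = - ext1 N D T (ext0 D p) e f"
proof -
  have "(\<Sum>c | c \<in> coframe N \<and> T c e f \<noteq> 0. D c (- p) * T c e f) =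
      (\<Sum>c | c \<in> coframe N \<and> T c e f \<noteq> 0. - (D c p * T c e f))"
    by (rule sum.cong) (auto simp: derivation.neg[OF deriv])
  then show ?thesis
    by (simp add: ext1_def ext0_def derivation.neg[OF deriv[OF e]] derivation.neg[OF deriv[OF f]] sum_negf)
qed

lemma ext1_const_mult:
  assumes e: "e \<in> coframe N" and f: "f \<in> coframe N"
  shows "ext1 N D T (ext0 D (const z * p)) e f = const z * ext1 N D T (ext0 D p) e f"
proof -
  have D: "D e (const z * p) = const z * D e p" if "e \<in> coframe N" for e p
    using derivation.mult[OF deriv[OF that]] D_const[OF that] by simp
  have "(\<Sum>c | c \<in> coframe N \<and> T c e f \<noteq> 0. D c (const z * p) * T c e f) =
      (\<Sum>c | c \<in> coframe N \<and> T c e f \<noteq> 0. const z * (D c p * T c e f))"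
    by (rule sum.cong) (auto simp: D mult.assoc)
  then show ?thesis
    by (simp add: ext1_def ext0_def D e f sum_distrib_left[symmetric] right_diff_distrib distrib_left)
qed

lemma ext1_const:
  assumes e: "e \<in> coframe N" and f: "f \<in> coframe N"
  shows "ext1 N D T (ext0 D (const z)) e f = 0"
  unfolding ext1_def ext0_def using D_const e f D_const[of _ 0]
  by (auto intro!: sum.neutral)

lemma d_squared_coefficient:
  assumes e: "e \<in> coframe N" and f: "f \<in> coframe N"
    and A: "A \<in> {Y_ser, S_ser N, adj Y_ser, adj (S_ser N)}"
  shows "ext1 N D T (ext0 D (A n $ i $ j)) e f \<in> I"
proof -
  have *: "ext1 N D T (ext0 D (mser a n $ i $ j)) e f \<in> I" if "nul3 (dd N D T e f a)" for a n
    using nul3_mser_nth[OF coeff_ideal_axioms that] unfolding mser_dd[OF e f] .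
  note 1 = *[OF v1.dd_Y[OF preserved(1) e f], of n] and 2 = *[OF v1.dd_S[OF preserved(1) e f], of n]
    and 3 = *[OF v2.dd_Y[OF preserved(2) e f], of "- n"] and 4 = *[OF v2.dd_S[OF preserved(2) e f], of "- n"]
  have "adj (S_ser N) n = - mser (x2 N) (- n)"
    using fun_cong[OF mser_minus_x2, of N "- n"] by (simp add: mser_neg rv_apply)
  then have "ext1 N D T (ext0 D (adj (S_ser N) n $ i $ j)) e f \<in> I"
    using 4 by (simp add: ext1_uminus[OF e f] neg_iff)
  then show ?thesis
    using A 1 2 3 by (auto simp: mser_y1 mser_x1 mser_y2 rv_apply)
qed

lemma dd_phi:
  assumes e: "e \<in> coframe N" and f: "f \<in> coframe N"
  shows "nul3 (dd N D T e f (\<phi>1 N s g))"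
proof (rule nul3_mserI[OF coeff_ideal_axioms], unfold mser_dd[OF e f] mser_\<phi>1)
  fix n and i j :: 2
  show "ext1 N D T (ext0 D (phi_hat N s g n $ i $ j)) e f \<in> I"
    using phi_hat_entry[of N s g n i j]
    by (elim disjE exE conjE)
      (auto simp only: ext1_const[OF e f] ext1_const_mult[OF e f] intro!: zero mult
          d_squared_coefficient[OF e f])
qed

text \<open>The conformal factor is always treated with \<open>\<sigma>1 Plus\<close>. For the sign
  \<open>Minus\<close> this is the vector field part of the second view.\<close>

lemma sigma_Plus_struct:
  assumes e: "e \<in> coframe N" and f: "f \<in> coframe N"
  shows "nul (tsum N T (\<sigma>1 Plus) e f + (\<sigma>1 Plus e * eul (\<sigma>1 Plus f) - \<sigma>1 Plus f * eul (\<sigma>1 Plus e)))"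
proof (cases s)
  case Plus
  then show ?thesis using v1.sigma_struct[OF e f] by simp
next
  case Minus
  then show ?thesis using v2.sigma_struct[OF e f] by simp
qed

lemma d_squared_factor:
  assumes e: "e \<in> coframe N" and f: "f \<in> coframe N"
  shows "ext1 N D T (ext0 D (exp_u N s n)) e f \<in> I"
proof -
  let ?\<sigma> = "\<sigma>1 Plus" and ?w = "w1 N"
  let ?E = "\<lambda>e. dmap (D e) ?w + (?\<sigma> e * eul ?w - ?w * eul (?\<sigma> e))"
  let ?TD = "\<Sum>c\<in>T_support N T e f. fls_const (T c e f) * dmap (D c) ?w"
  let ?TE = "\<Sum>c\<in>T_support N T e f. fls_const (T c e f) * ?E c"
  let ?S = "tsum N T ?\<sigma> e f"
  let ?Ss = "?S + (?\<sigma> e * eul (?\<sigma> f) - ?\<sigma> f * eul (?\<sigma> e))"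
  have E: "nul (?E e)" if "e \<in> coframe N" for e
    using sys that unfolding extended_CMC_system_def S_hat_equation_def
      exp_u_equation_iff[where D=D and e=e and s=s, OF coeff_ideal_axioms deriv[OF that], symmetric] by blast
  have DE: "nul (dmap (D e) a)" if "nul a" "e \<in> coframe N" for a e
    using that D_ideal by (simp add: nul_def derivation.dmap_nth[OF deriv])
  interpret commuting_derivations "dmap (D e)" "dmap (D f)" eul using v1.commuting[OF e f] .
  have TD: "?TD = ?TE - (?S * eul ?w - ?w * eul ?S)"
    by (simp add: tsum_def dl.sum dl.mult eul_const sum_distrib_left sum_distrib_right
        sum_subtractf sum.distrib distrib_left right_diff_distrib mult_ac)
  have TE: "nul ?TE"
    unfolding nul_def fls_nth_sum
    using E by (auto intro!: sum mult simp: nul_def T_support_def)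
  have "dmap (D e) (dmap (D f) ?w) - dmap (D f) (dmap (D e) ?w) + ?TD =
      dmap (D e) (?E f) - dmap (D f) (?E e) - (?\<sigma> f * eul (?E e) - ?E e * eul (?\<sigma> f))
      + (?\<sigma> e * eul (?E f) - ?E f * eul (?\<sigma> e)) + ?TE - (?Ss * eul ?w - ?w * eul ?Ss)"
    by (rule factor_second_derivative[where S="?S"]) (simp_all add: TD dmap_\<sigma>1 deriv e f)
  also have "nul \<dots>"
    by (rule nul_rules(2)[OF nul_rules(1)[OF nul_rules(1)[OF nul_rules(2)[OF nul_rules(2)
      [OF DE[OF E[OF f] e] DE[OF E[OF e] f]] nul_rules(2)[OF nul_mult'[OF nul_rules(4)[OF E[OF
          e]]] nul_mult[OF E[OF e]]]]
      nul_rules(2)[OF nul_mult'[OF nul_rules(4)[OF E[OF f]]] nul_mult[OF E[OF f]]]] TE]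
      nul_rules(2)[OF nul_mult[OF sigma_Plus_struct[OF e f]]
        nul_mult'[OF nul_rules(4)[OF sigma_Plus_struct[OF e f]]]]])
  finally have *: "ext1 N D T (ext0 D (?w $$ n)) e f \<in> I" for n
  proof -
    assume *: "nul (dmap (D e) (dmap (D f) ?w) - dmap (D f) (dmap (D e) ?w) + ?TD)"
    have "(\<Sum>c\<in>T_support N T e f. T c e f * dmap (D c) ?w $$ n) =
        (\<Sum>c\<in>T_support N T e f. D c (?w $$ n) * T c e f)"
      by (rule sum.cong) (auto simp: T_support_def derivation.dmap_nth[OF deriv] mult.commute)
    then have "ext1 N D T (ext0 D (?w $$ n)) e f =
        (dmap (D e) (dmap (D f) ?w) - dmap (D f) (dmap (D e) ?w) + ?TD) $$ n"
      by (simp add: ext1_def ext0_def fls_nth_sum T_support_def derivation.dmap_nth[OF deriv] e f)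
    then show ?thesis using *[unfolded nul_def, rule_format, of n] by (simp only:)
  qed
  show ?thesis
    using *[of n] *[of "- n"]
    by (cases s) (simp_all add: fls_nth_w1[OF coeff_ideal_axioms] exp_u_Minus[OF coeff_ideal_axioms] rv_apply)
qed

lemma d_squared_forms:
  assumes mem: "e \<in> coframe N" "f \<in> coframe N" "g \<in> coframe N" and c: "c \<in> coframe N"
  shows "ext2 N D T (T c) e f g \<in> I"
proof -
  \<comment> \<open>Covers dt_m and its conjugate, whose differentials the system puts into the
    ideal.\<close>
  have trivial: "ext2 N D T (T c) e f g \<in> I"
    if "\<And>e f. \<lbrakk>e \<in> coframe N; f \<in> coframe N\<rbrakk> \<Longrightarrow> T c e f \<in> I"
    unfolding ext2_def using that mem D_ideal by (intro add sum mult) auto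
  show ?thesis
  proof (cases c)
    case Rho
    have *: "const (- 2 * \<i>) * const (\<i> / 2) = 1"
      by (simp add: const_mult[symmetric])
    show ?thesis
      unfolding Rho
      by (rule v1.Rho_closed[OF preserved(1) mem dd_phi *])
        (auto simp: fst_phi_0 D_const finite_support)
  next
    case (Sig k)
    show ?thesis
    proof (cases s)
      case Plus
      show ?thesis
        \<comment> \<open>For the sign \<open>Plus\<close> the form \<open>Sig k\<close> sits at
          \<lambda> to the power 2k with coefficient -1, which is its own inverse.\<close>
        by (rule v1.Sig_closed[OF preserved(1) mem, of "- 1" "- 1" c "2 * int k"])
          (auto simp: Sig Plus c[unfolded Sig] finite_support derivation.rules deriv \<sigma>1_nth
            split: basis_form.splits)
    next
      case Minus
      show ?thesis
        by (rule v1.Sig_closed[OF preserved(1) mem, of 1 1 c "- 2 * int k"])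
          (auto simp: Sig Minus c[unfolded Sig] finite_support derivation.rules deriv \<sigma>1_nth
            split: basis_form.splits)
    qed
  next
    case (DT m)
    then show ?thesis
      using c sys by (intro trivial) (auto simp: extended_CMC_system_def coframe_def)
  next
    case (DTbar m)
    then show ?thesis
      using c sys by (intro trivial) (auto simp: extended_CMC_system_def coframe_def)
  qed
qed

lemma compatible: "preserves_relations N \<gamma> D \<and> d_squared_zero N \<gamma> s D T"
  unfolding preserves_relations_def d_squared_zero_def coefficients_def ext0_def[of D]
  using D_ideal d_squared_forms d_squared_coefficient d_squared_factor
  unfolding ext0_def[abs_def] by auto

end

subsection \<open>Existence of the exterior derivation\<close>

text \<open>Coefficients of the wrong parity vanish because all series lie in the twisted loop algebra; they
  correspond to no unknown, so the equations for them have to hold by themselves.\<close>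

definition par :: "bool \<Rightarrow> fn fls \<Rightarrow> bool" where
  "par b f \<longleftrightarrow> (\<forall>n. even n \<noteq> b \<longrightarrow> f $$ n = 0)"

lemma par_mult: "\<lbrakk>par a f; par b g; c \<longleftrightarrow> a = b\<rbrakk> \<Longrightarrow> par c (f * g)"
  unfolding par_def
proof (intro allI impI)
  fix n :: int
  assume fg: "\<forall>n. even n \<noteq> a \<longrightarrow> f $$ n = 0" "\<forall>n. even n \<noteq> b \<longrightarrow> g $$ n = 0"
    and c: "c \<longleftrightarrow> a = b" "even n \<noteq> c"
  have "f $$ i * g $$ (n - i) = 0" for i
    using fg(1)[rule_format, of i] fg(2)[rule_format, of "n - i"] c by (cases "even i = a") auto
  then show "(f * g) $$ n = 0" by (simp add: fls_times_nth(2))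
qed

lemma par_rules:
  "par b 0" "\<lbrakk>par b f; par b g\<rbrakk> \<Longrightarrow> par b (f + g)" "\<lbrakk>par b f; par b g\<rbrakk> \<Longrightarrow> par b (f - g)"
  "par b f \<Longrightarrow> par b (- f)" "par b f \<Longrightarrow> par b (eul f)" "par b f \<Longrightarrow> par b (2 * f)"
  by (auto simp: par_def)

definition twisted :: "fn fls sl2 \<Rightarrow> bool" where
  "twisted a \<longleftrightarrow> par True (fst a) \<and> par False (fst (snd a)) \<and> par False (snd (snd a))"

lemma twisted_rules:
  "twisted 0" "\<lbrakk>twisted a; twisted b\<rbrakk> \<Longrightarrow> twisted (a + b)" "\<lbrakk>twisted a; twisted b\<rbrakk> \<Longrightarrow> twisted (a - b)"
  "twisted a \<Longrightarrow> twisted (- a)" "twisted a \<Longrightarrow> twisted (lft eul a)"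
  "\<lbrakk>par True f; twisted a\<rbrakk> \<Longrightarrow> twisted (sm f a)" "\<lbrakk>twisted a; twisted b\<rbrakk> \<Longrightarrow> twisted (br a b)"
  by (auto simp: twisted_def lft_def sm_def br_def intro!: par_rules intro: par_mult)

lemma twisted_dmap: "\<lbrakk>derivation d; twisted a\<rbrakk> \<Longrightarrow> twisted (lft (dmap d) a)"
  by (auto simp: twisted_def lft_def par_def derivation.dmap_nth derivation.zero)

lemma twisted_sum: "(\<And>c. c \<in> A \<Longrightarrow> twisted (f c)) \<Longrightarrow> twisted (sum f A)"
  by (induction A rule: infinite_finite_induct) (auto intro: twisted_rules)

lemma twisted_bt: "twisted a \<Longrightarrow> twisted (bt a)"
  by (auto simp: twisted_def bt_def par_def)

lemma twisted_iff: "twisted a \<longleftrightarrow>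
    (\<forall>n. (odd n \<longrightarrow> mser a n $ 1 $ 1 = 0) \<and> (even n \<longrightarrow> mser a n $ 1 $ 2 = 0 \<and> mser a n $ 2 $ 1 = 0))"
  by (auto simp: twisted_def par_def mser_def)

lemma twisted_y1: "twisted y1"
  by (auto simp: twisted_iff mser_y1 Y_ser_def)

lemma twisted_x1: "twisted (x1 N)"
  by (auto simp: twisted_iff mser_x1 S_ser_def)

lemma phi_hat_parity:
  "odd n \<Longrightarrow> phi_hat N s e n $ 1 $ 1 = 0"
  "even n \<Longrightarrow> phi_hat N s e n $ 1 $ 2 = 0" "even n \<Longrightarrow> phi_hat N s e n $ 2 $ 1 = 0"
  by (cases "(N, s, e)" rule: phi_hat.cases;
      auto simp: U_neg_nth S_neg_nth adj_nth mat_mult_2 Y_ser_def S_ser_def)+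

lemma twisted_\<phi>1: "twisted (\<phi>1 N s e)" and twisted_\<phi>2: "twisted (\<phi>2 N s e)"
  by (auto simp: twisted_iff mser_\<phi>1 mser_\<phi>2 rv_apply phi_hat_parity)

lemma par_\<sigma>1: "par True (\<sigma>1 s e)"
  by (cases "(s, e)" rule: \<sigma>1.cases) (auto simp: par_def mono_nth)

lemma twisted_Y_term: "\<lbrakk>twisted a; par True f; twisted b\<rbrakk> \<Longrightarrow> twisted (Y_term eul a f b)"
  and twisted_S_term: "\<lbrakk>twisted a; par True f; twisted b\<rbrakk> \<Longrightarrow> twisted (S_term eul a f b)"
  and twisted_curv: "\<lbrakk>twisted a; par True f; twisted b; par True g\<rbrakk> \<Longrightarrow> twisted (curv eul a f b g)"
  unfolding Y_term_def S_term_def curv_def by (intro twisted_rules par_rules; assumption)+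

lemma y1_nth:
  "fst y1 $$ n = (if n \<ge> 0 \<and> even n then const (- \<i>) * var (Fn (ACoef (nat n + 1))) else 0)"
  "fst (snd y1) $$ n = (if n \<ge> 0 \<and> odd n then 2 * var (Fn (CCoef (nat n + 1))) else 0)"
  "snd (snd y1) $$ n = (if n \<ge> 0 \<and> odd n then 2 * var (Fn (BCoef (nat n + 1))) else 0)"
  using fun_cong[OF mser_y1, of n] by (auto simp: Y_ser_def mat2_eq_iff mser_def split: if_splits)

lemma x1_nth:
  "fst (x1 N) $$ n = (if n \<ge> - (2 * int N + 1) \<and> even n then var (Fn (SDiag n)) else 0)"
  "fst (snd (x1 N)) $$ n = (if n \<ge> - (2 * int N + 1) \<and> odd n then var (Fn (SUpper n)) else 0)"
  "snd (snd (x1 N)) $$ n = (if n \<ge> - (2 * int N + 1) \<and> odd n then var (Fn (SLower n)) else 0)"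
  using fun_cong[OF mser_x1, of N n] by (auto simp: S_ser_def mat2_eq_iff mser_def split: if_splits)

lemma y2_nth:
  "fst y2 $$ n = (if n \<ge> 0 \<and> even n then const \<i> * var (Conj (ACoef (nat n + 1))) else 0)"
  "fst (snd y2) $$ n = (if n \<ge> 0 \<and> odd n then 2 * var (Conj (BCoef (nat n + 1))) else 0)"
  "snd (snd y2) $$ n = (if n \<ge> 0 \<and> odd n then 2 * var (Conj (CCoef (nat n + 1))) else 0)"
  by (auto simp: y2_eq bt_def y1_nth bar_mult)

lemma x2_nth:
  "fst (x2 N) $$ n = (if n \<ge> - (2 * int N + 1) \<and> even n then - var (Conj (SDiag n)) else 0)"
  "fst (snd (x2 N)) $$ n = (if n \<ge> - (2 * int N + 1) \<and> odd n then - var (Conj (SLower n)) else 0)"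
  "snd (snd (x2 N)) $$ n = (if n \<ge> - (2 * int N + 1) \<and> odd n then - var (Conj (SUpper n)) else 0)"
  by (auto simp: x2_eq bt_def x1_nth bar_uminus)

lemma w1_nth:
  "w1 N $$ n = (if n \<ge> 2 * int N + 2 \<and> even n
     then var (Fn (ECoef (nat ((n - (2 * int N + 2)) div 2)))) else 0)"
proof -
  have "w1 N $$ n = exp_u N Plus n"
    using fls_nth_w1[OF coeff_ideal_rel_ideal] by simp
  then show ?thesis by (auto simp: exp_u_def)
qed

definition factor_term :: "nat \<Rightarrow> basis_form \<Rightarrow> fn fls" where
  "factor_term N e = \<sigma>1 Plus e * eul (w1 N) - w1 N * eul (\<sigma>1 Plus e)"

definition K1 :: "nat \<Rightarrow> sgn \<Rightarrow> basis_form \<Rightarrow> fn fls sl2" where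
  "K1 N s e = Y_term eul (\<phi>1 N s e) (\<sigma>1 s e) y1"
definition K2 :: "nat \<Rightarrow> sgn \<Rightarrow> basis_form \<Rightarrow> fn fls sl2" where
  "K2 N s e = Y_term eul (\<phi>2 N s e) (\<sigma>2 s e) y2"
definition L1 :: "nat \<Rightarrow> sgn \<Rightarrow> basis_form \<Rightarrow> fn fls sl2" where
  "L1 N s e = S_term eul (\<phi>1 N s e) (\<sigma>1 s e) (x1 N)"
definition L2 :: "nat \<Rightarrow> sgn \<Rightarrow> basis_form \<Rightarrow> fn fls sl2" where
  "L2 N s e = S_term eul (\<phi>2 N s e) (\<sigma>2 s e) (x2 N)"

text \<open>The derivatives of the unknowns, read off from the equations. \<open>ACoef k\<close> belongs to \<open>\<lambda>\<close> to the power
  \<open>k - 1\<close>. The derivatives of the conjugates of \<open>ECoef k\<close> are not prescribed by the system.\<close>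

fun gen :: "nat \<Rightarrow> sgn \<Rightarrow> basis_form \<Rightarrow> coord \<Rightarrow> fn" where
  "gen N s e (Fn (ACoef k)) = const (- \<i>) * fst (K1 N s e) $$ (int k - 1)"
| "gen N s e (Fn (BCoef k)) = const (- 1 / 2) * snd (snd (K1 N s e)) $$ (int k - 1)"
| "gen N s e (Fn (CCoef k)) = const (- 1 / 2) * fst (snd (K1 N s e)) $$ (int k - 1)"
| "gen N s e (Fn (SDiag n)) = - fst (L1 N s e) $$ n"
| "gen N s e (Fn (SUpper n)) = - fst (snd (L1 N s e)) $$ n"
| "gen N s e (Fn (SLower n)) = - snd (snd (L1 N s e)) $$ n"
| "gen N s e (Fn (ECoef k)) = - factor_term N e $$ (2 * int N + 2 + 2 * int k)"
| "gen N s e (Conj (ACoef k)) = const \<i> * fst (K2 N s e) $$ (int k - 1)"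
| "gen N s e (Conj (BCoef k)) = const (- 1 / 2) * fst (snd (K2 N s e)) $$ (int k - 1)"
| "gen N s e (Conj (CCoef k)) = const (- 1 / 2) * snd (snd (K2 N s e)) $$ (int k - 1)"
| "gen N s e (Conj (SDiag n)) = fst (L2 N s e) $$ n"
| "gen N s e (Conj (SUpper n)) = snd (snd (L2 N s e)) $$ n"
| "gen N s e (Conj (SLower n)) = fst (snd (L2 N s e)) $$ n"
| "gen N s e (Conj (ECoef k)) = 0"

definition DD :: "nat \<Rightarrow> sgn \<Rightarrow> basis_form \<Rightarrow> fn \<Rightarrow> fn" where
  "DD N s e = poly_deriv (gen N s e)"

lemma derivation_DD: "derivation (DD N s e)"
  unfolding DD_def by (rule derivation_poly_deriv)

lemma DD_const: "DD N s e (const z) = 0"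
  unfolding DD_def by (rule poly_deriv_const)

lemma DD_var: "DD N s e (var v) = gen N s e v"
  unfolding DD_def by (rule poly_deriv_var)

lemma half_2: "2 * (const (- (1 / 2)) * p) = - p"
proof -
  have "2 * (const (- (1 / 2)) * p) = const 2 * const (- (1 / 2)) * p"
    using const_of_int[of 2] by (simp add: mult.assoc)
  also have "\<dots> = - p" unfolding const_mult[symmetric] by (simp add: const_uminus)
  finally show ?thesis .
qed

lemma i_i: "const \<i> * (const \<i> * p) = - p" "const (- \<i>) * (const (- \<i>) * p) = - p"
  unfolding mult.assoc[symmetric] const_mult[symmetric] by (simp_all add: const_uminus)

text \<open>On \<open>Rho\<close> the factor comes from 2i times i/2 = -1, where i/2 is the diagonal
  entry of \<phi> along \<open>Rho\<close>: the diagonal coefficient of the structure equation at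
  \<lambda> to the power 0 becomes 0. On \<open>Sig k\<close> these are the structure constants dual
  to the bracket of the fields \<lambda>^(2k) times the Euler operator; the formula is the same for
  both signs.\<close>

fun TT :: "nat \<Rightarrow> sgn \<Rightarrow> basis_form \<Rightarrow> form2" where
  "TT N s Rho e f = const (2 * \<i>) * fst (curvature (DD N s) (\<phi>1 N s) (\<sigma>1 s) e f) $$ 0"
| "TT N s (Sig k) (Sig a) (Sig b) = (if a + b = k then of_int (2 * (int b - int a)) else 0)"
| "TT N s _ _ _ = 0"

text \<open>Requiring F to vanish where T does gives one formula also when the listed value of T
  happens to be 0, as for \<open>Sig a\<close> paired with itself.\<close>

lemma sum_T_support:
  fixes F :: "basis_form \<Rightarrow> 'a::comm_monoid_add"
  assumes e: "e \<in> coframe N" and f: "f \<in> coframe N"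
    and F: "\<And>c. TT N s c e f = 0 \<Longrightarrow> F c = 0"
  shows "sum F (T_support N (TT N s) e f) =
    F Rho + (case (e, f) of (Sig a, Sig b) \<Rightarrow> F (Sig (a + b)) | _ \<Rightarrow> 0)"
proof -
  let ?K = "{Rho} \<union> (case (e, f) of (Sig a, Sig b) \<Rightarrow> {Sig (a + b)} | _ \<Rightarrow> {})"
  have "c \<in> ?K" if "c \<in> T_support N (TT N s) e f" for c
    using that by (cases "(N, s, c, e, f)" rule: TT.cases) (auto simp: T_support_def split: if_splits)
  moreover have "?K \<subseteq> coframe N"
    using e f by (auto simp: coframe_def split: basis_form.splits)
  ultimately have "sum F (T_support N (TT N s) e f) = sum F ?K"
    by (intro sum.mono_neutral_left) (auto simp: T_support_def F split: basis_form.splits)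
  also have "\<dots> = F Rho + (case (e, f) of (Sig a, Sig b) \<Rightarrow> F (Sig (a + b)) | _ \<Rightarrow> 0)"
    by (auto split: basis_form.splits)
  finally show ?thesis .
qed

lemma finite_T_support: "finite (T_support N (TT N s) e f)"
proof -
  have "T_support N (TT N s) e f \<subseteq> {Rho} \<union> (case (e, f) of (Sig a, Sig b) \<Rightarrow> {Sig (a + b)} | _ \<Rightarrow> {})"
  proof
    fix c assume "c \<in> T_support N (TT N s) e f"
    then show "c \<in> {Rho} \<union> (case (e, f) of (Sig a, Sig b) \<Rightarrow> {Sig (a + b)} | _ \<Rightarrow> {})"
      by (cases "(N, s, c, e, f)" rule: TT.cases) (auto simp: T_support_def split: if_splits)
  qed
  then show ?thesis
    by (rule finite_subset) (auto split: basis_form.splits)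
qed

lemma TT_swap: "TT N s c e f = - TT N s c f e"
proof (cases "c = Rho")
  case True
  then show ?thesis using curvature_swap[of "DD N s" "\<phi>1 N s" "\<sigma>1 s" e f] by simp
next
  case False
  then show ?thesis
    by (cases "(N, s, c, e, f)" rule: TT.cases; cases f; cases e) auto
qed

lemma exterior_derivation_DD: "exterior_derivation N (DD N s) (TT N s)"
  unfolding exterior_derivation_def
proof (intro conjI ballI allI)
  fix e f c p q z
  show "DD N s e (p + q) = DD N s e p + DD N s e q"
    and "DD N s e (p * q) = DD N s e p * q + p * DD N s e q"
    using derivation_DD by (simp_all add: derivation.add derivation.mult)
  show "DD N s e (const z) = 0" by (rule DD_const)
  show "TT N s c e f = - TT N s c f e" by (rule TT_swap)
  show "finite {c \<in> coframe N. TT N s c e f \<noteq> 0}"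
    using finite_T_support[of N s e f] by (simp add: T_support_def)
qed

section \<open>Verification of the equations for the constructed derivation\<close>

context
  fixes N :: nat and \<gamma> :: complex and s :: sgn and I :: "fn set"
  defines "I \<equiv> rel_ideal N \<gamma>"
begin

interpretation coeff_ideal I
  unfolding I_def by (rule coeff_ideal_rel_ideal)

interpretation s1: shaped I N y1 "x1 N" "\<phi>1 N s" "\<sigma>1 s" DT DTbar "s = Minus" "1 / (2 * \<i>)"
  unfolding I_def by (rule shaped_1)

interpretation s2: shaped I N y2 "x2 N" "\<phi>2 N s" "\<sigma>2 s" DTbar DT "s = Plus" "1 / (2 * \<i>)"
  unfolding I_def by (rule shaped_2)

lemma nul3I:
  assumes "\<And>n. fst a $$ n \<in> I" "\<And>n. fst (snd a) $$ n \<in> I" "\<And>n. snd (snd a) $$ n \<in> I"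
  shows "nul3 a"
  using assms by (simp add: nul3_def nul_def)

lemma low3_twisted_nth:
  assumes "low3 k a" "twisted a" "\<not> (n \<ge> k \<and> even n)"
  shows "fst a $$ n \<in> I"
  using assms by (cases "even n") (auto simp: low3_def low_def twisted_def par_def zero)

lemma low3_twisted_nth':
  assumes "low3 k a" "twisted a" "\<not> (n \<ge> k \<and> odd n)"
  shows "fst (snd a) $$ n \<in> I" "snd (snd a) $$ n \<in> I"
  using assms by (cases "even n"; auto simp: low3_def low_def twisted_def par_def zero)+

text \<open>Where an unknown exists the coefficient vanishes by the choice of \<open>gen\<close>;
  elsewhere the order and the parity of \<open>K1\<close> put it into the ideal. Since a^1 is an
  unknown too, order 0 is the relevant bound. The next three lemmas argue in the same way.\<close>

lemma DD_Y1:
  assumes e: "e \<in> coframe N"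
  shows "nul3 (lft (dmap (DD N s e)) y1 + Y_term eul (\<phi>1 N s e) (\<sigma>1 s e) y1)"
proof -
  interpret d: derivation "DD N s e" by (rule derivation_DD)
  have low: "low3 0 (K1 N s e)"
    using low3_mono[OF s1.low_Y_term[OF e], of 0] by (simp add: K1_def)
  have tw: "twisted (K1 N s e)"
    unfolding K1_def by (intro twisted_Y_term twisted_\<phi>1 par_\<sigma>1 twisted_y1)
  show ?thesis
    unfolding K1_def[symmetric]
    using low3_twisted_nth[OF low tw] low3_twisted_nth'[OF low tw]
    by (intro nul3I) (auto simp: lft_def y1_nth d.rules DD_const DD_var i_i half_2 zero)
qed

lemma DD_Y2:
  assumes e: "e \<in> coframe N"
  shows "nul3 (lft (dmap (DD N s e)) y2 + Y_term eul (\<phi>2 N s e) (\<sigma>2 s e) y2)"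
proof -
  interpret d: derivation "DD N s e" by (rule derivation_DD)
  have low: "low3 0 (K2 N s e)"
    using low3_mono[OF s2.low_Y_term[OF e], of 0] by (simp add: K2_def)
  have tw: "twisted (K2 N s e)"
    unfolding K2_def y2_eq by (intro twisted_Y_term twisted_\<phi>2 par_\<sigma>1 twisted_bt twisted_y1)
  show ?thesis
    unfolding K2_def[symmetric]
    using low3_twisted_nth[OF low tw] low3_twisted_nth'[OF low tw]
    by (intro nul3I) (auto simp: lft_def y2_nth d.rules DD_const DD_var i_i half_2 zero)
qed

lemma DD_S1:
  assumes e: "e \<in> coframe N"
  shows "nul3 (lft (dmap (DD N s e)) (x1 N) + S_term eul (\<phi>1 N s e) (\<sigma>1 s e) (x1 N))"
proof -
  interpret d: derivation "DD N s e" by (rule derivation_DD)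
  have low: "low3 (- (2 * int N + 1)) (L1 N s e)"
    unfolding L1_def by (rule s1.low_S_term[OF e])
  have tw: "twisted (L1 N s e)"
    unfolding L1_def by (intro twisted_S_term twisted_\<phi>1 par_\<sigma>1 twisted_x1)
  show ?thesis
    unfolding L1_def[symmetric]
    using low3_twisted_nth[OF low tw] low3_twisted_nth'[OF low tw]
    by (intro nul3I) (auto simp: lft_def x1_nth d.zero DD_var zero)
qed

lemma DD_S2:
  assumes e: "e \<in> coframe N"
  shows "nul3 (lft (dmap (DD N s e)) (x2 N) + S_term eul (\<phi>2 N s e) (\<sigma>2 s e) (x2 N))"
proof -
  interpret d: derivation "DD N s e" by (rule derivation_DD)
  have low: "low3 (- (2 * int N + 1)) (L2 N s e)"
    unfolding L2_def by (rule s2.low_S_term[OF e])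
  have tw: "twisted (L2 N s e)"
    unfolding L2_def x2_eq by (intro twisted_S_term twisted_\<phi>2 par_\<sigma>1 twisted_rules(4) twisted_bt twisted_x1)
  show ?thesis
    unfolding L2_def[symmetric]
    using low3_twisted_nth[OF low tw] low3_twisted_nth'[OF low tw]
    by (intro nul3I) (auto simp: lft_def x2_nth d.zero d.neg DD_var zero)
qed

lemma DD_factor: "nul (dmap (DD N s e) (w1 N) + factor_term N e)"
proof -
  interpret d: derivation "DD N s e" by (rule derivation_DD)
  have eul_mono': "eul (lmonom c j) = lmonom (of_int j * c) j" for c :: fn and j
    by (rule fls_eqI) (simp add: mono_nth)
  have out: "factor_term N e $$ n = 0" if "\<not> (n \<ge> 2 * int N + 2 \<and> even n)" for n
  proof (cases e)
    case (Sig k)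
    have "(w1 N * lmonom c j) $$ n = c * w1 N $$ (n - j)" for c j n
      by (subst mult.commute) (rule mono_times_nth)
    then have "factor_term N e $$ n = (- of_int (n - 2 * int k) + of_int (2 * int k)) * w1 N $$ (n
        - 2 * int k)"
      by (simp add: Sig factor_term_def eul_mono' mono_times_nth left_diff_distrib)
    \<comment> \<open>Multiplication by \<lambda>^(2k) raises powers by an even nonnegative number,
      so nothing appears below or between the powers of the factor.\<close>
    also have "w1 N $$ (n - 2 * int k) = 0" using that by (auto simp: w1_nth)
    finally show ?thesis by simp
  qed (simp_all add: factor_term_def derivation.zero[OF derivation_eul])
  show ?thesis
    unfolding nul_def
  proof
    fix n
    show "(dmap (DD N s e) (w1 N) + factor_term N e) $$ n \<in> I"
    proof (cases "n \<ge> 2 * int N + 2 \<and> even n")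
      case True
      then have "2 * int N + 2 + 2 * int (nat ((n - (2 * int N + 2)) div 2)) = n" by auto
      then show ?thesis using True by (simp add: w1_nth DD_var zero)
    next
      case False
      then show ?thesis by (auto simp: w1_nth d.zero out zero)
    qed
  qed
qed

text \<open>The pole left by the curvature on \<open>Sig a\<close> and \<open>Sig b\<close> is a
  multiple of S shifted by 2(a + b). The connection along \<open>Sig (a + b)\<close> has this same
  polar part, and T supplies the opposite coefficient.\<close>

lemma TT_low:
  assumes "shaped I N y x \<phi> \<sigma> p q pole c"
    and e: "e \<in> coframe N" and f: "f \<in> coframe N"
    and "\<And>e. e \<in> coframe N \<Longrightarrow> nul3 (lft (dmap (DD N s e)) y + Y_term eul (\<phi> e) (\<sigma> e) y)"
    and "\<And>e. e \<in> coframe N \<Longrightarrow> nul3 (lft (dmap (DD N s e)) x + S_term eul (\<phi> e) (\<sigma> e) x)"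
  shows "low3 0 (tsum3 N (TT N s) \<phi> e f + curvature (DD N s) \<phi> \<sigma> e f)"
proof -
  interpret shaped I N y x \<phi> \<sigma> p q pole c by fact
  let ?X = "case (e, f) of (Sig a, Sig b) \<Rightarrow> sm (fls_const (of_int (2 * (int b - int a)))) (\<phi> (Sig
      (a + b))) | _ \<Rightarrow> 0"
  have "tsum3 N (TT N s) \<phi> e f = sm (fls_const (TT N s Rho e f)) (\<phi> Rho) + ?X"
    unfolding tsum3_def
    by (subst sum_T_support[OF e f]) (auto simp: sm_zero_left split: basis_form.splits)
  then have eq: "tsum3 N (TT N s) \<phi> e f + curvature (DD N s) \<phi> \<sigma> e f =
      (sm (fls_const (TT N s Rho e f)) (\<phi> Rho) + (?X + curvature_pole e f))
      + (curvature (DD N s) \<phi> \<sigma> e f - curvature_pole e f)"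
    by (simp add: algebra_simps)
  have low_sm: "low3 0 (sm (fls_const t) P)" if "reg3 P" for t P
    using low3_sm[OF low_const reg3_low3[OF that]] by simp
  have "low3 0 (?X + curvature_pole e f)"
  proof (cases "\<exists>a b. e = Sig a \<and> f = Sig b")
    case True
    then obtain a b where ab: "e = Sig a" "f = Sig b" by blast
    then have N: "N < a + b" using e f by (auto simp: coframe_def)
    show ?thesis
    proof (cases pole)
      case True
      obtain P where P: "reg3 P" "\<phi> (Sig (a + b)) = sm (lmonom 1 (- 2 * int (a + b))) x + P"
        using pole_shape(1)[OF True N] by blast
      have "sm (fls_const (of_int (2 * (int b - int a)))) (\<phi> (Sig (a + b)))
          + sm (lmonom (of_int (2 * (int a - int b))) (- 2 * int (a + b))) x
          = sm (fls_const (of_int (2 * (int b - int a)))) P"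
        unfolding P(2)
        by (simp add: sm_def prod_eq_iff fls_eq_iff mono_times_nth) (simp add: algebra_simps)
      then show ?thesis
        using low_sm[OF P(1)] True unfolding curvature_pole_def ab by simp
    next
      case False
      then show ?thesis
        using low_sm[OF no_pole_shape(1)[OF False N]] unfolding curvature_pole_def ab by simp
    qed
  next
    case False
    then have "?X + curvature_pole e f = 0"
      by (auto simp: curvature_pole_def split: basis_form.splits)
    then show ?thesis by (simp add: low3_def low_zero)
  qed
  moreover have "low3 0 (curvature (DD N s) \<phi> \<sigma> e f - curvature_pole e f)"
    using assms(4,5) e f by (intro curvature_low derivation_DD DD_const)
  ultimately show ?thesis
    unfolding eq using low3_rules(1)[OF low3_rules(1)[OF low_sm[OF Rho_shape(1)]]] by blast
qed

lemma TT_struct: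
  assumes e: "e \<in> coframe N" and f: "f \<in> coframe N"
  shows "nul3 (tsum3 N (TT N s) (\<phi>1 N s) e f + curvature (DD N s) (\<phi>1 N s) (\<sigma>1 s) e f)"
    (is "nul3 ?V")
proof -
  let ?V2 = "tsum3 N (TT N s) (\<phi>2 N s) e f + curvature (DD N s) (\<phi>2 N s) (\<sigma>2 s) e f"
  have low1: "low3 0 ?V"
    by (rule TT_low[OF s1.shaped_axioms e f DD_Y1 DD_S1])
  have low2: "low3 0 ?V2"
    by (rule TT_low[OF s2.shaped_axioms e f DD_Y2 DD_S2])
  have mser_low: "mser a n $ i $ j \<in> I" if "low3 0 a" "n < 0" for a n i j
    using that exhaust_2[of i] exhaust_2[of j] by (auto simp: mser_def low3_def low_def neg)
  have V2: "mser ?V2 = rv (mser ?V)"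
    by (rule struct_2[OF coeff_ideal_axioms derivation_DD derivation_DD])
  have tw: "twisted ?V"
    unfolding curvature_def tsum3_def
    by (intro twisted_rules twisted_sum twisted_dmap twisted_curv derivation_DD twisted_\<phi>1 par_\<sigma>1)
      (auto simp: par_def)
  have "fst ?V $$ 0 = TT N s Rho e f * const (\<i> / 2) + fst (curvature (DD N s) (\<phi>1 N s) (\<sigma>1 s) e f) $$ 0"
    unfolding fst_add fls_plus_nth tsum3_nth[OF coeff_ideal_axioms]
    by (subst sum_T_support[OF e f]) (auto simp: fst_phi_0 split: basis_form.splits)
  also have "TT N s Rho e f * const (\<i> / 2) = const (2 * \<i> * (\<i> / 2)) * fst (curvature (DD N s)
      (\<phi>1 N s) (\<sigma>1 s) e f) $$ 0"
    unfolding const_mult[of "2 * \<i>"] by (simp add: mult_ac)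
  finally have V0: "fst ?V $$ 0 = 0" by (simp add: const_uminus)
  show ?thesis
  proof (rule nul3_mserI[OF coeff_ideal_axioms])
    fix n :: int and i j :: 2
    consider "n < 0" | "n = 0" | "n > 0" by linarith
    then show "mser ?V n $ i $ j \<in> I"
    proof cases
      case 1
      then show ?thesis by (rule mser_low[OF low1])
    next
      case 2
      \<comment> \<open>The entries off the diagonal vanish by parity; the diagonal one is the
        coefficient for which \<open>TT\<close> on \<open>Rho\<close> was chosen.\<close>
      then show ?thesis
        using V0 tw exhaust_2[of i] exhaust_2[of j] unfolding twisted_def par_def
        by (auto simp: mser_def zero simp del: fst_add snd_add)
    next
      case 3
      then have "mser ?V2 (- n) $ i $ j \<in> I" by (intro mser_low[OF low2]) simp
      then show ?thesis unfolding V2 by (simp only: rv_apply minus_minus)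
    qed
  qed
qed

lemma TT_sigma:
  assumes e: "e \<in> coframe N" and f: "f \<in> coframe N"
  shows "nul (tsum N (TT N s) (\<sigma>1 s) e f + (\<sigma>1 s e * eul (\<sigma>1 s f) - \<sigma>1 s f * eul (\<sigma>1 s e)))"
proof -
  have "\<sigma>1 s Rho = 0" by (cases s) simp_all
  then have "tsum N (TT N s) (\<sigma>1 s) e f =
      (case (e, f) of (Sig a, Sig b) \<Rightarrow> fls_const (of_int (2 * (int b - int a))) * \<sigma>1 s (Sig (a + b)) | _ \<Rightarrow> 0)"
    unfolding tsum_def by (subst sum_T_support[OF e f]) (auto split: basis_form.splits)
  moreover have "(case (e, f) of (Sig a, Sig b) \<Rightarrow> fls_const (of_int (2 * (int b - int a))) * \<sigma>1 s
      (Sig (a + b)) | _ \<Rightarrow> 0)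
      + (\<sigma>1 s e * eul (\<sigma>1 s f) - \<sigma>1 s f * eul (\<sigma>1 s e)) = 0"
  proof (cases "\<exists>a b. e = Sig a \<and> f = Sig b")
    case True
    then obtain a b where ab: "e = Sig a" "f = Sig b" by blast
    show ?thesis
      by (cases s; rule fls_eqI) (auto simp: ab mono_times_nth mono_nth algebra_simps)
  next
    case False
    then have "\<sigma>1 s e = 0 \<or> \<sigma>1 s f = 0"
      by (cases s; cases e; cases f) auto
    then show ?thesis
      using False by (auto simp: derivation.zero[OF derivation_eul] split: basis_form.splits)
  qed
  ultimately show ?thesis by (simp add: nul_zero)
qed

lemma extended_CMC_system_DD: "extended_CMC_system N \<gamma> s (DD N s) (TT N s)"
  unfolding extended_CMC_system_def S_hat_equation_def adjoint_equations_def I_def[symmetric]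
proof (intro conjI ballI allI impI)
  fix e assume e: "e \<in> coframe N"
  note d = derivation_DD[of N s e]
  note ix = coeff_ideal_axioms
  show "km_vanishes I (km_add (km_ext0 (DD N s) Y_hat e) (km_bracket (Phi_km N s e) Y_hat))"
    unfolding Y_hat_equation_iff[where D="DD N s" and e=e, OF ix d] using e by (rule DD_Y1)
  show "vanishes I (\<lambda>n. ext0 (DD N s) (exp_u N s n) e
            + sprod (sigma s e) (euler (exp_u N s)) n - sprod (exp_u N s) (euler (sigma s e)) n)"
    unfolding exp_u_equation_iff[where D="DD N s" and e=e, OF ix d] factor_term_def[symmetric] by
        (rule DD_factor)
  show "mvanishes I (\<lambda>n. mext0 (DD N s) (S_ser N) e n + lie (phi_hat N s e) (S_ser N) n
            + smprod (euler (sigma s e)) (S_ser N) n + smprod (sigma s e) (meuler (S_ser N)) n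
            - meuler (phi_hat N s e) n)"
    unfolding S_equation_iff[where D="DD N s" and e=e, OF ix d] using e by (rule DD_S1)
  show "mvanishes I (\<lambda>n. mext0 (DD N s) (adj Y_ser) e n + lie (phi_hat N s e) (adj Y_ser) n
            + smprod (sigma s e) (\<lambda>m. meuler (adj Y_ser) m + adj Y_ser m) n)"
    unfolding Y_adjoint_iff[where D="DD N s" and e=e, OF ix d] using e by (rule DD_Y2)
  show "mvanishes I (\<lambda>n. mext0 (DD N s) (adj (S_ser N)) e n + lie (phi_hat N s e) (adj (S_ser N)) n
            + smprod (euler (sigma s e)) (adj (S_ser N)) n
            + smprod (sigma s e) (meuler (adj (S_ser N))) n
            - meuler (phi_hat N s e) n)"
    unfolding S_adjoint_iff[where D="DD N s" and e=e, OF ix d] using e by (rule DD_S2)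
  fix f assume f: "f \<in> coframe N"
  show "km_vanishes I (km_add (km_ext1 N (DD N s) (TT N s) (Phi_km N s) e f) (km_bracket (Phi_km N
      s e) (Phi_km N s f)))"
    unfolding km_vanishes_def
      struct_iff[where D="DD N s" and e=e and f=f, OF ix d derivation_DD]
      sigma_struct_iff[where D="DD N s" and e=e and f=f, OF ix d derivation_DD]
    using TT_struct[OF e f] TT_sigma[OF e f] by blast
  show "TT N s (DT m) e f \<in> I" "TT N s (DTbar m) e f \<in> I" for m
    by (simp_all add: zero)
qed

end

theorem theorem8p1:
  fixes N :: nat and \<gamma> :: complex and s :: sgn
  assumes "\<gamma> \<noteq> 0" and "cnj \<gamma> = \<gamma>"
  shows "(\<exists>D T. exterior_derivation N D T \<and> extended_CMC_system N \<gamma> s D T) \<and>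
    (\<forall>D T. exterior_derivation N D T \<and> extended_CMC_system N \<gamma> s D T \<longrightarrow>
       preserves_relations N \<gamma> D \<and> d_squared_zero N \<gamma> s D T)"
  using exterior_derivation_DD extended_CMC_system_DD
    cmc_system.compatible[OF cmc_system.intro[OF assms(2)]] by blast

end
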